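(* Let $\varphi$ be a holomorphic self-map of the unit disc $\mathbb{D}$, let $\alpha\in(0,1)$ and let $0<p\le 2/(1-\alpha)$. If $C_\varphi\in\mathcal{S}_p(\mathcal{D}_\alpha)$, then $\mathrm{cap}_\alpha(E_\varphi)=0$.
   Context: $dA(z)=dx\,dy/\pi$ and $dA_\alpha(z)=(1+\alpha)(1-|z|^2)^\alpha dA(z)$ on $\mathbb{D}$. The weighted Dirichlet space $\mathcal{D}_\alpha$ ($0\le\alpha\le1$) consists of analytic functions $f$ on $\mathbb{D}$ with $\mathcal{D}_\alpha(f)=\int_{\mathbb{D}}|f'|^2dA_\alpha<\infty$, a Hilbert space with $\|f\|_\alpha^2=|f(0)|^2+\mathcal{D}_\alpha(f)$. $C_\varphi f=f\circ\varphi$. A compact operator on a Hilbert space $\mathcal{H}$ belongs to $\mathcal{S}_p(\mathcal{H})$ if its sequence of singular numbers belongs to $\ell^p$. With $\mathbb{T}=\partial\mathbb{D}$ and $\varphi(\zeta)$ the non-tangential limit of $\varphi$ at $\zeta\in\mathbb{T}$ where it exists, the contact set is $E_\varphi=\{\zeta\in\mathbb{T}: |\varphi(\zeta)|\ge1\}$ (so $|\varphi(\zeta)|=1$ there). For $0\le\alpha<1$ and a Borel probability measure $\mu$ on $\mathbb{T}$, $I_\alpha(\mu)=\sum_{n\ge1}|\widehat\mu(n)|^2/n^{1-\alpha}$. For closed $E\subset\mathbb{T}$, $\mathrm{cap}_\alpha(E)=1/\inf\{I_\alpha(\mu):\mu\text{ a probability measure on }E\}$ (equal to $0$ if there is no such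 $\mu$ of finite energy); for Borel $E$, $\mathrm{cap}_\alpha(E)=\sup\{\mathrm{cap}_\alpha(F): F\subset E,\ F\text{ closed}\}$. *)

theory Defs
  imports
    "HOL-Complex_Analysis.Complex_Analysis"
    "HOL-Probability.Probability"
    "HOL-Library.Function_Algebras"
begin

section \<open>Schatten classes on Hilbert spaces of complex functions\<close>

text \<open>
  A Hilbert space of functions on \<open>'a\<close> is given by its carrier \<open>H\<close>, a linear subspace
  of \<open>'a \<Rightarrow> complex\<close>, and its inner product \<open>ip\<close>, linear in the first argument.
\<close>

definition fun_scale :: "complex \<Rightarrow> ('a \<Rightarrow> complex) \<Rightarrow> 'a \<Rightarrow> complex" where
  "fun_scale c f = (\<lambda>z. c * f z)"

lemma vector_space_fun_scale: "vector_space (fun_scale :: complex \<Rightarrow> ('a \<Rightarrow> complex) \<Rightarrow> _)"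
  by unfold_locales (auto simp: fun_scale_def fun_eq_iff algebra_simps)

definition hnorm :: "(('a \<Rightarrow> complex) \<Rightarrow> ('a \<Rightarrow> complex) \<Rightarrow> complex) \<Rightarrow> ('a \<Rightarrow> complex) \<Rightarrow> real" where
  "hnorm ip f = sqrt (Re (ip f f))"

definition linear_operator_on ::
    "('a \<Rightarrow> complex) set \<Rightarrow> (('a \<Rightarrow> complex) \<Rightarrow> 'a \<Rightarrow> complex) \<Rightarrow> bool" where
  "linear_operator_on H T \<longleftrightarrow>
     (\<forall>f\<in>H. T f \<in> H) \<and>
     (\<forall>f\<in>H. \<forall>g\<in>H. T (f + g) = T f + T g) \<and>
     (\<forall>c. \<forall>f\<in>H. T (fun_scale c f) = fun_scale c (T f))"

definition compact_operator_on ::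
    "('a \<Rightarrow> complex) set \<Rightarrow> (('a \<Rightarrow> complex) \<Rightarrow> ('a \<Rightarrow> complex) \<Rightarrow> complex)
      \<Rightarrow> (('a \<Rightarrow> complex) \<Rightarrow> 'a \<Rightarrow> complex) \<Rightarrow> bool" where
  "compact_operator_on H ip T \<longleftrightarrow>
     linear_operator_on H T \<and>
     (\<forall>f :: nat \<Rightarrow> 'a \<Rightarrow> complex.
        (\<forall>n. f n \<in> H) \<and> (\<exists>B. \<forall>n. hnorm ip (f n) \<le> B) \<longrightarrow>
        (\<exists>g\<in>H. \<exists>r :: nat \<Rightarrow> nat. strict_mono r \<and>
           (\<lambda>n. hnorm ip (T (f (r n)) - g)) \<longlonglongrightarrow> 0))"

definition adjoint_on ::
    "('a \<Rightarrow> complex) set \<Rightarrow> (('a \<Rightarrow> complex) \<Rightarrow> ('a \<Rightarrow> complex) \<Rightarrow> complex)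
      \<Rightarrow> (('a \<Rightarrow> complex) \<Rightarrow> 'a \<Rightarrow> complex) \<Rightarrow> ('a \<Rightarrow> complex) \<Rightarrow> 'a \<Rightarrow> complex" where
  "adjoint_on H ip T f = (THE g. g \<in> H \<and> (\<forall>h\<in>H. ip (T h) f = ip h g))"

definition eigenspace_on ::
    "('a \<Rightarrow> complex) set \<Rightarrow> (('a \<Rightarrow> complex) \<Rightarrow> 'a \<Rightarrow> complex) \<Rightarrow> complex
      \<Rightarrow> ('a \<Rightarrow> complex) set" where
  "eigenspace_on H S c = {f \<in> H. S f = fun_scale c f}"

text \<open>
  The singular numbers of a compact \<open>T\<close> are the square roots of the eigenvalues of
  \<open>T\<^sup>* T\<close>, in decreasing order and repeated according to multiplicity; the sequence is
  continued by zeros when \<open>T\<close> has finite rank. For compact \<open>T\<close> there is exactly one such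
  sequence, and the eigenspaces for \<open>t > 0\<close> are finite-dimensional. The limit \<open>0\<close>, together
  with monotonicity, makes the terms nonnegative and the sets \<open>{n. s n = t}\<close> finite.
\<close>

definition singular_numbers_on ::
    "('a \<Rightarrow> complex) set \<Rightarrow> (('a \<Rightarrow> complex) \<Rightarrow> ('a \<Rightarrow> complex) \<Rightarrow> complex)
      \<Rightarrow> (('a \<Rightarrow> complex) \<Rightarrow> 'a \<Rightarrow> complex) \<Rightarrow> (nat \<Rightarrow> real) \<Rightarrow> bool" where
  "singular_numbers_on H ip T s \<longleftrightarrow>
     decseq s \<and> s \<longlonglongrightarrow> 0 \<and>
     (\<forall>t>0. card {n. s n = t} =
        vector_space.dim fun_scale
          (eigenspace_on H (\<lambda>f. adjoint_on H ip T (T f)) (complex_of_real (t\<^sup>2))))"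

definition schatten_class_on ::
    "('a \<Rightarrow> complex) set \<Rightarrow> (('a \<Rightarrow> complex) \<Rightarrow> ('a \<Rightarrow> complex) \<Rightarrow> complex)
      \<Rightarrow> real \<Rightarrow> (('a \<Rightarrow> complex) \<Rightarrow> 'a \<Rightarrow> complex) set" where
  "schatten_class_on H ip p =
     {T. compact_operator_on H ip T \<and>
         (\<exists>s. singular_numbers_on H ip T s \<and> summable (\<lambda>n. s n powr p))}"


section \<open>Weighted Dirichlet spaces and composition operators\<close>

definition disc_measure :: "real \<Rightarrow> complex measure" where
  "disc_measure \<alpha> = density (restrict_space lborel (ball 0 1))
     (\<lambda>z. ennreal ((1 + \<alpha>) * (1 - (cmod z)\<^sup>2) powr \<alpha> / pi))"

definition dirichlet_integral :: "real \<Rightarrow> (complex \<Rightarrow> complex) \<Rightarrow> real" where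
  "dirichlet_integral \<alpha> f = (LINT z|disc_measure \<alpha>. (cmod (deriv f z))\<^sup>2)"

text \<open>
  A function on the disc is represented by its extension by \<open>0\<close>, so that equality of
  elements is equality of functions on the disc.
\<close>

definition dirichlet_space :: "real \<Rightarrow> (complex \<Rightarrow> complex) set" where
  "dirichlet_space \<alpha> =
     {f. f holomorphic_on ball 0 1 \<and> (\<forall>z. z \<notin> ball 0 1 \<longrightarrow> f z = 0) \<and>
         integrable (disc_measure \<alpha>) (\<lambda>z. (cmod (deriv f z))\<^sup>2)}"

definition dirichlet_inner :: "real \<Rightarrow> (complex \<Rightarrow> complex) \<Rightarrow> (complex \<Rightarrow> complex) \<Rightarrow> complex" where
  "dirichlet_inner \<alpha> f g =
     f 0 * cnj (g 0) + (LINT z|disc_measure \<alpha>. deriv f z * cnj (deriv g z))"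

lemma dirichlet_norm:
  "(hnorm (dirichlet_inner \<alpha>) f)\<^sup>2 = (cmod (f 0))\<^sup>2 + dirichlet_integral \<alpha> f"
proof -
  have "dirichlet_inner \<alpha> f f = complex_of_real ((cmod (f 0))\<^sup>2 + dirichlet_integral \<alpha> f)"
    unfolding dirichlet_inner_def dirichlet_integral_def
    by (simp add: complex_norm_square[symmetric] del: of_real_power)
  moreover have "0 \<le> dirichlet_integral \<alpha> f"
    unfolding dirichlet_integral_def by simp
  ultimately show ?thesis
    unfolding hnorm_def by simp
qed

definition composition_operator ::
    "(complex \<Rightarrow> complex) \<Rightarrow> (complex \<Rightarrow> complex) \<Rightarrow> complex \<Rightarrow> complex" where
  "composition_operator \<phi> f = (\<lambda>z. if z \<in> ball 0 1 then f (\<phi> z) else 0)"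


section \<open>Non-tangential limits and the contact set\<close>

definition stolz_region :: "complex \<Rightarrow> real \<Rightarrow> complex set" where
  "stolz_region \<zeta> M = {z \<in> ball 0 1. cmod (z - \<zeta>) < M * (1 - cmod z)}"

definition has_nontangential_limit :: "(complex \<Rightarrow> complex) \<Rightarrow> complex \<Rightarrow> complex \<Rightarrow> bool" where
  "has_nontangential_limit \<phi> w \<zeta> \<longleftrightarrow>
     (\<forall>M>1. (\<phi> \<longlongrightarrow> w) (at \<zeta> within stolz_region \<zeta> M))"

definition contact_set :: "(complex \<Rightarrow> complex) \<Rightarrow> complex set" where
  "contact_set \<phi> = {\<zeta> \<in> sphere 0 1. \<exists>w. has_nontangential_limit \<phi> w \<zeta> \<and> 1 \<le> cmod w}"


section \<open>Capacity\<close>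

definition circle_prob_measures :: "complex set \<Rightarrow> complex measure set" where
  "circle_prob_measures E =
     {\<mu>. prob_space \<mu> \<and> sets \<mu> = sets (restrict_space borel (sphere 0 1)) \<and>
         emeasure \<mu> (E \<inter> sphere 0 1) = 1}"

definition fourier_coeff :: "complex measure \<Rightarrow> int \<Rightarrow> complex" where
  "fourier_coeff \<mu> n = (LINT \<zeta>|\<mu>. \<zeta> powi (- n))"

definition energy :: "real \<Rightarrow> complex measure \<Rightarrow> ennreal" where
  "energy \<alpha> \<mu> =
     (\<Sum>k. ennreal ((cmod (fourier_coeff \<mu> (int (Suc k))))\<^sup>2 / real (Suc k) powr (1 - \<alpha>)))"

text \<open>
  The conventions of \<^typ>\<open>ennreal\<close> give capacity \<open>0\<close> if no measure has finite energy. They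
  also give the whole circle capacity \<open>\<infinity>\<close>: the sum defining the energy omits \<open>n = 0\<close>, so
  normalized arc length has energy \<open>0\<close>.
\<close>

definition closed_capacity :: "real \<Rightarrow> complex set \<Rightarrow> ennreal" where
  "closed_capacity \<alpha> F = 1 / (INF \<mu>\<in>circle_prob_measures F. energy \<alpha> \<mu>)"

definition capacity :: "real \<Rightarrow> complex set \<Rightarrow> ennreal" where
  "capacity \<alpha> E = (SUP F\<in>{F. closed F \<and> F \<subseteq> E}. closed_capacity \<alpha> F)"

end

theory Submission
  imports Defs
begin

text \<open>
Suppose that a closed subset \<open>F\<close> of the contact set carries a probability measure \<open>\<mu>\<close> of finite
energy. The operator is tested on the monomials \<open>z\<^bsup>n\<^esup>\<close>, which it sends to the powers \<open>\<phi>\<^bsup>n\<^esup>\<close>.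

These powers cannot be small in norm. If \<open>\<bar>h\<bar> \<le> 1\<close>, then the complex measure \<open>h \<mu>\<close> has energy at most
a constant times that of \<open>\<mu>\<close> (\<open>twisted_energy_le\<close>). The reason is that the energy is a double
integral of the kernel \<open>(1 - z)\<^bsup>-\<alpha>\<^esup>\<close>, whose modulus is at most a constant times its real
part (\<open>cmod_riesz_kernel_le\<close>). The energy being dual to the Dirichlet norm, the integrals of
\<open>h \<zeta> * f (r \<zeta>)\<close> with respect to \<open>\<mu>\<close> are bounded by \<open>K \<parallel>f\<parallel>\<close>, with \<open>K\<close> independent of \<open>r < 1\<close>
and of \<open>h\<close> (\<open>integral_against_bounded_le\<close>). For \<open>f = \<phi>\<^bsup>n\<^esup>\<close> and \<open>h \<zeta> = cnj (\<phi> (r \<zeta>))\<^bsup>n\<^esup>\<close> the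
integrand is \<open>\<bar>\<phi> (r \<zeta>)\<bar>\<^bsup>2n\<^esup>\<close>, which tends to \<open>1\<close> on \<open>F\<close> as \<open>r \<rightarrow> 1\<close>. Hence \<open>1 \<le> K \<parallel>\<phi>\<^bsup>n\<^esup>\<parallel>\<close> for
all \<open>n\<close> (\<open>norm_composed_power_ge\<close>).

On the other hand the normalized monomials \<open>e\<^sub>n\<close> are orthonormal, and \<open>\<parallel>z\<^bsup>n\<^esup>\<parallel>\<^sup>2\<close> is of order \<open>n\<^bsup>1 - \<alpha>\<^esup>\<close>.
With \<open>q = 2 / (1 - \<alpha>)\<close> the lower bound becomes \<open>\<parallel>C e\<^sub>n\<parallel>\<^bsup>q\<^esup> \<ge> b / n\<close> for some \<open>b > 0\<close>, where \<open>C\<close> is the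
composition operator. But \<open>q \<ge> 2\<close>, and for such \<open>q\<close> an operator whose singular numbers are in
\<open>\<ell>\<^bsup>q\<^esup>\<close> satisfies \<open>\<Sum> \<parallel>C e\<^sub>n\<parallel>\<^bsup>q\<^esup> < \<infinity>\<close> (\<open>sum_nrm_T_powr_le\<close>, by the spectral decomposition of \<open>C\<^sup>* C\<close>
and Jensen's inequality). The harmonic series diverges, so \<open>\<mu>\<close> does not exist.

The duality between energy and norm comes from the orthogonality of the monomials, which gives
\<open>\<Sum> w\<^sub>n \<bar>a\<^sub>n\<bar>\<^sup>2 \<le> \<parallel>f\<parallel>\<^sup>2\<close> for the Taylor coefficients \<open>a\<^sub>n\<close> of \<open>f\<close> and the weights
\<open>w\<^sub>n = \<parallel>z\<^bsup>n\<^esup>\<parallel>\<^sup>2\<close>: up to bounded factors these weights are the reciprocals of the Taylor coefficients of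
\<open>(1 - z)\<^bsup>-\<alpha>\<^esup>\<close> (\<open>weight_kernel_coeff\<close>).
\<close>

section \<open>Hilbert spaces of functions\<close>

locale inner_function_space =
  fixes H :: "('a \<Rightarrow> complex) set"
    and ip :: "('a \<Rightarrow> complex) \<Rightarrow> ('a \<Rightarrow> complex) \<Rightarrow> complex"
  assumes zero_mem [simp]: "0 \<in> H"
    and add_mem [simp]: "f \<in> H \<Longrightarrow> g \<in> H \<Longrightarrow> f + g \<in> H"
    and scale_mem [simp]: "f \<in> H \<Longrightarrow> fun_scale c f \<in> H"
    and ip_add_left: "f \<in> H \<Longrightarrow> g \<in> H \<Longrightarrow> h \<in> H \<Longrightarrow> ip (f + g) h = ip f h + ip g h"
    and ip_scale_left: "f \<in> H \<Longrightarrow> h \<in> H \<Longrightarrow> ip (fun_scale c f) h = c * ip f h"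
    and ip_commute: "f \<in> H \<Longrightarrow> g \<in> H \<Longrightarrow> ip g f = cnj (ip f g)"
    and ip_nonneg: "f \<in> H \<Longrightarrow> 0 \<le> Re (ip f f)"
    and ip_definite: "f \<in> H \<Longrightarrow> ip f f = 0 \<Longrightarrow> f = 0"
begin

abbreviation nrm where "nrm \<equiv> hnorm ip"

lemma uminus_eq: "- f = fun_scale (-1) (f :: 'a \<Rightarrow> complex)"
  by (auto simp: fun_scale_def)

lemma diff_conv_scale: "f - g = f + fun_scale (-1) (g :: 'a \<Rightarrow> complex)"
  by (auto simp: fun_scale_def)

lemma diff_mem [simp]: "f \<in> H \<Longrightarrow> g \<in> H \<Longrightarrow> f - g \<in> H"
  by (simp add: diff_conv_scale)

lemma sum_mem [simp]: "(\<And>x. x \<in> A \<Longrightarrow> F x \<in> H) \<Longrightarrow> sum F A \<in> H"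
  by (induction A rule: infinite_finite_induct) auto

lemma ip_diff_left: "f \<in> H \<Longrightarrow> g \<in> H \<Longrightarrow> h \<in> H \<Longrightarrow> ip (f - g) h = ip f h - ip g h"
  by (simp add: diff_conv_scale ip_add_left ip_scale_left)

lemma ip_add_right: "f \<in> H \<Longrightarrow> g \<in> H \<Longrightarrow> h \<in> H \<Longrightarrow> ip h (f + g) = ip h f + ip h g"
  using ip_commute ip_add_left by (metis add_mem complex_cnj_add)

lemma ip_scale_right: "f \<in> H \<Longrightarrow> h \<in> H \<Longrightarrow> ip h (fun_scale c f) = cnj c * ip h f"
  using ip_commute ip_scale_left by (metis scale_mem complex_cnj_mult)

lemma ip_diff_right: "f \<in> H \<Longrightarrow> g \<in> H \<Longrightarrow> h \<in> H \<Longrightarrow> ip h (f - g) = ip h f - ip h g"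
  by (simp add: diff_conv_scale ip_add_right ip_scale_right)

lemma ip_zero_left [simp]: "f \<in> H \<Longrightarrow> ip 0 f = 0"
  using ip_diff_left[of f f f] by simp

lemma ip_zero_right [simp]: "f \<in> H \<Longrightarrow> ip f 0 = 0"
  using ip_diff_right[of f f f] by simp

lemma ip_sum_left:
  "(\<And>x. x \<in> A \<Longrightarrow> F x \<in> H) \<Longrightarrow> h \<in> H \<Longrightarrow> ip (sum F A) h = (\<Sum>x\<in>A. ip (F x) h)"
  by (induction A rule: infinite_finite_induct) (auto simp: ip_add_left)

lemma ip_sum_right:
  "(\<And>x. x \<in> A \<Longrightarrow> F x \<in> H) \<Longrightarrow> h \<in> H \<Longrightarrow> ip h (sum F A) = (\<Sum>x\<in>A. ip h (F x))"
  by (induction A rule: infinite_finite_induct) (auto simp: ip_add_right)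

lemma nrm_sq: "f \<in> H \<Longrightarrow> (nrm f)\<^sup>2 = Re (ip f f)"
  unfolding hnorm_def using ip_nonneg by simp

lemma ip_self: "f \<in> H \<Longrightarrow> ip f f = complex_of_real ((nrm f)\<^sup>2)"
  using ip_commute[of f f] by (auto simp: nrm_sq complex_eq_iff)

lemma nrm_nonneg [simp]: "f \<in> H \<Longrightarrow> 0 \<le> nrm f"
  unfolding hnorm_def using ip_nonneg by simp

lemma nrm_zero [simp]: "nrm 0 = 0"
  by (simp add: hnorm_def)

lemma nrm_eq_0: "f \<in> H \<Longrightarrow> nrm f = 0 \<longleftrightarrow> f = 0"
  using ip_definite ip_self by (metis nrm_zero of_real_0 zero_power2)

lemma nrm_scale: "f \<in> H \<Longrightarrow> nrm (fun_scale c f) = cmod c * nrm f"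
proof -
  assume f: "f \<in> H"
  have "ip (fun_scale c f) (fun_scale c f) = (c * cnj c) * ip f f"
    using f by (simp add: ip_scale_left ip_scale_right)
  also have "c * cnj c = complex_of_real ((cmod c)\<^sup>2)"
    by (rule complex_norm_square[symmetric])
  finally have "ip (fun_scale c f) (fun_scale c f) = complex_of_real ((cmod c)\<^sup>2) * ip f f" .
  then show ?thesis unfolding hnorm_def by (simp add: real_sqrt_mult)
qed

lemma nrm_minus_commute: "f \<in> H \<Longrightarrow> g \<in> H \<Longrightarrow> nrm (f - g) = nrm (g - f)"
  using nrm_scale[of "f - g" "-1"] by (simp add: uminus_eq[symmetric])

lemma nrm_add_sq: "f \<in> H \<Longrightarrow> g \<in> H \<Longrightarrow> (nrm (f + g))\<^sup>2 = (nrm f)\<^sup>2 + (nrm g)\<^sup>2 + 2 * Re (ip f g)"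
  using ip_commute[of f g] by (simp add: nrm_sq ip_add_left ip_add_right)

lemma nrm_diff_sq: "f \<in> H \<Longrightarrow> g \<in> H \<Longrightarrow> (nrm (f - g))\<^sup>2 = (nrm f)\<^sup>2 + (nrm g)\<^sup>2 - 2 * Re (ip f g)"
  using ip_commute[of f g] by (simp add: nrm_sq ip_diff_left ip_diff_right)

lemma Cauchy_Schwarz:
  assumes "f \<in> H" "g \<in> H"
  shows "cmod (ip f g) \<le> nrm f * nrm g"
proof (cases "nrm g = 0")
  case True
  then show ?thesis using assms nrm_eq_0 by auto
next
  case False
  then have g: "nrm g > 0" using assms by (simp add: order_less_le)
  define c where "c = ip f g / complex_of_real ((nrm g)\<^sup>2)"
  have "0 \<le> (nrm (f - fun_scale c g))\<^sup>2" by simp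
  also have "\<dots> = (nrm f)\<^sup>2 + (cmod c)\<^sup>2 * (nrm g)\<^sup>2 - 2 * Re (cnj c * ip f g)"
    using assms by (simp add: nrm_diff_sq nrm_scale ip_scale_right power_mult_distrib)
  also have "cnj c * ip f g = complex_of_real ((cmod (ip f g))\<^sup>2 / (nrm g)\<^sup>2)"
    unfolding c_def using complex_norm_square[of "ip f g"] by (simp add: mult.commute)
  also have "(cmod c)\<^sup>2 * (nrm g)\<^sup>2 = (cmod (ip f g))\<^sup>2 / (nrm g)\<^sup>2"
    unfolding c_def using g
    by (simp add: norm_divide power_divide norm_power field_simps power2_eq_square norm_mult)
  finally have "(cmod (ip f g))\<^sup>2 / (nrm g)\<^sup>2 \<le> (nrm f)\<^sup>2" by simp
  then have "(cmod (ip f g))\<^sup>2 \<le> (nrm f * nrm g)\<^sup>2"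
    using g by (simp add: field_simps power_mult_distrib)
  then show ?thesis using assms by (meson mult_nonneg_nonneg nrm_nonneg power2_le_imp_le)
qed

lemma nrm_triangle:
  assumes "f \<in> H" "g \<in> H"
  shows "nrm (f + g) \<le> nrm f + nrm g"
proof (rule power2_le_imp_le)
  have "Re (ip f g) \<le> nrm f * nrm g"
    using Cauchy_Schwarz[OF assms] complex_Re_le_cmod order_trans by blast
  then show "(nrm (f + g))\<^sup>2 \<le> (nrm f + nrm g)\<^sup>2"
    using assms by (simp add: nrm_add_sq power2_sum)
qed (use assms in auto)

lemma nrm_triangle_diff:
  assumes "f \<in> H" "g \<in> H" "h \<in> H"
  shows "nrm (f - h) \<le> nrm (f - g) + nrm (g - h)"
  using nrm_triangle[of "f - g" "g - h"] assms by simp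

definition orthonormal :: "('a \<Rightarrow> complex) set \<Rightarrow> bool" where
  "orthonormal B \<longleftrightarrow> B \<subseteq> H \<and> (\<forall>u\<in>B. \<forall>v\<in>B. ip u v = (if u = v then 1 else 0))"

text \<open>
The orthogonal projection onto the span of a finite orthonormal set \<open>B\<close>.
\<close>

definition proj :: "('a \<Rightarrow> complex) set \<Rightarrow> ('a \<Rightarrow> complex) \<Rightarrow> 'a \<Rightarrow> complex" where
  "proj B f = (\<Sum>v\<in>B. fun_scale (ip f v) v)"

lemma orthonormal_nrm: "orthonormal B \<Longrightarrow> v \<in> B \<Longrightarrow> nrm v = 1"
  by (simp add: orthonormal_def hnorm_def)

lemma proj_mem [simp]: "orthonormal B \<Longrightarrow> f \<in> H \<Longrightarrow> proj B f \<in> H"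
  unfolding proj_def by (rule sum_mem) (auto simp: orthonormal_def)

lemma ip_proj:
  assumes "orthonormal B" "finite B" "v \<in> B" "f \<in> H"
  shows "ip (proj B f) v = ip f v"
proof -
  have "ip (proj B f) v = (\<Sum>u\<in>B. ip f u * ip u v)"
    unfolding proj_def using assms
    by (subst ip_sum_left) (auto simp: orthonormal_def subset_iff ip_scale_left)
  also have "\<dots> = (\<Sum>u\<in>B. if u = v then ip f u else 0)"
    by (rule sum.cong) (use assms in \<open>auto simp: orthonormal_def\<close>)
  finally show ?thesis using assms by simp
qed

lemma ip_residual:
  assumes "orthonormal B" "finite B" "v \<in> B" "f \<in> H"
  shows "ip (f - proj B f) v = 0"
  using assms ip_proj[OF assms] ip_diff_left[of f "proj B f" v]
  by (auto simp: orthonormal_def subset_iff)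

lemma nrm_residual:
  assumes "orthonormal B" "finite B" "f \<in> H"
  shows "(nrm (f - proj B f))\<^sup>2 = (nrm f)\<^sup>2 - (\<Sum>v\<in>B. (cmod (ip f v))\<^sup>2)"
proof -
  let ?g = "f - proj B f"
  have mem: "?g \<in> H" "proj B f \<in> H" using assms by auto
  have "ip ?g (proj B f) = (\<Sum>v\<in>B. ip ?g (fun_scale (ip f v) v))"
    using assms mem(1) unfolding proj_def
    by (intro ip_sum_right) (auto simp: orthonormal_def subset_iff)
  also have "\<dots> = 0"
    by (rule sum.neutral)
      (use assms mem ip_residual in \<open>auto simp: ip_scale_right orthonormal_def subset_iff\<close>)
  finally have 0: "ip ?g (proj B f) = 0" .
  have "ip (proj B f) f = (\<Sum>v\<in>B. ip (fun_scale (ip f v) v) f)"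
    using assms unfolding proj_def
    by (intro ip_sum_left) (auto simp: orthonormal_def subset_iff)
  also have "\<dots> = (\<Sum>v\<in>B. complex_of_real ((cmod (ip f v))\<^sup>2))"
  proof (rule sum.cong)
    fix v assume v: "v \<in> B"
    then have "v \<in> H" using assms by (auto simp: orthonormal_def)
    then show "ip (fun_scale (ip f v) v) f = complex_of_real ((cmod (ip f v))\<^sup>2)"
      using assms complex_norm_square[of "ip f v"] ip_commute[of f v] by (simp add: ip_scale_left)
  qed simp
  finally have 1: "Re (ip (proj B f) f) = (\<Sum>v\<in>B. (cmod (ip f v))\<^sup>2)" by simp
  have "(nrm ?g)\<^sup>2 = Re (ip ?g f - ip ?g (proj B f))"
    using mem assms by (simp add: nrm_sq ip_diff_right del: ip_diff_left)
  also have "\<dots> = Re (ip f f) - Re (ip (proj B f) f)"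
    using 0 assms mem by (simp add: ip_diff_left)
  finally show ?thesis using 1 assms by (simp add: nrm_sq)
qed

lemma Bessel:
  assumes "orthonormal B" "finite B" "f \<in> H"
  shows "(\<Sum>v\<in>B. (cmod (ip f v))\<^sup>2) \<le> (nrm f)\<^sup>2"
  using nrm_residual[OF assms] zero_le_power2[of "nrm (f - proj B f)"] by linarith

end

interpretation fs: vector_space "fun_scale :: complex \<Rightarrow> ('a \<Rightarrow> complex) \<Rightarrow> _"
  by (rule vector_space_fun_scale)

context inner_function_space
begin

lemma orthonormal_independent:
  assumes "orthonormal B" "finite B"
  shows "fs.independent B"
proof
  assume "fs.dependent B"
  then obtain c where c: "\<exists>v\<in>B. c v \<noteq> 0" "(\<Sum>v\<in>B. fun_scale (c v) v) = 0"
    using fs.dependent_finite[OF assms(2)] by blast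
  then obtain v where v: "v \<in> B" "c v \<noteq> 0" by blast
  have "0 = ip (\<Sum>u\<in>B. fun_scale (c u) u) v"
    using c v assms by (auto simp: orthonormal_def)
  also have "\<dots> = (\<Sum>u\<in>B. c u * ip u v)"
    using v assms by (subst ip_sum_left) (auto simp: orthonormal_def subset_iff ip_scale_left)
  also have "\<dots> = (\<Sum>u\<in>B. if u = v then c u else 0)"
    by (rule sum.cong) (use assms v in \<open>auto simp: orthonormal_def\<close>)
  finally show False using assms v by simp
qed

end

locale hilbert_function_space = inner_function_space +
  assumes complete: "\<And>F :: nat \<Rightarrow> _. (\<And>n. F n \<in> H) \<Longrightarrow>
       (\<And>e. e > 0 \<Longrightarrow> \<exists>N. \<forall>m\<ge>N. \<forall>n\<ge>N. hnorm ip (F m - F n) < e) \<Longrightarrow>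
       \<exists>g\<in>H. (\<lambda>n. hnorm ip (F n - g)) \<longlonglongrightarrow> 0"
begin

text \<open>
Riesz representation. The representing element minimizes \<open>\<parallel>g\<parallel>\<^sup>2 - 2 Re (L g)\<close>: by the
parallelogram law a minimizing sequence is Cauchy, and the vanishing of the first variation
at the limit \<open>g\<close> says that \<open>Re (L h) = Re \<langle>h, g\<rangle>\<close> for every \<open>h\<close>. Replacing \<open>h\<close> by
\<open>\<i> h\<close> gives the imaginary parts.
\<close>

lemma Riesz:
  assumes L_add: "\<And>f g. f \<in> H \<Longrightarrow> g \<in> H \<Longrightarrow> L (f + g) = L f + L g"
    and L_scale: "\<And>c f. f \<in> H \<Longrightarrow> L (fun_scale c f) = c * L f"
    and L_bound: "\<And>f. f \<in> H \<Longrightarrow> cmod (L f) \<le> C * nrm f"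
  shows "\<exists>g\<in>H. \<forall>h\<in>H. L h = ip h g"
proof -
  define J where "J g = (nrm g)\<^sup>2 - 2 * Re (L g)" for g
  have J_lower: "J g \<ge> - C\<^sup>2" if "g \<in> H" for g
  proof -
    have "Re (L g) \<le> C * nrm g" using L_bound[OF that] complex_Re_le_cmod order_trans by blast
    moreover have "0 \<le> (nrm g - C)\<^sup>2" by simp
    ultimately show ?thesis unfolding J_def power2_diff by (simp add: mult.commute)
  qed
  define m where "m = (INF g\<in>H. J g)"
  have bdd: "bdd_below (J ` H)" using J_lower by (auto intro!: bdd_belowI2)
  have m_le: "m \<le> J g" if "g \<in> H" for g unfolding m_def by (rule cINF_lower[OF bdd that])
  have "\<exists>g\<in>H. J g < m + 1 / real (Suc n)" for n
    using cInf_lessD[of "J ` H" "m + 1 / real (Suc n)"] zero_mem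
    by (fastforce simp: m_def[symmetric])
  then obtain F where F: "\<And>n. F n \<in> H" "\<And>n. J (F n) < m + 1 / real (Suc n)" by metis
  have par: "(nrm (a - b))\<^sup>2 \<le> 2 * (J a + J b - 2 * m)" if ab: "a \<in> H" "b \<in> H" for a b
  proof -
    let ?c = "fun_scale (1/2) (a + b)"
    have "L ?c = (L a + L b) / 2" using ab by (simp add: L_scale L_add)
    then have "Re (L ?c) = Re ((L a + L b) / 2)" by (simp only:)
    then have "Re (L ?c) = (Re (L a) + Re (L b)) / 2" by simp
    moreover have "(nrm ?c)\<^sup>2 = (nrm (a + b))\<^sup>2 / 4"
      using ab by (simp add: nrm_scale power_divide norm_divide)
    ultimately have "4 * J ?c = (nrm (a + b))\<^sup>2 - 4 * Re (L a) - 4 * Re (L b)"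
      unfolding J_def by (simp add: field_simps)
    then have "2 * J a + 2 * J b - 4 * J ?c = (nrm (a - b))\<^sup>2"
      unfolding J_def using ab by (simp add: nrm_add_sq nrm_diff_sq)
    with m_le[of ?c] ab show ?thesis by simp
  qed
  have "\<exists>N. \<forall>i\<ge>N. \<forall>j\<ge>N. nrm (F i - F j) < e" if e0: "e > 0" for e
  proof -
    have "0 < e\<^sup>2 / 4" using e0 by simp
    then obtain N where "inverse (real (Suc N)) < e\<^sup>2 / 4" using reals_Archimedean by blast
    then have N: "1 / real (Suc N) < e\<^sup>2 / 4" by (simp add: inverse_eq_divide)
    have "nrm (F i - F j) < e" if ij: "i \<ge> N" "j \<ge> N" for i j
    proof (rule power2_less_imp_less)
      have "1 / real (Suc i) \<le> 1 / real (Suc N)" "1 / real (Suc j) \<le> 1 / real (Suc N)"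
        using ij by (auto simp: frac_le)
      then have "J (F i) + J (F j) - 2 * m < e\<^sup>2 / 2" using F(2)[of i] F(2)[of j] N by simp
      then show "(nrm (F i - F j))\<^sup>2 < e\<^sup>2" using par[OF F(1)[of i] F(1)[of j]] by simp
    qed (use e0 in auto)
    then show ?thesis by blast
  qed
  from complete[OF F(1) this] obtain g where g: "g \<in> H" "(\<lambda>n. nrm (F n - g)) \<longlonglongrightarrow> 0" by blast
  have Jm: "J g \<le> m"
  proof (rule LIMSEQ_le_const)
    have "(\<lambda>n. nrm (F n - g) * (nrm (F n - g) + 2 * nrm g) + 2 * (C * nrm (F n - g)) + m + 1 / real (Suc n))
       \<longlonglongrightarrow> 0 * (0 + 2 * nrm g) + 2 * (C * 0) + m + 0"
      by (intro tendsto_intros g LIMSEQ_Suc[OF lim_1_over_n])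
    then show "(\<lambda>n. nrm (F n - g) * (nrm (F n - g) + 2 * nrm g) + 2 * (C * nrm (F n - g)) + m + 1 / real (Suc n))
       \<longlonglongrightarrow> m" by simp
    have "J g \<le> nrm (F n - g) * (nrm (F n - g) + 2 * nrm g) + 2 * (C * nrm (F n - g)) + m + 1 / real (Suc n)" for n
    proof -
      define d where "d = F n - g"
      have d: "d \<in> H" "F n = g + d" using F g by (auto simp: d_def)
      have "- Re (ip g d) \<le> nrm g * nrm d"
        using Cauchy_Schwarz[of g d] d g abs_Re_le_cmod[of "ip g d"] by linarith
      moreover have "Re (L d) \<le> C * nrm d"
        using L_bound[OF d(1)] complex_Re_le_cmod[of "L d"] by linarith
      moreover have "J (F n) = J g + (nrm d)\<^sup>2 + 2 * Re (ip g d) - 2 * Re (L d)"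
        unfolding J_def d(2) using d(1) g by (simp add: nrm_add_sq L_add)
      moreover have "nrm d * (nrm d + 2 * nrm g) = (nrm d)\<^sup>2 + 2 * (nrm g * nrm d)"
        by (simp add: power2_eq_square algebra_simps)
      ultimately show ?thesis using F(2)[of n] zero_le_power2[of "nrm d"]
        unfolding d_def[symmetric] by linarith
    qed
    then show "\<exists>N. \<forall>n\<ge>N. J g \<le> nrm (F n - g) * (nrm (F n - g) + 2 * nrm g) + 2 * (C * nrm (F n - g)) + m + 1 / real (Suc n)"
      by blast
  qed
  have Re_eq: "Re (L h) = Re (ip h g)" if h: "h \<in> H" for h
  proof -
    have key: "0 \<le> t\<^sup>2 * (nrm h)\<^sup>2 + 2 * t * (Re (ip h g) - Re (L h))" for t :: real
    proof -
      have "J g \<le> J (g + fun_scale (of_real t) h)" using Jm m_le[of "g + fun_scale (of_real t) h"] g h by simp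
      also have "\<dots> = J g + t\<^sup>2 * (nrm h)\<^sup>2 + 2 * t * (Re (ip h g) - Re (L h))"
        unfolding J_def using g h ip_commute[of g h]
        by (simp add: nrm_add_sq nrm_scale L_add L_scale ip_scale_right power_mult_distrib algebra_simps)
      finally show ?thesis by simp
    qed
    \<comment> \<open>The quadratic in \<open>t\<close> is tested near its minimum; the added \<open>1\<close> keeps \<open>a\<close> positive.\<close>
    define b where "b = Re (ip h g) - Re (L h)"
    define a where "a = (nrm h)\<^sup>2 + 1"
    have a: "a > 0" unfolding a_def by (simp add: add_nonneg_pos)
    have "0 \<le> (- b / a)\<^sup>2 * (nrm h)\<^sup>2 + 2 * (- b / a) * b" using key[of "- b / a"] by (simp add: b_def)
    also have "\<dots> \<le> (- b / a)\<^sup>2 * a + 2 * (- b / a) * b" by (intro add_right_mono mult_left_mono) (auto simp: a_def)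
    also have "\<dots> = - b\<^sup>2 / a" using a by (simp add: field_simps power2_eq_square)
    finally have "b\<^sup>2 \<le> 0" using a by (simp add: field_simps)
    then show ?thesis by (simp add: b_def)
  qed
  have "L h = ip h g" if h: "h \<in> H" for h
    using Re_eq[OF h] Re_eq[of "fun_scale \<i> h"] h g by (simp add: complex_eq_iff L_scale ip_scale_left)
  with g show ?thesis by blast
qed

end

section \<open>Singular numbers of compact operators\<close>

locale compact_operator = hilbert_function_space +
  fixes T :: "('a \<Rightarrow> complex) \<Rightarrow> 'a \<Rightarrow> complex"
  assumes compact: "compact_operator_on H ip T"
begin

lemma T_mem [simp]: "f \<in> H \<Longrightarrow> T f \<in> H"
  and T_add: "f \<in> H \<Longrightarrow> g \<in> H \<Longrightarrow> T (f + g) = T f + T g"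
  and T_scale: "f \<in> H \<Longrightarrow> T (fun_scale c f) = fun_scale c (T f)"
  using compact by (auto simp: compact_operator_on_def linear_operator_on_def)

lemma T_diff: "f \<in> H \<Longrightarrow> g \<in> H \<Longrightarrow> T (f - g) = T f - T g"
  using T_add[of f "fun_scale (-1) g"] by (simp only: diff_conv_scale T_scale scale_mem)

lemma T_zero [simp]: "T 0 = 0"
  using T_diff[of 0 0] by simp

lemma T_convergent_subseq:
  assumes "\<And>n :: nat. F n \<in> H" "\<And>n. nrm (F n) \<le> b"
  obtains g r where "g \<in> H" "strict_mono (r :: nat \<Rightarrow> nat)" "(\<lambda>n. nrm (T (F (r n)) - g)) \<longlonglongrightarrow> 0"
  using compact assms unfolding compact_operator_on_def by metis

lemma T_bounded: obtains C where "0 \<le> C" "\<And>f. f \<in> H \<Longrightarrow> nrm (T f) \<le> C * nrm f"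
proof -
  have "\<exists>C\<ge>0. \<forall>f\<in>H. nrm (T f) \<le> C * nrm f"
  proof (rule ccontr)
    assume "\<not> ?thesis"
    then have "\<exists>f\<in>H. nrm (T f) > real n * nrm f" for n
      by (meson linorder_not_le of_nat_0_le_iff)
    then obtain F where F: "\<And>n. F n \<in> H" "\<And>n. nrm (T (F n)) > real n * nrm (F n)" by metis
    have pos: "nrm (F n) > 0" for n
    proof (rule ccontr)
      assume "\<not> nrm (F n) > 0"
      then have "nrm (F n) = 0" using nrm_nonneg[OF F(1)[of n]] by linarith
      then have "F n = 0" using F(1)[of n] nrm_eq_0 by blast
      then show False using F(2)[of n] by simp
    qed
    define G where "G n = fun_scale (of_real (1 / nrm (F n))) (F n)" for n
    have G: "G n \<in> H" "nrm (G n) \<le> 1" "nrm (T (G n)) > real n" for n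
      using F[of n] pos[of n] by (auto simp: G_def nrm_scale T_scale norm_divide field_simps)
    obtain g r where g: "g \<in> H" "strict_mono r" "(\<lambda>n. nrm (T (G (r n)) - g)) \<longlonglongrightarrow> 0"
      using T_convergent_subseq[of G 1] G by blast
    have "eventually (\<lambda>n. nrm (T (G (r n)) - g) < 1) sequentially"
      using g(3) by (rule order_tendstoD) simp
    then obtain N where N: "\<And>n. n \<ge> N \<Longrightarrow> nrm (T (G (r n)) - g) < 1"
      by (auto simp: eventually_sequentially)
    define n where "n = max N (nat \<lceil>1 + nrm g\<rceil>)"
    have "real n < nrm (T (G (r n)))"
      using G(3)[of "r n"] seq_suble[OF g(2), of n] by linarith
    also have "\<dots> \<le> nrm (T (G (r n)) - g) + nrm g"
      using nrm_triangle[of "T (G (r n)) - g" g] G g by simp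
    also have "\<dots> < 1 + nrm g" using N[of n] by (simp add: n_def)
    also have "\<dots> \<le> real n" by (simp add: n_def) linarith
    finally show False by simp
  qed
  then show thesis using that by blast
qed

text \<open>
An adjoint given by a definite description denotes what it should only if it exists and is unique;
existence comes from Riesz representation.
\<close>

definition adj :: "('a \<Rightarrow> complex) \<Rightarrow> 'a \<Rightarrow> complex" where
  "adj = adjoint_on H ip T"

lemma adj_unique:
  assumes "g \<in> H" "g' \<in> H" "\<And>h. h \<in> H \<Longrightarrow> ip h g = ip h g'"
  shows "g = g'"
proof -
  have "ip (g - g') (g - g') = 0" using assms by (simp add: ip_diff_right)
  then show ?thesis using ip_definite[of "g - g'"] assms by simp
qed

lemma ex_adj: "f \<in> H \<Longrightarrow> \<exists>g\<in>H. \<forall>h\<in>H. ip (T h) f = ip h g"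
proof -
  assume f: "f \<in> H"
  obtain C where C: "0 \<le> C" "\<And>f. f \<in> H \<Longrightarrow> nrm (T f) \<le> C * nrm f" using T_bounded by blast
  show ?thesis
  proof (rule Riesz[where C = "C * nrm f"])
    fix h assume h: "h \<in> H"
    have "cmod (ip (T h) f) \<le> nrm (T h) * nrm f" using h f Cauchy_Schwarz by simp
    also have "\<dots> \<le> C * nrm h * nrm f" using C(2)[OF h] f by (intro mult_right_mono) auto
    finally show "cmod (ip (T h) f) \<le> C * nrm f * nrm h" by (simp add: algebra_simps)
  qed (use f in \<open>auto simp: T_add T_scale ip_add_left ip_scale_left\<close>)
qed

lemma adj_props:
  assumes "f \<in> H"
  shows adj_mem [simp]: "adj f \<in> H" and ip_adj: "\<And>h. h \<in> H \<Longrightarrow> ip (T h) f = ip h (adj f)"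
proof -
  obtain g where g: "g \<in> H" "\<forall>h\<in>H. ip (T h) f = ip h g" using ex_adj[OF assms] by blast
  have "\<exists>!g. g \<in> H \<and> (\<forall>h\<in>H. ip (T h) f = ip h g)"
    using g adj_unique by (intro ex1I[of _ g]) auto
  from theI'[OF this] show "adj f \<in> H" "\<And>h. h \<in> H \<Longrightarrow> ip (T h) f = ip h (adj f)"
    unfolding adj_def adjoint_on_def by auto
qed

lemma adj_eqI:
  assumes "f \<in> H" "g \<in> H" "\<And>h. h \<in> H \<Longrightarrow> ip (T h) f = ip h g"
  shows "adj f = g"
  using assms by (intro adj_unique) (auto simp: ip_adj[symmetric])

lemma adj_add: "f \<in> H \<Longrightarrow> g \<in> H \<Longrightarrow> adj (f + g) = adj f + adj g"
  by (rule adj_eqI) (auto simp: ip_add_right ip_adj)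

lemma adj_scale: "f \<in> H \<Longrightarrow> adj (fun_scale c f) = fun_scale c (adj f)"
  by (rule adj_eqI) (auto simp: ip_scale_right ip_adj)

lemma adj_diff: "f \<in> H \<Longrightarrow> g \<in> H \<Longrightarrow> adj (f - g) = adj f - adj g"
  using adj_add[of f "fun_scale (-1) g"] by (simp only: diff_conv_scale adj_scale scale_mem)

lemma adj_bounded:
  assumes C: "0 \<le> C" "\<And>f. f \<in> H \<Longrightarrow> nrm (T f) \<le> C * nrm f" and f: "f \<in> H"
  shows "nrm (adj f) \<le> C * nrm f"
proof (cases "nrm (adj f) = 0")
  case False
  then have pos: "nrm (adj f) > 0" using nrm_nonneg[OF adj_mem[OF f]] by linarith
  have "(nrm (adj f))\<^sup>2 = Re (ip (T (adj f)) f)" using f by (simp add: nrm_sq ip_adj)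
  also have "\<dots> \<le> nrm (T (adj f)) * nrm f"
    using Cauchy_Schwarz[of "T (adj f)" f] f complex_Re_le_cmod order_trans by (metis T_mem adj_mem)
  also have "\<dots> \<le> C * nrm (adj f) * nrm f" using C(2)[of "adj f"] f by (intro mult_right_mono) auto
  finally show ?thesis using pos by (simp add: power2_eq_square)
qed (use C f in auto)

abbreviation A where "A f \<equiv> adj (T f)"

lemma ip_TT: "f \<in> H \<Longrightarrow> g \<in> H \<Longrightarrow> ip (T f) (T g) = ip f (A g)"
  by (simp add: ip_adj)

lemma A_sum:
  assumes "finite S" "S \<subseteq> H"
  shows "A (\<Sum>v\<in>S. fun_scale (c v) v) = (\<Sum>v\<in>S. fun_scale (c v) (A v))"
  using assms
proof (induction S rule: finite_induct)
  case empty
  have "adj 0 = 0" using adj_diff[of 0 0] by simp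
  then show ?case by (simp only: sum.empty T_zero)
next
  case (insert x F)
  let ?S = "\<Sum>v\<in>F. fun_scale (c v) v"
  have mem: "?S \<in> H" "fun_scale (c x) x \<in> H" "x \<in> H" using insert by (auto intro!: sum_mem)
  have "A (fun_scale (c x) x + ?S) = A (fun_scale (c x) x) + A ?S"
    using mem T_add[OF mem(2,1)] adj_add[of "T (fun_scale (c x) x)" "T ?S"] by simp
  also have "A (fun_scale (c x) x) = fun_scale (c x) (A x)"
    using mem T_scale[OF mem(3)] adj_scale[of "T x"] by simp
  finally show ?case using insert by simp
qed

lemma A_selfadjoint: "f \<in> H \<Longrightarrow> g \<in> H \<Longrightarrow> ip (A f) g = ip f (A g)"
  by (metis T_mem adj_mem ip_TT ip_commute)

text \<open>
The unit eigenvectors of \<open>T\<^sup>* T\<close> whose singular number exceeds \<open>t\<close>. For a unit eigenvector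
\<open>v\<close> the eigenvalue is \<open>\<langle>T\<^sup>* T v, v\<rangle> = \<parallel>T v\<parallel>\<^sup>2\<close>, which is why it is not a separate parameter.
\<close>

definition singular_vectors :: "real \<Rightarrow> ('a \<Rightarrow> complex) set" where
  "singular_vectors t = {v \<in> H. nrm v = 1 \<and> t < nrm (T v) \<and>
     A v = fun_scale (of_real ((nrm (T v))\<^sup>2)) v}"

definition maximal_system :: "real \<Rightarrow> ('a \<Rightarrow> complex) set \<Rightarrow> bool" where
  "maximal_system t B \<longleftrightarrow> orthonormal B \<and> B \<subseteq> singular_vectors t \<and>
     (\<forall>B'. orthonormal B' \<and> B' \<subseteq> singular_vectors t \<and> B \<subseteq> B' \<longrightarrow> B' = B)"

lemma ex_maximal_system: "\<exists>B. maximal_system t B"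
proof -
  let ?S = "{B. orthonormal B \<and> B \<subseteq> singular_vectors t}"
  have "\<exists>M\<in>?S. \<forall>X\<in>?S. M \<subseteq> X \<longrightarrow> X = M"
  proof (rule subset_Zorn')
    fix C assume C: "subset.chain ?S C"
    have "orthonormal (\<Union>C)"
      unfolding orthonormal_def
    proof (intro conjI ballI)
      show "\<Union>C \<subseteq> H" using C by (auto simp: subset.chain_def orthonormal_def)
      fix u v assume "u \<in> \<Union>C" "v \<in> \<Union>C"
      then obtain X Y where XY: "X \<in> C" "Y \<in> C" "u \<in> X" "v \<in> Y" by blast
      then have "X \<subseteq> Y \<or> Y \<subseteq> X" using C unfolding subset.chain_def by blast
      then obtain Z where "Z \<in> C" "u \<in> Z" "v \<in> Z" using XY by blast
      then show "ip u v = (if u = v then 1 else 0)"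
        using C by (auto simp: subset.chain_def orthonormal_def)
    qed
    then show "\<Union>C \<in> ?S" using C by (auto simp: subset.chain_def)
  qed
  then obtain M where "M \<in> ?S" "\<forall>X\<in>?S. M \<subseteq> X \<longrightarrow> X = M" by blast
  then show ?thesis unfolding maximal_system_def by (intro exI[of _ M]) simp
qed

text \<open>
The images of orthonormal eigenvectors are orthogonal and longer than \<open>t\<close>, so infinitely many
of them would form a sequence without convergent subsequence.
\<close>

lemma finite_system:
  assumes t: "t > 0" and B: "orthonormal B" "B \<subseteq> singular_vectors t"
  shows "finite B"
proof (rule ccontr)
  assume "infinite B"
  then obtain v :: "nat \<Rightarrow> _" where v: "inj v" "range v \<subseteq> B"
    using infinite_countable_subset by blast
  have vB: "v n \<in> B" "v n \<in> H" "nrm (v n) = 1" for n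
    using v B by (auto simp: singular_vectors_def)
  obtain g r where g: "g \<in> H" "strict_mono r" "(\<lambda>n. nrm (T (v (r n)) - g)) \<longlonglongrightarrow> 0"
    using T_convergent_subseq[of v 1] vB by auto
  have "eventually (\<lambda>n. nrm (T (v (r n)) - g) < t / 2) sequentially"
    using g(3) by (rule order_tendstoD) (use t in simp)
  then obtain N where N: "\<And>n. n \<ge> N \<Longrightarrow> nrm (T (v (r n)) - g) < t / 2"
    by (auto simp: eventually_sequentially)
  define a b where "a = v (r N)" and "b = v (r (Suc N))"
  have ab: "a \<in> H" "b \<in> H" "a \<in> B" "b \<in> B" using vB by (auto simp: a_def b_def)
  have ne: "a \<noteq> b" using v(1) g(2) by (auto simp: a_def b_def inj_eq strict_mono_eq)
  have "nrm (T a - T b) \<le> nrm (T a - g) + nrm (g - T b)"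
    using nrm_triangle_diff g ab by simp
  also have "\<dots> < t"
    using N[of N] N[of "Suc N"] nrm_minus_commute[of g "T b"] ab g by (simp add: a_def b_def)
  finally have lt: "(nrm (T a - T b))\<^sup>2 < t\<^sup>2"
    using ab by (intro power_strict_mono) auto
  have "ip (T a) (T b) = 0"
    using ab ne B by (auto simp: ip_TT singular_vectors_def ip_scale_right orthonormal_def subset_iff)
  then have "(nrm (T a - T b))\<^sup>2 = (nrm (T a))\<^sup>2 + (nrm (T b))\<^sup>2" using ab by (simp add: nrm_diff_sq)
  moreover have "(nrm (T a))\<^sup>2 > t\<^sup>2"
    using ab B t by (intro power_strict_mono) (auto simp: singular_vectors_def)
  ultimately show False using lt zero_le_power2[of "nrm (T b)"] by linarith
qed

lemma no_further_eigenvector: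
  assumes B: "maximal_system t B" and t: "0 \<le> t" "t < l"
    and g: "g \<in> H" "\<And>v. v \<in> B \<Longrightarrow> ip g v = 0" "A g = fun_scale (of_real (l\<^sup>2)) g"
  shows "g = 0"
proof (rule ccontr)
  assume "g \<noteq> 0"
  then have pos: "nrm g > 0" using g nrm_eq_0[of g] nrm_nonneg[of g] by linarith
  define u where "u = fun_scale (of_real (1 / nrm g)) g"
  have u: "u \<in> H" "nrm u = 1" "\<And>v. v \<in> B \<Longrightarrow> ip u v = 0"
    using g pos B by (auto simp: u_def nrm_scale norm_divide ip_scale_left maximal_system_def orthonormal_def subset_iff)
  have Au: "A u = fun_scale (of_real (l\<^sup>2)) u"
    using g by (simp add: u_def T_scale adj_scale mult.commute)
  have "(nrm (T u))\<^sup>2 = Re (ip u (A u))" using u by (simp add: nrm_sq ip_TT del: adj_props)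
  also have "\<dots> = l\<^sup>2 * (nrm u)\<^sup>2" unfolding nrm_sq[OF u(1)] using u by (simp add: Au ip_scale_right)
  finally have "nrm (T u) = l" using u t by (simp add: power2_eq_iff_nonneg)
  then have us: "u \<in> singular_vectors t" using u Au t by (simp add: singular_vectors_def)
  have "ip v u = 0" if "v \<in> B" for v
    using u that B ip_commute[of u v] by (auto simp: maximal_system_def orthonormal_def)
  moreover have "ip u u = 1" using ip_self[of u] u by simp
  ultimately have "orthonormal (insert u B)"
    using B u unfolding maximal_system_def orthonormal_def by auto
  then have "insert u B = B"
    using B us unfolding maximal_system_def by blast
  then have "u \<in> B" by blast
  then show False using u(3)[of u] \<open>ip u u = 1\<close> by simp
qed

text \<open>
The members of a maximal system that belong to the eigenvalue \<open>l\<^sup>2\<close> form a basis of its eigenspace: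
an eigenvector minus its projection onto them is again an eigenvector, it is orthogonal to
the other members because eigenspaces of a self-adjoint operator are orthogonal, and hence it
vanishes by maximality.
\<close>

lemma card_maximal_system:
  assumes B: "maximal_system t B" and t: "0 < t" "t < l"
  shows "card {v \<in> B. nrm (T v) = l} = vector_space.dim fun_scale (eigenspace_on H A (of_real (l\<^sup>2)))"
proof -
  let ?E = "eigenspace_on H A (of_real (l\<^sup>2))"
  let ?B = "{v \<in> B. nrm (T v) = l}"
  have ob: "orthonormal B" "B \<subseteq> singular_vectors t" using B by (auto simp: maximal_system_def)
  have BH: "v \<in> H" if "v \<in> B" for v using ob that by (auto simp: orthonormal_def)
  have fin: "finite B" using finite_system[OF t(1) ob] .
  have obl: "orthonormal ?B" "finite ?B" using ob fin by (auto simp: orthonormal_def)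
  have BE: "?B \<subseteq> ?E" using ob BH by (auto simp: eigenspace_on_def singular_vectors_def)
  have "?E \<subseteq> fs.span ?B"
  proof
    fix u assume u: "u \<in> ?E"
    then have uH: "u \<in> H" "A u = fun_scale (of_real (l\<^sup>2)) u" by (auto simp: eigenspace_on_def)
    define p where "p = proj ?B u"
    have pH: "p \<in> H" using obl uH by (simp add: p_def)
    have Ap: "A p = fun_scale (of_real (l\<^sup>2)) p"
    proof -
      have "A v = fun_scale (of_real (l\<^sup>2)) v" if "v \<in> ?B" for v
        using ob that by (auto simp: singular_vectors_def)
      then have "A p = (\<Sum>v\<in>?B. fun_scale (ip u v) (fun_scale (of_real (l\<^sup>2)) v))"
        unfolding p_def proj_def using obl(2) BH by (subst A_sum) (auto intro!: sum.cong)
      also have "\<dots> = fun_scale (of_real (l\<^sup>2)) p"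
        unfolding p_def proj_def fs.scale_sum_right by (simp add: mult.commute)
      finally show ?thesis .
    qed
    define g where "g = u - p"
    have gH: "g \<in> H" using uH pH by (simp add: g_def)
    have Ag: "A g = fun_scale (of_real (l\<^sup>2)) g"
      using uH pH Ap by (simp add: g_def T_diff adj_diff fs.scale_right_diff_distrib)
    have "ip g v = 0" if v: "v \<in> B" for v
    proof (cases "nrm (T v) = l")
      case True
      then show ?thesis using ip_residual[OF obl _ uH(1), of v] v by (simp add: g_def p_def)
    next
      case False
      have Av: "A v = fun_scale (of_real ((nrm (T v))\<^sup>2)) v" using ob v by (auto simp: singular_vectors_def)
      have "of_real (l\<^sup>2) * ip g v = of_real ((nrm (T v))\<^sup>2) * ip g v"
        using A_selfadjoint[OF gH BH[OF v]] gH BH[OF v] unfolding Ag Av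
        by (simp add: ip_scale_left ip_scale_right)
      then have "of_real (l\<^sup>2 - (nrm (T v))\<^sup>2) * ip g v = 0" by (simp add: algebra_simps)
      moreover have "l\<^sup>2 \<noteq> (nrm (T v))\<^sup>2"
        using False t BH[OF v] by (simp add: power2_eq_iff_nonneg)
      ultimately show ?thesis by (simp del: of_real_diff of_real_power)
    qed
    from no_further_eigenvector[OF B _ t(2) gH this Ag] t have "u = p" by (simp add: g_def)
    then show "u \<in> fs.span ?B"
      unfolding p_def proj_def by (metis (no_types, lifting) fs.span_base fs.span_scale fs.span_sum)
  qed
  then have "fs.span ?E \<subseteq> fs.span ?B" by (rule fs.span_minimal) (rule fs.subspace_span)
  with fs.span_mono[OF BE] have "fs.span ?B = fs.span ?E" by (rule subset_antisym)
  from fs.dim_eq_card[OF this orthonormal_independent[OF obl]] show ?thesis by simp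
qed

text \<open>
The variational characterization of singular numbers. Otherwise the supremum \<open>s\<close> of \<open>\<parallel>T f\<parallel>\<close>
over the unit vectors orthogonal to \<open>B\<close> would exceed \<open>t\<close>. For a maximizing sequence \<open>F\<close> the
defects \<open>D = \<parallel>T\<^sup>* T F - s\<^sup>2 F\<parallel>\<close> tend to \<open>0\<close>, so compactness of \<open>T\<close> makes a subsequence of \<open>F\<close>
converge to an eigenvector \<open>u\<close> with eigenvalue \<open>s\<^sup>2\<close> that is orthogonal to \<open>B\<close>, against maximality.
\<close>

lemma nrm_T_orthogonal:
  assumes B: "maximal_system t B" and t: "0 < t"
    and g: "g \<in> H" "\<And>v. v \<in> B \<Longrightarrow> ip g v = 0"
  shows "nrm (T g) \<le> t * nrm g"
proof (rule ccontr)
  assume contr: "\<not> nrm (T g) \<le> t * nrm g"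
  have ob: "orthonormal B" "B \<subseteq> singular_vectors t" using B by (auto simp: maximal_system_def)
  have BH: "v \<in> H" if "v \<in> B" for v using ob that by (auto simp: orthonormal_def)
  define W where "W = {g \<in> H. \<forall>v\<in>B. ip g v = 0}"
  define U where "U = {g \<in> W. nrm g = 1}"
  obtain C where C: "0 \<le> C" "\<And>f. f \<in> H \<Longrightarrow> nrm (T f) \<le> C * nrm f" using T_bounded by blast
  define s where "s = (SUP g\<in>U. nrm (T g))"
  have normalise: "fun_scale (of_real (1 / nrm f)) f \<in> U" if "f \<in> W" "f \<noteq> 0" for f
    using that nrm_eq_0[of f] nrm_nonneg[of f]
    by (auto simp: U_def W_def nrm_scale norm_divide ip_scale_left BH)
  have bdd: "bdd_above ((\<lambda>g. nrm (T g)) ` U)"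
    by (rule bdd_aboveI2[where M = C]) (use C in \<open>force simp: U_def W_def\<close>)
  have le_s: "nrm (T f) \<le> s * nrm f" if "f \<in> W" for f
  proof (cases "f = 0")
    case False
    then have "nrm (T (fun_scale (of_real (1 / nrm f)) f)) \<le> s"
      unfolding s_def using normalise[OF that] bdd by (intro cSUP_upper) auto
    moreover have "nrm f > 0" "f \<in> H" using False that nrm_eq_0[of f] nrm_nonneg[of f] by (auto simp: W_def less_le)
    ultimately show ?thesis by (simp add: T_scale nrm_scale norm_divide field_simps)
  qed simp
  have gW: "g \<in> W" using g by (simp add: W_def)
  have g0: "g \<noteq> 0" using contr by auto
  have ts: "t < s"
  proof -
    have "nrm g > 0" using g0 nrm_eq_0[OF g(1)] nrm_nonneg[OF g(1)] by linarith
    moreover have "t * nrm g < s * nrm g" using contr le_s[OF gW] by simp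
    ultimately show ?thesis by simp
  qed
  have AW: "A f \<in> W" if "f \<in> W" for f
  proof -
    have "ip (A f) v = 0" if v: "v \<in> B" for v
    proof -
      have "A v = fun_scale (of_real ((nrm (T v))\<^sup>2)) v" using ob v by (auto simp: singular_vectors_def)
      then show ?thesis using \<open>f \<in> W\<close> v BH[OF v] by (simp add: A_selfadjoint W_def ip_scale_right)
    qed
    then show ?thesis using that by (simp add: W_def)
  qed
  have A_le: "nrm (A f) \<le> s * nrm (T f)" if f: "f \<in> W" for f
  proof (cases "nrm (A f) = 0")
    case True
    then show ?thesis using f t ts by (simp add: W_def)
  next
    case False
    have fH: "f \<in> H" "A f \<in> H" using f by (auto simp: W_def)
    then have pos: "nrm (A f) > 0" using False nrm_nonneg[of "A f"] by linarith
    have "(nrm (A f))\<^sup>2 = Re (ip (T (A f)) (T f))" using fH by (simp add: nrm_sq ip_TT)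
    also have "\<dots> \<le> nrm (T (A f)) * nrm (T f)"
      using Cauchy_Schwarz[of "T (A f)" "T f"] fH complex_Re_le_cmod order_trans by (metis T_mem)
    also have "\<dots> \<le> s * nrm (A f) * nrm (T f)" using le_s[OF AW[OF f]] fH by (intro mult_right_mono) auto
    finally show ?thesis using pos by (simp add: power2_eq_square)
  qed
  have "\<exists>f\<in>U. s - 1 / real (Suc n) < nrm (T f)" for n
  proof -
    have "U \<noteq> {}" using normalise[OF gW g0] by blast
    then show ?thesis using less_cSUP_iff[OF _ bdd, of "s - 1 / real (Suc n)"] unfolding s_def[symmetric] by simp
  qed
  then obtain F where F: "\<And>n. F n \<in> U" "\<And>n. s - 1 / real (Suc n) < nrm (T (F n))" by metis
  have FH: "F n \<in> H" "nrm (F n) = 1" "F n \<in> W" for n using F(1)[of n] by (auto simp: U_def W_def)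
  have Flim: "(\<lambda>n. nrm (T (F n))) \<longlonglongrightarrow> s"
  proof (rule tendsto_sandwich)
    show "(\<lambda>n. s - 1 / real (Suc n)) \<longlonglongrightarrow> s"
      using tendsto_diff[OF tendsto_const[of s] LIMSEQ_Suc[OF lim_1_over_n[where 'a = real]]] by simp
    show "\<forall>\<^sub>F n in sequentially. s - 1 / real (Suc n) \<le> nrm (T (F n))"
      using F(2) by (simp add: less_imp_le)
    show "\<forall>\<^sub>F n in sequentially. nrm (T (F n)) \<le> s"
      using le_s[OF FH(3)] FH(2) by simp
  qed auto
  define D where "D n = nrm (A (F n) - fun_scale (of_real (s\<^sup>2)) (F n))" for n
  have D_le: "(D n)\<^sup>2 \<le> s\<^sup>2 * (s\<^sup>2 - (nrm (T (F n)))\<^sup>2)" for n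
  proof -
    have "Re (ip (A (F n)) (fun_scale (of_real (s\<^sup>2)) (F n))) = s\<^sup>2 * (nrm (T (F n)))\<^sup>2"
      using FH[of n] by (simp add: ip_scale_right A_selfadjoint nrm_sq ip_TT)
    moreover have "(nrm (A (F n)))\<^sup>2 \<le> (s * nrm (T (F n)))\<^sup>2"
      using A_le[OF FH(3)] FH by (intro power_mono) auto
    ultimately show ?thesis unfolding D_def using FH[of n]
      by (simp add: nrm_diff_sq nrm_scale norm_power power_mult_distrib algebra_simps)
  qed
  have D0: "D \<longlonglongrightarrow> 0"
  proof -
    have "(\<lambda>n. (D n)\<^sup>2) \<longlonglongrightarrow> 0"
    proof (rule tendsto_sandwich[OF _ _ tendsto_const])
      show "\<forall>\<^sub>F n in sequentially. (D n)\<^sup>2 \<le> s\<^sup>2 * (s\<^sup>2 - (nrm (T (F n)))\<^sup>2)" using D_le by simp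
      have "(\<lambda>n. s\<^sup>2 * (s\<^sup>2 - (nrm (T (F n)))\<^sup>2)) \<longlonglongrightarrow> s\<^sup>2 * (s\<^sup>2 - s\<^sup>2)"
        by (intro tendsto_intros Flim)
      then show "(\<lambda>n. s\<^sup>2 * (s\<^sup>2 - (nrm (T (F n)))\<^sup>2)) \<longlonglongrightarrow> 0" by simp
    qed simp
    from tendsto_real_sqrt[OF this] have "(\<lambda>n. \<bar>D n\<bar>) \<longlonglongrightarrow> 0" by simp
    then show ?thesis by (simp add: tendsto_rabs_zero_iff)
  qed
  obtain y r where y: "y \<in> H" "strict_mono r" "(\<lambda>n. nrm (T (F (r n)) - y)) \<longlonglongrightarrow> 0"
    using T_convergent_subseq[of F 1] FH by auto
  have s0: "s > 0" using t ts by simp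
  define u where "u = fun_scale (of_real (1 / s\<^sup>2)) (adj y)"
  have uH: "u \<in> H" using y by (simp add: u_def)
  define E where "E n = nrm (F (r n) - u)" for n
  have Dr: "(\<lambda>n. D (r n)) \<longlonglongrightarrow> 0"
    using LIMSEQ_subseq_LIMSEQ[OF D0 y(2)] by (simp add: o_def)
  have E_le: "E n \<le> (D (r n) + C * nrm (T (F (r n)) - y)) / s\<^sup>2" for n
  proof -
    let ?f = "F (r n)"
    let ?h = "fun_scale (of_real (s\<^sup>2)) ?f"
    have "?f - u = fun_scale (of_real (1 / s\<^sup>2)) (?h - adj y)"
      using s0 by (simp add: u_def fs.scale_right_diff_distrib)
    then have "E n = nrm (?h - adj y) / s\<^sup>2"
      using FH y by (simp add: E_def nrm_scale norm_divide norm_power)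
    also have "\<dots> \<le> (nrm (?h - A ?f) + nrm (A ?f - adj y)) / s\<^sup>2"
      using nrm_triangle_diff[of ?h "A ?f" "adj y"] FH y by (intro divide_right_mono) auto
    also have "nrm (?h - A ?f) = D (r n)" unfolding D_def using FH by (subst nrm_minus_commute) auto
    also have "A ?f - adj y = adj (T ?f - y)" using FH y by (simp add: adj_diff)
    finally show ?thesis
      using adj_bounded[OF C, of "T ?f - y"] FH y by (smt (verit) T_mem diff_mem divide_right_mono zero_le_power2)
  qed
  have E0: "E \<longlonglongrightarrow> 0"
  proof (rule tendsto_sandwich[OF _ _ tendsto_const])
    show "\<forall>\<^sub>F n in sequentially. E n \<le> (D (r n) + C * nrm (T (F (r n)) - y)) / s\<^sup>2" using E_le by simp
    have "(\<lambda>n. (D (r n) + C * nrm (T (F (r n)) - y)) / s\<^sup>2) \<longlonglongrightarrow> (0 + C * 0) / s\<^sup>2"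
      by (intro tendsto_intros Dr y) (use s0 in auto)
    then show "(\<lambda>n. (D (r n) + C * nrm (T (F (r n)) - y)) / s\<^sup>2) \<longlonglongrightarrow> 0" by simp
    show "\<forall>\<^sub>F n in sequentially. 0 \<le> E n" using FH uH by (simp add: E_def)
  qed
  have "1 \<le> nrm u"
  proof (rule LIMSEQ_le_const2)
    show "(\<lambda>n. 1 - E n) \<longlonglongrightarrow> 1" using tendsto_diff[OF tendsto_const E0, of 1] by simp
    have "1 - E n \<le> nrm u" for n
      using nrm_triangle[of "F (r n) - u" u] FH[of "r n"] uH by (simp add: E_def)
    then show "\<exists>N. \<forall>n\<ge>N. 1 - E n \<le> nrm u" by blast
  qed
  then have u0: "u \<noteq> 0" by auto
  have u_orth: "ip u v = 0" if v: "v \<in> B" for v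
  proof -
    have "cmod (ip u v) \<le> 0"
    proof (rule LIMSEQ_le_const[OF E0])
      have "cmod (ip u v) \<le> E n" for n
      proof -
        have "ip u v = ip (u - F (r n)) v"
          using uH FH[of "r n"] v BH[OF v] by (simp add: ip_diff_left W_def)
        also have "cmod \<dots> \<le> nrm (u - F (r n)) * nrm v"
          using Cauchy_Schwarz uH FH BH[OF v] by simp
        also have "\<dots> = E n" using nrm_minus_commute[OF uH FH(1)] orthonormal_nrm[OF ob(1) v] by (simp add: E_def)
        finally show ?thesis .
      qed
      then show "\<exists>N. \<forall>n\<ge>N. cmod (ip u v) \<le> E n" by blast
    qed
    then show ?thesis by simp
  qed
  have "nrm (A u - fun_scale (of_real (s\<^sup>2)) u) \<le> 0"
  proof (rule LIMSEQ_le_const)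
    have "(\<lambda>n. C * (C * E n) + (D (r n) + s\<^sup>2 * E n)) \<longlonglongrightarrow> C * (C * 0) + (0 + s\<^sup>2 * 0)"
      by (intro tendsto_intros E0 Dr)
    then show "(\<lambda>n. C * (C * E n) + (D (r n) + s\<^sup>2 * E n)) \<longlonglongrightarrow> 0" by simp
    have "nrm (A u - fun_scale (of_real (s\<^sup>2)) u) \<le> C * (C * E n) + (D (r n) + s\<^sup>2 * E n)" for n
    proof -
      let ?f = "F (r n)"
      let ?k = "of_real (s\<^sup>2) :: complex"
      have m: "?f \<in> H" "?f - u \<in> H" using FH uH by auto
      have "nrm (A u - fun_scale ?k u) \<le> nrm (A u - A ?f) + nrm (A ?f - fun_scale ?k u)"
        using uH m by (intro nrm_triangle_diff) auto
      moreover have "nrm (A ?f - fun_scale ?k u) \<le> nrm (A ?f - fun_scale ?k ?f) + nrm (fun_scale ?k ?f - fun_scale ?k u)"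
        using uH m by (intro nrm_triangle_diff) auto
      moreover have "nrm (fun_scale ?k ?f - fun_scale ?k u) = s\<^sup>2 * E n"
        using m by (simp add: fs.scale_right_diff_distrib[symmetric] nrm_scale norm_power E_def del: of_real_power)
      moreover have "nrm (A u - A ?f) = nrm (A (?f - u))"
        using m uH nrm_minus_commute[of "A u" "A ?f"] by (simp add: T_diff adj_diff)
      moreover have "nrm (A (?f - u)) \<le> C * nrm (T (?f - u))" using m by (intro adj_bounded C) auto
      moreover have "C * nrm (T (?f - u)) \<le> C * (C * E n)"
        unfolding E_def using m C by (intro mult_left_mono) auto
      ultimately show ?thesis unfolding D_def by linarith
    qed
    then show "\<exists>N. \<forall>n\<ge>N. nrm (A u - fun_scale (of_real (s\<^sup>2)) u) \<le> C * (C * E n) + (D (r n) + s\<^sup>2 * E n)" by blast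
  qed
  moreover have "0 \<le> nrm (A u - fun_scale (of_real (s\<^sup>2)) u)" using uH by (intro nrm_nonneg) simp
  ultimately have "nrm (A u - fun_scale (of_real (s\<^sup>2)) u) = 0" by (rule antisym)
  then have "A u = fun_scale (of_real (s\<^sup>2)) u"
    using nrm_eq_0[of "A u - fun_scale (of_real (s\<^sup>2)) u"] uH by simp
  from no_further_eigenvector[OF B _ ts uH u_orth this] t u0 show False by simp
qed

lemma finite_level_set:
  assumes "s \<longlonglongrightarrow> (0::real)" "0 < t"
  shows "finite {n. t < s n}"
proof -
  have "eventually (\<lambda>n. s n < t) sequentially" using assms by (rule order_tendstoD(2))
  then obtain N where "\<And>n. n \<ge> N \<Longrightarrow> s n < t" by (auto simp: eventually_sequentially)
  then have "{n. t < s n} \<subseteq> {..<N}" by (force simp: not_less[symmetric])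
  then show ?thesis by (rule finite_subset) simp
qed

lemma sum_maximal_system:
  assumes s: "singular_numbers_on H ip T s" "summable (\<lambda>n. s n powr q)"
    and B: "maximal_system t B" and t: "0 < t"
  shows "(\<Sum>v\<in>B. nrm (T v) powr q) \<le> (\<Sum>n. s n powr q)"
proof -
  have ob: "orthonormal B" "B \<subseteq> singular_vectors t" using B by (auto simp: maximal_system_def)
  have fin: "finite B" using finite_system[OF t ob] .
  define L where "L = (\<lambda>v. nrm (T v)) ` B"
  define N where "N = {n. s n \<in> L}"
  have Lt: "t < l" if "l \<in> L" for l using that ob by (auto simp: L_def singular_vectors_def)
  have "N \<subseteq> {n. t < s n}" using Lt by (auto simp: N_def)
  then have finN: "finite N"
    using finite_level_set[of s t] s(1) t by (auto simp: singular_numbers_on_def intro: finite_subset)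
  have cd: "card {v \<in> B. nrm (T v) = l} = card {n \<in> N. s n = l}" if l: "l \<in> L" for l
  proof -
    have "{n \<in> N. s n = l} = {n. s n = l}" using l by (auto simp: N_def)
    moreover have "card {n. s n = l} = fs.dim (eigenspace_on H A (of_real (l\<^sup>2)))"
      using s(1) Lt[OF l] t unfolding singular_numbers_on_def adj_def by auto
    ultimately show ?thesis using card_maximal_system[OF B t Lt[OF l]] by simp
  qed
  have "(\<Sum>v\<in>B. nrm (T v) powr q) = (\<Sum>l\<in>L. \<Sum>v\<in>{v \<in> B. nrm (T v) = l}. nrm (T v) powr q)"
    by (rule sum.group[symmetric]) (use fin in \<open>auto simp: L_def\<close>)
  also have "\<dots> = (\<Sum>l\<in>L. real (card {v \<in> B. nrm (T v) = l}) * l powr q)"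
    by (intro sum.cong) auto
  also have "\<dots> = (\<Sum>l\<in>L. real (card {n \<in> N. s n = l}) * l powr q)"
    by (intro sum.cong) (auto simp: cd)
  also have "\<dots> = (\<Sum>l\<in>L. \<Sum>n\<in>{n \<in> N. s n = l}. s n powr q)"
    by (intro sum.cong) auto
  also have "\<dots> = (\<Sum>n\<in>N. s n powr q)"
    by (rule sum.group) (use fin finN in \<open>auto simp: L_def N_def\<close>)
  also have "\<dots> \<le> (\<Sum>n. s n powr q)"
    by (rule sum_le_suminf) (use s finN in auto)
  finally show ?thesis .
qed

text \<open>
For a unit vector \<open>f\<close> the number \<open>\<parallel>T f\<parallel>\<^sup>2\<close> is at most a convex combination of the squared singular
numbers \<open>\<parallel>T v\<parallel>\<^sup>2\<close> with weights \<open>\<bar>\<langle>f, v\<rangle>\<bar>\<^sup>2\<close>, and of \<open>t\<^sup>2\<close> for the part of \<open>f\<close> orthogonal to the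
maximal system. The claim is Jensen's inequality for the function \<open>x \<mapsto> x\<^bsup>q/2\<^esup>\<close>, which is
convex because \<open>q \<ge> 2\<close>.
\<close>

lemma nrm_T_powr_le:
  assumes B: "maximal_system t B" and t: "0 < t" and f: "f \<in> H" "nrm f = 1" and q: "2 \<le> q"
  shows "nrm (T f) powr q \<le> (\<Sum>v\<in>B. (cmod (ip f v))\<^sup>2 * nrm (T v) powr q) + t powr q"
proof -
  have ob: "orthonormal B" "B \<subseteq> singular_vectors t" using B by (auto simp: maximal_system_def)
  have fin: "finite B" using finite_system[OF t ob] .
  have BH: "B \<subseteq> H" using ob by (auto simp: orthonormal_def)
  define p where "p = proj B f"
  define g where "g = f - p"
  define a where "a v = (cmod (ip f v))\<^sup>2" for v
  have mem: "p \<in> H" "g \<in> H" using ob f by (auto simp: p_def g_def)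
  have g_orth: "ip g v = 0" if "v \<in> B" for v
    using ip_residual[OF ob(1) fin that f(1)] by (simp add: g_def p_def)
  have Av: "A v = fun_scale (of_real ((nrm (T v))\<^sup>2)) v" if "v \<in> B" for v
    using that ob by (auto simp: singular_vectors_def)
  have Ap: "A p = (\<Sum>v\<in>B. fun_scale (ip f v) (fun_scale (of_real ((nrm (T v))\<^sup>2)) v))"
    unfolding p_def proj_def using fin BH by (subst A_sum) (auto intro!: sum.cong simp: Av)
  have ip_Ap: "ip h (A p) = (\<Sum>v\<in>B. cnj (ip f v) * of_real ((nrm (T v))\<^sup>2) * ip h v)" if "h \<in> H" for h
    unfolding Ap using that BH by (subst ip_sum_right) (auto simp: ip_scale_right subset_iff mult_ac)
  have "ip f (A p) = (\<Sum>v\<in>B. of_real (a v * (nrm (T v))\<^sup>2))"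
    unfolding ip_Ap[OF f(1)] a_def of_real_mult complex_norm_square by (intro sum.cong) auto
  then have 1: "ip f (A p) = of_real (\<Sum>v\<in>B. a v * (nrm (T v))\<^sup>2)" by simp
  have "ip g (A p) = 0" unfolding ip_Ap[OF mem(2)] by (simp add: g_orth)
  then have pg: "ip p (A g) = 0"
    using A_selfadjoint[OF mem] ip_commute[of g "A p"] mem by simp
  have fpg: "f = p + g" by (simp add: g_def)
  have "A f = A p + A g" using mem T_add[OF mem] adj_add[of "T p" "T g"] by (simp add: fpg)
  then have "ip f (A f) = ip f (A p) + ip f (A g)" using f mem by (simp add: ip_add_right)
  also have "ip f (A g) = ip g (A g)" using ip_add_left[OF mem, of "A g"] pg mem by (simp add: fpg)
  finally have "Re (ip f (A f)) = (\<Sum>v\<in>B. a v * (nrm (T v))\<^sup>2) + (nrm (T g))\<^sup>2"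
    using 1 mem by (simp add: nrm_sq ip_TT)
  then have norm_Tf: "(nrm (T f))\<^sup>2 = (\<Sum>v\<in>B. a v * (nrm (T v))\<^sup>2) + (nrm (T g))\<^sup>2"
    using f by (simp add: nrm_sq ip_TT)
  define b where "b = 1 - sum a B"
  have ng: "(nrm g)\<^sup>2 = b" using nrm_residual[OF ob(1) fin f(1)] f by (simp add: g_def p_def a_def b_def)
  have b: "0 \<le> b" "b \<le> 1"
    using ng zero_le_power2[of "nrm g"] by (auto simp: b_def a_def sum_nonneg)
  have "nrm (T g) \<le> t * nrm g" using nrm_T_orthogonal[OF B t mem(2) g_orth] .
  then have "(nrm (T g))\<^sup>2 \<le> (t * nrm g)\<^sup>2" using mem by (intro power_mono) auto
  then have le: "(nrm (T f))\<^sup>2 \<le> (\<Sum>v\<in>B. a v * (nrm (T v))\<^sup>2) + b * t\<^sup>2"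
    using norm_Tf ng by (simp add: power_mult_distrib mult.commute)
  \<comment> \<open>The right-hand side is a convex combination over \<open>B\<close> and one further point.\<close>
  define I where "I = insert None (Some ` B)"
  define w where "w = (\<lambda>x. case x of None \<Rightarrow> b | Some v \<Rightarrow> a v)"
  define y where "y = (\<lambda>x. case x of None \<Rightarrow> t\<^sup>2 | Some v \<Rightarrow> (nrm (T v))\<^sup>2)"
  have sumI: "(\<Sum>x\<in>I. h x) = (\<Sum>v\<in>B. h (Some v)) + h None" for h :: "_ \<Rightarrow> real"
    using fin by (simp add: I_def sum.reindex o_def add.commute)
  have pos: "0 < nrm (T v)" if "v \<in> B" for v using that ob t by (auto simp: singular_vectors_def)
  have sq: "(x\<^sup>2) powr (q / 2) = x powr q" if "0 < x" for x :: real
    using that by (simp add: powr_powr flip: powr_numeral)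
  have "(\<Sum>x\<in>I. w x *\<^sub>R y x) powr (q / 2) \<le> (\<Sum>x\<in>I. w x * y x powr (q / 2))"
  proof (rule convex_on_sum[OF _ _ powr_convex])
    show "finite I" "I \<noteq> {}" using fin by (auto simp: I_def)
    show "1 \<le> q / 2" using q by simp
    show "(\<Sum>x\<in>I. w x) = 1" unfolding sumI by (simp add: w_def b_def)
    show "0 \<le> w x" if "x \<in> I" for x using b by (auto simp: w_def a_def split: option.split)
    show "y x \<in> {0<..}" if "x \<in> I" for x using that t pos by (auto simp: y_def I_def less_imp_neq[symmetric])
  qed
  also have "\<dots> = (\<Sum>v\<in>B. a v * nrm (T v) powr q) + b * t powr q"
    unfolding sumI using pos t by (auto simp: w_def y_def sq intro!: sum.cong)
  also have "\<dots> \<le> (\<Sum>v\<in>B. a v * nrm (T v) powr q) + t powr q"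
    using b by (simp add: mult_left_le_one_le)
  finally have jensen: "((\<Sum>v\<in>B. a v * (nrm (T v))\<^sup>2) + b * t\<^sup>2) powr (q / 2) \<le>
      (\<Sum>v\<in>B. a v * nrm (T v) powr q) + t powr q"
    unfolding sumI by (simp add: w_def y_def)
  have "nrm (T f) powr q = ((nrm (T f))\<^sup>2) powr (q / 2)"
  proof (cases "nrm (T f) = 0")
    case False
    then have "0 < nrm (T f)" using nrm_nonneg[OF T_mem[OF f(1)]] by linarith
    then show ?thesis by (simp add: sq)
  qed simp
  also have "\<dots> \<le> ((\<Sum>v\<in>B. a v * (nrm (T v))\<^sup>2) + b * t\<^sup>2) powr (q / 2)"
    using le q by (intro powr_mono2) auto
  also note jensen
  finally show ?thesis by (simp add: a_def)
qed

text \<open>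
The preceding estimate, summed over the \<open>f j\<close>, together with Bessel's inequality for each singular
vector gives the claim up to an error of \<open>M\<close> times \<open>t\<^bsup>q\<^esup>\<close>; the cut-off \<open>t\<close> then tends to \<open>0\<close>.
\<close>

theorem sum_nrm_T_powr_le:
  fixes f :: "nat \<Rightarrow> 'a \<Rightarrow> complex"
  assumes s: "singular_numbers_on H ip T s" "summable (\<lambda>n. s n powr q)" and q: "2 \<le> q"
    and f: "\<And>j. f j \<in> H" "\<And>i j. ip (f i) (f j) = (if i = j then 1 else 0)"
  shows "(\<Sum>j<M. nrm (T (f j)) powr q) \<le> (\<Sum>n. s n powr q)"
proof -
  have f1: "nrm (f j) = 1" for j using f(2)[of j j] by (simp add: hnorm_def)
  have inj: "inj f"
    using f(2) by (intro injI) (metis zero_neq_one)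
  have on: "orthonormal (f ` {..<M})" using f inj by (auto simp: orthonormal_def inj_eq)
  have "(\<Sum>j<M. nrm (T (f j)) powr q) \<le> (\<Sum>n. s n powr q) + real M * t powr q" if t: "0 < t" for t
  proof -
    obtain B where B: "maximal_system t B" using ex_maximal_system by blast
    then have ob: "orthonormal B" "B \<subseteq> singular_vectors t" by (auto simp: maximal_system_def)
    have fin: "finite B" using finite_system[OF t ob] .
    have "(\<Sum>j<M. nrm (T (f j)) powr q) \<le>
        (\<Sum>j<M. (\<Sum>v\<in>B. (cmod (ip (f j) v))\<^sup>2 * nrm (T v) powr q) + t powr q)"
      by (intro sum_mono nrm_T_powr_le B t f f1 q)
    also have "\<dots> = (\<Sum>v\<in>B. (\<Sum>j<M. (cmod (ip (f j) v))\<^sup>2) * nrm (T v) powr q) + real M * t powr q"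
      by (simp add: sum.distrib sum_distrib_right sum.swap[of _ B])
    also have "\<dots> \<le> (\<Sum>v\<in>B. 1 * nrm (T v) powr q) + real M * t powr q"
    proof (intro add_right_mono sum_mono mult_right_mono)
      fix v assume v: "v \<in> B"
      then have vH: "v \<in> H" "nrm v = 1" using ob by (auto simp: orthonormal_nrm orthonormal_def)
      have sw: "cmod (ip (f j) v) = cmod (ip v (f j))" for j
        using ip_commute[OF vH(1) f(1)[of j]] by (simp only: complex_mod_cnj)
      have "(\<Sum>j<M. (cmod (ip (f j) v))\<^sup>2) = (\<Sum>j<M. (cmod (ip v (f j)))\<^sup>2)"
        by (simp only: sw)
      also have "\<dots> = (\<Sum>u\<in>f ` {..<M}. (cmod (ip v u))\<^sup>2)"
        using inj_on_subset[OF inj subset_UNIV] by (simp only: sum.reindex o_def)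
      also have "\<dots> \<le> (nrm v)\<^sup>2" by (rule Bessel[OF on _ vH(1)]) simp
      finally show "(\<Sum>j<M. (cmod (ip (f j) v))\<^sup>2) \<le> 1" using vH by simp
    qed simp
    also have "\<dots> \<le> (\<Sum>n. s n powr q) + real M * t powr q"
      using sum_maximal_system[OF s B t] by simp
    finally show ?thesis .
  qed
  then have "\<forall>\<^sub>F t in at_right 0. (\<Sum>j<M. nrm (T (f j)) powr q) \<le> (\<Sum>n. s n powr q) + real M * t powr q"
    using eventually_at_right_less[of "0::real"] by (rule eventually_mono[rotated])
  moreover have "((\<lambda>t. (\<Sum>n. s n powr q) + real M * t powr q) \<longlongrightarrow> (\<Sum>n. s n powr q) + real M * 0) (at_right 0)"
  proof (intro tendsto_intros)
    have "((\<lambda>t::real. t powr q) \<longlongrightarrow> 0 powr q) (at_right 0)"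
      using q by (intro tendsto_powr' tendsto_intros) (auto simp: eventually_at_right_less less_imp_le intro: eventually_mono[OF eventually_at_right_less[of 0]])
    then show "((\<lambda>t::real. t powr q) \<longlongrightarrow> 0) (at_right 0)" by simp
  qed
  ultimately show ?thesis
    by (intro tendsto_lowerbound[of _ _ "at_right 0"]) auto
qed

end

section \<open>Integration over the disc\<close>

lemma emeasure_lborel_translate_vimage:
  fixes A :: "'a :: euclidean_space set"
  assumes "A \<in> sets borel"
  shows "emeasure lborel {x. x + c \<in> A} = emeasure lborel A"
proof -
  have "emeasure lborel A = emeasure (distr lborel borel ((+) c)) A" by (simp add: lborel_distr_plus)
  also have "\<dots> = emeasure lborel {x. x + c \<in> A}"
    using assms by (subst emeasure_distr) (auto simp: vimage_def add.commute)
  finally show ?thesis by simp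
qed

text \<open>
Both sides are translation invariant, and they agree on balls. The classical uniqueness argument
for Haar measure makes equality out of this: the product of the measure of \<open>f\<^sup>-\<^sup>1 A\<close> with that
of the unit ball is a double integral, which is transformed by translations alone and by
exchanging the order of integration into the product of the measure of \<open>A\<close> with that of a ball
of radius \<open>1\<close>.
\<close>

lemma lborel_distr_orthogonal_transformation:
  fixes f :: "'a :: euclidean_space \<Rightarrow> 'a"
  assumes f: "orthogonal_transformation f"
  shows "distr lborel borel f = lborel"
proof -
  have lin: "linear f" and inj: "inj f" and bij: "bij f"
    using f orthogonal_transformation_linear orthogonal_transformation_inj orthogonal_transformation_bij by auto
  have meas [measurable]: "f \<in> borel_measurable borel"
    using lin by (intro borel_measurable_continuous_onI linear_continuous_on) (simp add: linear_conv_bounded_linear)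
  define B where "B = ball (0::'a) 1"
  have B [measurable]: "B \<in> sets borel" by (simp add: B_def)
  define V where "V = emeasure lborel B"
  have V: "V \<noteq> 0" "V \<noteq> \<top>" using content_ball_pos[of 1 "0::'a"] emeasure_lborel_ball_finite[of "0::'a" 1]
    by (auto simp: V_def B_def measure_def)
  have ball: "emeasure lborel (ball c 1) = V" for c :: 'a
    by (simp add: V_def B_def emeasure_ball)
  show ?thesis
  proof (rule measure_eqI)
    fix A :: "'a set" assume "A \<in> sets (distr lborel borel f)"
    then have A [measurable]: "A \<in> sets borel" by simp
    have L: "(\<integral>\<^sup>+x. indicator A (f x + y) \<partial>lborel) = emeasure (distr lborel borel f) A" for y
    proof -
      obtain c where c: "f c = y" using bij by (metis bij_is_surj surjE)
      have "(\<integral>\<^sup>+x. indicator A (f x + y) \<partial>lborel) = (\<integral>\<^sup>+x. indicator {x. x + c \<in> f -` A} x \<partial>lborel)"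
        using lin by (intro nn_integral_cong) (auto simp: indicator_def c[symmetric] linear_add)
      also have "\<dots> = emeasure lborel {x. x + c \<in> f -` A}"
        by (rule nn_integral_indicator) (use measurable_sets[OF meas, of A] in \<open>measurable; simp\<close>)
      also have "\<dots> = emeasure lborel (f -` A)"
        using measurable_sets[OF meas, of A] by (intro emeasure_lborel_translate_vimage) simp
      finally show ?thesis by (simp add: emeasure_distr)
    qed
    have R: "(\<integral>\<^sup>+x. indicator B (y - f x) \<partial>lborel) = V" for y
    proof -
      obtain c where c: "f c = y" using bij by (metis bij_is_surj surjE)
      have "norm (y - f x) = norm (c - x)" for x
        using orthogonal_transformation_norm[OF f, of "c - x"] by (simp add: linear_diff[OF lin] c)
      then have "(\<integral>\<^sup>+x. indicator B (y - f x) \<partial>lborel) = (\<integral>\<^sup>+x. indicator (ball c 1) x \<partial>lborel)"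
        by (intro nn_integral_cong) (auto simp: indicator_def B_def dist_norm norm_minus_commute)
      then show ?thesis by (simp add: ball)
    qed
    have "emeasure (distr lborel borel f) A * V = (\<integral>\<^sup>+y. emeasure (distr lborel borel f) A * indicator B y \<partial>lborel)"
      by (simp add: V_def nn_integral_cmult_indicator)
    also have "\<dots> = (\<integral>\<^sup>+y. \<integral>\<^sup>+x. indicator A (f x + y) * indicator B y \<partial>lborel \<partial>lborel)"
      by (simp add: nn_integral_multc L)
    also have "\<dots> = (\<integral>\<^sup>+x. \<integral>\<^sup>+y. indicator A (f x + y) * indicator B y \<partial>lborel \<partial>lborel)"
      by (rule lborel_pair.Fubini') measurable
    also have "\<dots> = (\<integral>\<^sup>+x. \<integral>\<^sup>+y. indicator A y * indicator B (y - f x) \<partial>lborel \<partial>lborel)"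
    proof (rule nn_integral_cong)
      fix x
      have "(\<integral>\<^sup>+y. indicator A y * indicator B (y - f x) \<partial>lborel) =
            (\<integral>\<^sup>+y. indicator A y * indicator B (y - f x) \<partial>distr lborel borel ((+) (f x)))"
        by (simp add: lborel_distr_plus)
      also have "\<dots> = (\<integral>\<^sup>+y. indicator A (f x + y) * indicator B y \<partial>lborel)"
        by (subst nn_integral_distr) auto
      finally show "(\<integral>\<^sup>+y. indicator A (f x + y) * indicator B y \<partial>lborel) =
        (\<integral>\<^sup>+y. indicator A y * indicator B (y - f x) \<partial>lborel)" by simp
    qed
    also have "\<dots> = (\<integral>\<^sup>+y. \<integral>\<^sup>+x. indicator A y * indicator B (y - f x) \<partial>lborel \<partial>lborel)"
      by (rule lborel_pair.Fubini') measurable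
    also have "\<dots> = emeasure lborel A * V"
      by (simp add: nn_integral_cmult R nn_integral_multc)
    finally show "emeasure (distr lborel borel f) A = emeasure lborel A"
      using V ennreal_mult_cancel_left[of V "emeasure (distr lborel borel f) A" "emeasure lborel A"]
      by (simp add: mult.commute)
  qed simp
qed

lemma borel_measurable_cnj [measurable (raw)]:
  "f \<in> borel_measurable M \<Longrightarrow> (\<lambda>x. cnj (f x)) \<in> borel_measurable M"
  by (rule measurable_compose[OF _ borel_measurable_continuous_onI[of cnj]]) (auto intro: continuous_intros)

lemma ball_in_sets_borel [measurable]: "ball (c :: complex) r \<in> sets borel"
  by simp

lemma sums_integral_bounded:
  fixes u :: "nat \<Rightarrow> 'a \<Rightarrow> complex"
  assumes fin: "finite_measure M"
    and meas: "\<And>j. u j \<in> borel_measurable M"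
    and bound: "\<And>j x. x \<in> space M \<Longrightarrow> cmod (u j x) \<le> b j" and b: "summable b"
    and sums: "\<And>x. x \<in> space M \<Longrightarrow> (\<lambda>j. u j x) sums s x"
  shows "(\<lambda>j. LINT x|M. u j x) sums (LINT x|M. s x)" and "integrable M s"
proof -
  interpret finite_measure M by (rule fin)
  have int: "integrable M (u j)" for j
    by (rule integrable_const_bound[where B = "b j"]) (use bound meas in auto)
  have sn: "AE x in M. summable (\<lambda>j. cmod (u j x))"
    using bound by (intro AE_I2 summable_comparison_test'[OF b]) auto
  have ints: "summable (\<lambda>j. LINT x|M. cmod (u j x))"
  proof (rule summable_comparison_test'[OF summable_mult[OF b, of "measure M (space M)"]])
    fix j
    have "(LINT x|M. cmod (u j x)) \<le> (LINT x|M. b j)"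
      using int bound by (intro integral_mono) auto
    then show "norm (LINT x|M. cmod (u j x)) \<le> measure M (space M) * b j" by simp
  qed
  have eq: "(LINT x|M. (\<Sum>j. u j x)) = (LINT x|M. s x)"
    by (intro Bochner_Integration.integral_cong) (auto simp: sums_unique[OF sums])
  show "(\<lambda>j. LINT x|M. u j x) sums (LINT x|M. s x)"
    using sums_integral[OF int sn ints] unfolding eq .
  have "integrable M (\<lambda>x. \<Sum>j. u j x)" by (rule integrable_suminf[OF int sn ints])
  then show "integrable M s"
    by (rule Bochner_Integration.integrable_cong[THEN iffD1, rotated 2]) (auto simp: sums_unique[OF sums])
qed

text \<open>
Under \<open>z \<mapsto> \<bar>z\<bar>\<^sup>2\<close> area becomes \<open>\<pi>\<close> times length, because a disc of radius \<open>\<surd>u\<close> has area \<open>\<pi> u\<close>.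
It replaces polar coordinates for radial integrands.
\<close>

lemma distr_cmod_square_disc:
  "distr (restrict_space lborel (ball (0::complex) 1)) borel (\<lambda>z. (cmod z)\<^sup>2) =
     density lborel (\<lambda>u. ennreal pi * indicator {0..<1} u)" (is "?M = ?N")
proof -
  have area: "emeasure lborel (ball (0::complex) r) = ennreal (pi * r\<^sup>2)"
    "emeasure lborel (cball (0::complex) r) = ennreal (pi * r\<^sup>2)" if "0 \<le> r" for r
    using that by (simp_all add: emeasure_ball emeasure_cball unit_ball_vol_2)
  have M: "emeasure ?M {x<..} = emeasure lborel {z \<in> ball (0::complex) 1. x < (cmod z)\<^sup>2}" for x
  proof -
    let ?R = "restrict_space lborel (ball (0::complex) 1)"
    have "emeasure ?M {x<..} = emeasure ?R ((\<lambda>z. (cmod z)\<^sup>2) -` {x<..} \<inter> space ?R)"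
      by (rule emeasure_distr) (auto intro!: measurable_restrict_space1)
    also have "(\<lambda>z. (cmod z)\<^sup>2) -` {x<..} \<inter> space ?R = {z \<in> ball (0::complex) 1. x < (cmod z)\<^sup>2}"
      by (auto simp: space_restrict_space)
    also have "emeasure ?R \<dots> = emeasure lborel {z \<in> ball (0::complex) 1. x < (cmod z)\<^sup>2}"
      by (rule emeasure_restrict_space) auto
    finally show ?thesis .
  qed
  have N: "emeasure ?N {x<..} = ennreal pi * emeasure lborel ({x<..} \<inter> {0..<1})" for x :: real
    by (subst emeasure_density)
      (auto simp: nn_integral_cmult_indicator mult.assoc indicator_inter_arith[symmetric] Int_commute)
  have eq: "emeasure ?M {x<..} = emeasure ?N {x<..}" for x
  proof -
    consider "x < 0" | "0 \<le> x" "x < 1" | "1 \<le> x" by linarith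
    then show ?thesis
    proof cases
      case 1
      have "x < (cmod z)\<^sup>2" for z using 1 zero_le_power2[of "cmod z"] by linarith
      then have "{z \<in> ball (0::complex) 1. x < (cmod z)\<^sup>2} = ball 0 1" by blast
      moreover have "{x<..} \<inter> {0..<1} = {0..<1}" using 1 by auto
      ultimately show ?thesis unfolding M N by (simp add: area)
    next
      case 2
      have sq: "x < (cmod z)\<^sup>2 \<longleftrightarrow> \<not> cmod z \<le> sqrt x" for z
        using 2 by (metis norm_ge_zero not_le real_sqrt_less_iff real_sqrt_abs abs_norm_cancel)
      have "{z \<in> ball (0::complex) 1. x < (cmod z)\<^sup>2} = ball 0 1 - cball 0 (sqrt x)"
        unfolding set_diff_eq sq mem_cball_0 by (rule refl)
      also have "emeasure lborel \<dots> = ennreal (pi * 1\<^sup>2) - ennreal (pi * (sqrt x)\<^sup>2)"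
      proof (subst emeasure_Diff)
        have "sqrt x < 1" using 2 by (simp add: real_sqrt_lt_1_iff)
        then have "cmod z < 1" if "cmod z \<le> sqrt x" for z using that by linarith
        then show "cball (0::complex) (sqrt x) \<subseteq> ball 0 1" by (auto simp: subset_iff)
      qed (use 2 area(2)[of "sqrt x"] in \<open>auto simp: area\<close>)
      also have "\<dots> = ennreal pi * ennreal (1 - x)"
        using 2 by (simp add: ennreal_minus flip: ennreal_mult) (simp add: algebra_simps)
      also have "{x<..} \<inter> {0..<1} = {x<..<1}" using 2 by auto
      then have "ennreal pi * ennreal (1 - x) = ennreal pi * emeasure lborel ({x<..} \<inter> {0..<1})"
        using 2 by simp
      finally show ?thesis unfolding M N .
    next
      case 3
      have "\<not> x < (cmod z)\<^sup>2" if "cmod z < 1" for z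
        using that 3 power_mono[of "cmod z" 1 2] by auto
      then have e: "{z \<in> ball (0::complex) 1. x < (cmod z)\<^sup>2} = {}" by auto
      have "{x<..} \<inter> {0..<1} = {}" using 3 by auto
      then show ?thesis unfolding M N e by simp
    qed
  qed
  show ?thesis
  proof (rule measure_eqI_lessThan)
    fix x
    have "emeasure ?M {x<..} \<le> emeasure lborel (ball (0::complex) 1)"
      unfolding M by (rule emeasure_mono) auto
    also have "\<dots> < \<infinity>" using emeasure_lborel_ball_finite[of "0::complex" 1] by simp
    finally show "emeasure ?M {x<..} < \<infinity>" .
  qed (use eq in auto)
qed

locale dirichlet_weight =
  fixes \<alpha> :: real
  assumes \<alpha>0: "0 < \<alpha>" and \<alpha>1: "\<alpha> < 1"
begin

abbreviation D :: "complex measure" where "D \<equiv> disc_measure \<alpha>"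

definition density_at :: "real \<Rightarrow> real" where
  "density_at u = (1 + \<alpha>) * (1 - u) powr \<alpha> / pi"

lemma density_at_nonneg [simp]: "0 \<le> density_at u"
  using \<alpha>0 by (simp add: density_at_def)

lemma density_at_measurable [measurable]: "density_at \<in> borel_measurable borel"
  unfolding density_at_def by measurable

lemma disc_measure_eq: "D = density (restrict_space lborel (ball 0 1)) (\<lambda>z. ennreal (density_at ((cmod z)\<^sup>2)))"
  by (simp add: disc_measure_def density_at_def)

lemma space_D [simp]: "space D = ball 0 1"
  by (simp add: disc_measure_eq space_restrict_space)

lemma sets_D: "sets D = sets (restrict_space borel (ball 0 1))"
  by (simp add: disc_measure_eq sets_restrict_space)

lemma measurable_D: "f \<in> borel_measurable (restrict_space borel (ball 0 1)) \<longleftrightarrow> f \<in> borel_measurable D"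
  using measurable_cong_sets[OF sets_D refl] by blast

lemma continuous_measurable_D: "continuous_on (ball 0 1) f \<Longrightarrow> (f :: complex \<Rightarrow> complex) \<in> borel_measurable D"
  using borel_measurable_continuous_on_restrict measurable_D by blast

lemma borel_measurable_D [measurable (raw)]: "f \<in> borel_measurable borel \<Longrightarrow> f \<in> borel_measurable D"
  using measurable_restrict_space1 measurable_D by blast

lemma nn_integral_D_radial:
  assumes [measurable]: "h \<in> borel_measurable borel"
  shows "(\<integral>\<^sup>+z. h ((cmod z)\<^sup>2) \<partial>D) =
    (\<integral>\<^sup>+u. ennreal pi * ennreal (density_at u) * h u * indicator {0..<1} u \<partial>lborel)"
proof -
  let ?R = "restrict_space lborel (ball (0::complex) 1)"
  have [measurable]: "(\<lambda>z. (cmod z)\<^sup>2) \<in> borel_measurable ?R"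
    by (intro measurable_restrict_space1) measurable
  have "(\<integral>\<^sup>+z. h ((cmod z)\<^sup>2) \<partial>D) = (\<integral>\<^sup>+z. ennreal (density_at ((cmod z)\<^sup>2)) * h ((cmod z)\<^sup>2) \<partial>?R)"
    unfolding disc_measure_eq by (subst nn_integral_density) auto
  also have "\<dots> = (\<integral>\<^sup>+u. ennreal (density_at u) * h u \<partial>distr ?R borel (\<lambda>z. (cmod z)\<^sup>2))"
    by (subst nn_integral_distr) auto
  also have "\<dots> = (\<integral>\<^sup>+u. ennreal pi * ennreal (density_at u) * h u * indicator {0..<1} u \<partial>lborel)"
    unfolding distr_cmod_square_disc by (subst nn_integral_density) (auto simp: mult_ac)
  finally show ?thesis .
qed

text \<open>
The integral of \<open>\<bar>z\<bar>\<^bsup>2k\<^esup>\<close> with respect to the weighted area measure \<open>D\<close>.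
\<close>

definition moment :: "nat \<Rightarrow> real" where
  "moment k = (1 + \<alpha>) * Beta (real k + 1) (\<alpha> + 1)"

lemma moment_pos: "0 < moment k"
  using \<alpha>0 by (simp add: moment_def Beta_def Gamma_real_pos)

lemma nn_integral_moment: "(\<integral>\<^sup>+z. ennreal (((cmod z)\<^sup>2) ^ k) \<partial>D) = ennreal (moment k)"
proof -
  let ?f = "\<lambda>t::real. t powr (real k + 1 - 1) * (1 - t) powr (\<alpha> + 1 - 1)"
  have "(?f has_integral Beta (real k + 1) (\<alpha> + 1)) {0..1}"
    by (rule has_integral_Beta_real) (use \<alpha>0 in auto)
  then have beta: "(\<integral>\<^sup>+u. ennreal (indicator {0..1} u * ?f u) \<partial>lborel) = ennreal (Beta (real k + 1) (\<alpha> + 1))"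
    by (intro nn_integral_has_integral_lebesgue) auto
  have "(\<integral>\<^sup>+z. ennreal (((cmod z)\<^sup>2) ^ k) \<partial>D) =
      (\<integral>\<^sup>+u. ennreal pi * ennreal (density_at u) * ennreal (u ^ k) * indicator {0..<1} u \<partial>lborel)"
    by (rule nn_integral_D_radial) measurable
  also have "\<dots> = (\<integral>\<^sup>+u. ennreal (1 + \<alpha>) * ennreal (indicator {0..1} u * ?f u) \<partial>lborel)"
  proof (rule nn_integral_cong_AE)
    have "AE u in lborel. u \<noteq> (0::real)" "AE u in lborel. u \<noteq> (1::real)" by (rule AE_lborel_singleton)+
    then show "AE u in lborel. ennreal pi * ennreal (density_at u) * ennreal (u ^ k) * indicator {0..<1} u =
        ennreal (1 + \<alpha>) * ennreal (indicator {0..1} u * ?f u)"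
    proof eventually_elim
      case (elim u)
      show ?case
      proof (cases "0 < u \<and> u < 1")
        case True
        have "ennreal pi * ennreal (density_at u) * ennreal (u ^ k) = ennreal (pi * density_at u * u ^ k)"
          using True by (simp add: ennreal_mult'')
        also have "pi * density_at u * u ^ k = (1 + \<alpha>) * ?f u"
          using True by (simp add: density_at_def powr_realpow)
        finally show ?thesis using True \<alpha>0 by (simp add: ennreal_mult')
      next
        case False
        then show ?thesis using elim by (auto simp: indicator_def)
      qed
    qed
  qed
  also have "\<dots> = ennreal (1 + \<alpha>) * ennreal (Beta (real k + 1) (\<alpha> + 1))"
    by (subst nn_integral_cmult) (auto simp: beta[simplified])
  also have "\<dots> = ennreal (moment k)" using \<alpha>0 by (simp add: moment_def ennreal_mult')
  finally show ?thesis .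
qed

lemma emeasure_D: "emeasure D (space D) = 1"
proof -
  have "Beta 1 (\<alpha> + 1) * (1 + \<alpha>) = 1"
  proof -
    have "\<alpha> + 1 \<notin> \<int>\<^sub>\<le>\<^sub>0" using \<alpha>0 by (auto elim!: nonpos_Ints_cases)
    from Gamma_plus1[OF this] have "Gamma (\<alpha> + 2) = (\<alpha> + 1) * Gamma (\<alpha> + 1)" by (simp add: add_ac)
    moreover have "Gamma (1 + \<alpha>) \<noteq> 0"
      using \<alpha>0 Gamma_real_pos[of "1 + \<alpha>"] by linarith
    ultimately show ?thesis using \<alpha>0 by (simp add: Beta_def add_ac)
  qed
  then have "moment 0 = 1" by (simp add: moment_def mult.commute)
  then show ?thesis using nn_integral_moment[of 0] by simp
qed

lemma prob_D: "prob_space D"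
  by (rule prob_spaceI) (rule emeasure_D)

lemma finite_D: "finite_measure D"
  using prob_D by (rule prob_space.finite_measure)

lemma integral_moment: "(LINT z|D. ((cmod z)\<^sup>2) ^ k) = moment k"
  by (subst integral_eq_nn_integral) (use nn_integral_moment moment_pos in \<open>auto simp: less_imp_le\<close>)

lemma distr_D_rotation:
  assumes c: "cmod c = 1"
  shows "distr D D (\<lambda>z. c * z) = D"
proof (rule measure_eqI)
  have ot: "orthogonal_transformation (\<lambda>z. c * z)"
    unfolding orthogonal_transformation using c by (simp add: norm_mult bounded_linear_mult_right bounded_linear.linear)
  have [measurable]: "(\<lambda>z. c * z) \<in> measurable D D"
  proof -
    have "(\<lambda>z. c * z) \<in> measurable D (restrict_space borel (ball 0 1))"
      by (rule measurable_restrict_space2) (use c in \<open>auto simp: norm_mult\<close>)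
    then show ?thesis using measurable_cong_sets[OF refl sets_D] by blast
  qed
  fix A assume "A \<in> sets (distr D D (\<lambda>z. c * z))"
  then have A: "A \<in> sets D" by simp
  then have A': "A \<in> sets borel" "A \<subseteq> ball 0 1"
    using sets_D sets.sets_into_space[OF A] by (auto simp: sets_restrict_space)
  have em: "emeasure D B = (\<integral>\<^sup>+z. ennreal (density_at ((cmod z)\<^sup>2)) * indicator B z \<partial>lborel)"
    if "B \<in> sets borel" "B \<subseteq> ball 0 1" for B
  proof -
    have "B \<in> sets (restrict_space lborel (ball 0 1))"
      using that by (auto simp: sets_restrict_space)
    then have "emeasure D B = (\<integral>\<^sup>+z. ennreal (density_at ((cmod z)\<^sup>2)) * indicator B z \<partial>restrict_space lborel (ball 0 1))"
      unfolding disc_measure_eq by (rule emeasure_density[rotated]) (intro measurable_restrict_space1; measurable)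
    also have "\<dots> = (\<integral>\<^sup>+z. ennreal (density_at ((cmod z)\<^sup>2)) * indicator B z * indicator (ball 0 1) z \<partial>lborel)"
      by (rule nn_integral_restrict_space) simp
    also have "\<dots> = (\<integral>\<^sup>+z. ennreal (density_at ((cmod z)\<^sup>2)) * indicator B z \<partial>lborel)"
      using that by (intro nn_integral_cong) (auto simp: indicator_def)
    finally show ?thesis .
  qed
  let ?B = "{z. c * z \<in> A}"
  have [measurable]: "A \<in> sets borel" by (rule A')
  have B: "?B \<in> sets borel" by measurable
  have B1: "?B \<subseteq> ball 0 1" using A' c by (auto simp: norm_mult subset_iff)
  have "emeasure (distr D D (\<lambda>z. c * z)) A = emeasure D ?B"
    using A B1 by (subst emeasure_distr) (auto simp: vimage_def Int_absorb2 intro!: arg_cong[where f = "emeasure D"])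
  also have "\<dots> = (\<integral>\<^sup>+z. ennreal (density_at ((cmod z)\<^sup>2)) * indicator ?B z \<partial>lborel)"
    by (rule em[OF B B1])
  also have "\<dots> = (\<integral>\<^sup>+z. ennreal (density_at ((cmod (c * z))\<^sup>2)) * indicator A (c * z) \<partial>lborel)"
    using c by (intro nn_integral_cong) (auto simp: norm_mult indicator_def)
  also have "\<dots> = (\<integral>\<^sup>+z. ennreal (density_at ((cmod z)\<^sup>2)) * indicator A z \<partial>distr lborel borel (\<lambda>z. c * z))"
    by (subst nn_integral_distr) auto
  also have "\<dots> = emeasure D A"
    unfolding lborel_distr_orthogonal_transformation[OF ot] by (rule em[OF A', symmetric])
  finally show "emeasure (distr D D (\<lambda>z. c * z)) A = emeasure D A" .
qed simp

lemma integral_D_rotation: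
  fixes f :: "complex \<Rightarrow> complex"
  assumes "cmod c = 1" "f \<in> borel_measurable borel"
  shows "(LINT z|D. f (c * z)) = (LINT z|D. f z)"
proof -
  have m: "(\<lambda>z. c * z) \<in> measurable D D"
  proof -
    have "(\<lambda>z. c * z) \<in> measurable D (restrict_space borel (ball 0 1))"
      by (rule measurable_restrict_space2) (use assms in \<open>auto simp: norm_mult\<close>)
    then show ?thesis using measurable_cong_sets[OF refl sets_D] by blast
  qed
  have "(LINT z|D. f z) = (LINT z|distr D D (\<lambda>z. c * z). f z)"
    using distr_D_rotation[OF assms(1)] by simp
  also have "\<dots> = (LINT z|D. f (c * z))"
    by (rule integral_distr[OF m]) (use assms in measurable)
  finally show ?thesis by simp
qed

text \<open>
A rotation \<open>c\<close> with \<open>c\<^bsup>j\<^esup> cnj (c\<^bsup>k\<^esup>) = -1\<close> changes the sign of the integrand, but not the integral.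
\<close>

lemma integral_monomials_orthogonal:
  assumes "j \<noteq> k"
  shows "(LINT z|D. indicator (ball 0 r) z * (z ^ j * cnj (z ^ k))) = (0::complex)"
proof -
  define \<theta> where "\<theta> = pi / (real j - real k)"
  define c where "c = cis \<theta>"
  have c1: "cmod c = 1" by (simp add: c_def)
  have "c ^ j * cnj (c ^ k) = cis ((real j - real k) * \<theta>)"
    by (simp add: c_def Complex.DeMoivre cis_cnj cis_mult algebra_simps)
  also have "\<dots> = -1" using assms by (simp add: \<theta>_def)
  finally have c: "c ^ j * cnj (c ^ k) = -1" .
  let ?f = "\<lambda>z. indicator (ball 0 r) z * (z ^ j * cnj (z ^ k)) :: complex"
  have "?f (c * z) = (c ^ j * cnj (c ^ k)) * ?f z" for z
    using c1 by (simp add: indicator_def norm_mult power_mult_distrib mult_ac)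
  then have "(LINT z|D. ?f z) = (LINT z|D. - ?f z)"
    using integral_D_rotation[OF c1, of ?f] unfolding c by simp
  then show ?thesis by simp
qed

text \<open>
On a disc of radius \<open>r < 1\<close> the power series converges uniformly and can be integrated term by
term, so that only the term \<open>j = k\<close> survives. Dominated convergence covers the limit \<open>r \<rightarrow> 1\<close>;
square integrability of \<open>F\<close> provides the majorant.
\<close>

lemma integral_power_series_coeff:
  fixes F :: "complex \<Rightarrow> complex" and b :: "nat \<Rightarrow> complex"
  assumes sums: "\<And>z. z \<in> ball 0 1 \<Longrightarrow> (\<lambda>j. b j * z ^ j) sums F z"
    and meas: "F \<in> borel_measurable D" and int: "integrable D (\<lambda>z. (cmod (F z))\<^sup>2)"
  shows "(LINT z|D. F z * cnj (z ^ k)) = b k * moment k"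
proof -
  interpret finite_measure D by (rule finite_D)
  define r where "r n = 1 - 1 / real (Suc (Suc n))" for n
  have r: "0 < r n" "r n < 1" for n by (auto simp: r_def)
  have r_lim: "r \<longlonglongrightarrow> 1"
  proof -
    have "(\<lambda>n. 1 / real (Suc (Suc n))) \<longlonglongrightarrow> 0"
      using LIMSEQ_Suc[OF LIMSEQ_Suc[OF lim_1_over_n[where 'a = real]]] by simp
    from tendsto_diff[OF tendsto_const this, of 1] show ?thesis by (simp add: r_def[abs_def])
  qed
  have ind_lim: "(\<lambda>n. indicator (ball 0 (r n)) z * w) \<longlonglongrightarrow> w" if "z \<in> ball 0 1" for z w :: complex
  proof (rule tendsto_eventually)
    have "\<forall>\<^sub>F n in sequentially. cmod z < r n" using that by (intro order_tendstoD[OF r_lim]) auto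
    then show "\<forall>\<^sub>F n in sequentially. indicator (ball 0 (r n)) z * w = w"
      by eventually_elim auto
  qed
  have zk: "cmod (z ^ k) \<le> 1" if "z \<in> ball 0 1" for z :: complex
    using that by (simp add: norm_power power_le_one)
  have part: "(LINT z|D. indicator (ball 0 (r n)) z * (F z * cnj (z ^ k))) =
      b k * (LINT z|D. indicator (ball 0 (r n)) z * (z ^ k * cnj (z ^ k)))" for n
  proof -
    let ?u = "\<lambda>j z. indicator (ball 0 (r n)) z * (b j * z ^ j * cnj (z ^ k))"
    have "summable (\<lambda>j. cmod (b j * complex_of_real (r n) ^ j))"
    proof (rule powser_insidea)
      let ?x = "complex_of_real ((1 + r n) / 2)"
      have "?x \<in> ball 0 1" using r[of n] by (simp del: of_real_divide of_real_add)
      then show "summable (\<lambda>j. b j * ?x ^ j)" using sums sums_summable by blast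
      show "norm (complex_of_real (r n)) < norm ?x" using r[of n] by (simp del: of_real_divide of_real_add)
    qed
    then have sb: "summable (\<lambda>j. cmod (b j) * r n ^ j)"
      using r[of n] by (simp add: norm_mult norm_power)
    have "(\<lambda>j. LINT z|D. ?u j z) sums (LINT z|D. indicator (ball 0 (r n)) z * (F z * cnj (z ^ k)))"
    proof (rule sums_integral_bounded(1)[OF finite_D _ _ sb])
      show "?u j \<in> borel_measurable D" for j by (intro borel_measurable_D) measurable
      show "cmod (?u j z) \<le> cmod (b j) * r n ^ j" if "z \<in> space D" for j z
      proof (cases "z \<in> ball 0 (r n)")
        case True
        have "cmod z ^ j * cmod z ^ k \<le> r n ^ j * 1"
          using True zk[of z] that r[of n] by (intro mult_mono power_mono) (auto simp: norm_power)
        then show ?thesis using True by (simp add: norm_mult norm_power mult.assoc mult_left_mono)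
      qed (use r[of n] in auto)
      show "(\<lambda>j. ?u j z) sums (indicator (ball 0 (r n)) z * (F z * cnj (z ^ k)))" if "z \<in> space D" for z
        using that by (intro sums_mult sums_mult2 sums) auto
    qed
    moreover have "(LINT z|D. ?u j z) = (if j = k then b k * (LINT z|D. indicator (ball 0 (r n)) z * (z ^ k * cnj (z ^ k))) else 0)" for j
    proof -
      have "(LINT z|D. ?u j z) = (LINT z|D. b j * (indicator (ball 0 (r n)) z * (z ^ j * cnj (z ^ k))))"
        by (simp add: mult_ac)
      also have "\<dots> = b j * (LINT z|D. indicator (ball 0 (r n)) z * (z ^ j * cnj (z ^ k)))"
        by (rule integral_mult_right_zero)
      finally show ?thesis using integral_monomials_orthogonal[of j k "r n"] by auto
    qed
    ultimately show ?thesis using sums_unique2 sums_single[of k "\<lambda>_. b k * (LINT z|D. indicator (ball 0 (r n)) z * (z ^ k * cnj (z ^ k)))"] by auto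
  qed
  have lim1: "(\<lambda>n. LINT z|D. indicator (ball 0 (r n)) z * (F z * cnj (z ^ k))) \<longlonglongrightarrow> (LINT z|D. F z * cnj (z ^ k))"
  proof (rule integral_dominated_convergence)
    show "integrable D (\<lambda>z. 1 + (cmod (F z))\<^sup>2)" using int by simp
    have "cmod (F z * cnj (z ^ k)) \<le> 1 + (cmod (F z))\<^sup>2" if "z \<in> ball 0 1" for z
    proof -
      have "cmod (F z * cnj (z ^ k)) \<le> cmod (F z) * 1"
        unfolding norm_mult complex_mod_cnj using zk[OF that] by (intro mult_left_mono) auto
      also have "\<dots> \<le> 1 + (cmod (F z))\<^sup>2"
        using zero_le_power2[of "cmod (F z) - 1"] zero_le_power2[of "cmod (F z)"]
        unfolding power2_diff power_one mult_1_right by linarith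
      finally show ?thesis .
    qed
    then show "AE z in D. cmod (indicator (ball 0 (r n)) z * (F z * cnj (z ^ k))) \<le> 1 + (cmod (F z))\<^sup>2" for n
      by (intro AE_I2) (auto simp: indicator_def add_nonneg_nonneg)
  qed (use ind_lim meas in \<open>auto intro!: AE_I2\<close>)
  have "(\<lambda>n. LINT z|D. indicator (ball 0 (r n)) z * (z ^ k * cnj (z ^ k))) \<longlonglongrightarrow> (LINT z|D. z ^ k * cnj (z ^ k))"
  proof (rule integral_dominated_convergence[where w = "\<lambda>_. 1"])
    have "cmod (z ^ k * cnj (z ^ k)) \<le> 1" if "z \<in> ball 0 1" for z :: complex
      unfolding norm_mult complex_mod_cnj using zk[OF that] by (intro mult_le_one) auto
    then show "AE z in D. cmod (indicator (ball 0 (r n)) z * (z ^ k * cnj (z ^ k))) \<le> 1" for n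
      by (intro AE_I2) (auto simp: indicator_def)
  qed (use ind_lim in \<open>auto intro!: AE_I2 borel_measurable_D\<close>)
  moreover have "(LINT z|D. z ^ k * cnj (z ^ k)) = (LINT z|D. complex_of_real (((cmod z)\<^sup>2) ^ k))"
    by (intro Bochner_Integration.integral_cong refl)
      (metis complex_cnj_power complex_norm_square of_real_power power_mult_distrib)
  moreover have "\<dots> = moment k" unfolding integral_complex_of_real integral_moment ..
  ultimately have "(\<lambda>n. LINT z|D. indicator (ball 0 (r n)) z * (F z * cnj (z ^ k))) \<longlonglongrightarrow> b k * moment k"
    unfolding part by (intro tendsto_mult tendsto_const) auto
  with lim1 show ?thesis by (rule LIMSEQ_unique)
qed

section \<open>The weighted Dirichlet space as a Hilbert space\<close>

abbreviation H :: "(complex \<Rightarrow> complex) set" where "H \<equiv> dirichlet_space \<alpha>"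
abbreviation ip :: "(complex \<Rightarrow> complex) \<Rightarrow> (complex \<Rightarrow> complex) \<Rightarrow> complex" where
  "ip \<equiv> dirichlet_inner \<alpha>"

lemma dirichlet_spaceI:
  assumes "f holomorphic_on ball 0 1" "\<And>z. z \<notin> ball 0 1 \<Longrightarrow> f z = 0"
    "integrable D (\<lambda>z. (cmod (deriv f z))\<^sup>2)"
  shows "f \<in> H"
  using assms by (simp add: dirichlet_space_def)

lemma dirichlet_spaceD:
  assumes "f \<in> H"
  shows "f holomorphic_on ball 0 1" "\<And>z. z \<notin> ball 0 1 \<Longrightarrow> f z = 0"
    "integrable D (\<lambda>z. (cmod (deriv f z))\<^sup>2)"
  using assms by (auto simp: dirichlet_space_def)

lemma deriv_measurable_D: "f holomorphic_on ball 0 1 \<Longrightarrow> deriv f \<in> borel_measurable D"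
  by (intro continuous_measurable_D holomorphic_on_imp_continuous_on holomorphic_deriv) auto

lemma H_measurable [measurable]: "f \<in> H \<Longrightarrow> deriv f \<in> borel_measurable D"
  using dirichlet_spaceD deriv_measurable_D by blast

lemma differentiable_in_disc:
  "f holomorphic_on ball 0 1 \<Longrightarrow> z \<in> ball 0 1 \<Longrightarrow> f field_differentiable at z"
  using holomorphic_on_imp_differentiable_at by blast

lemma integrable_deriv_product:
  assumes [measurable]: "f \<in> H" "g \<in> H"
  shows "integrable D (\<lambda>z. deriv f z * cnj (deriv g z))"
proof (rule Bochner_Integration.integrable_bound)
  show "integrable D (\<lambda>z. (cmod (deriv f z))\<^sup>2 + (cmod (deriv g z))\<^sup>2)"
    using assms dirichlet_spaceD(3) by simp
  have "cmod (x * cnj y) \<le> norm ((cmod x)\<^sup>2 + (cmod y)\<^sup>2)" for x y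
  proof -
    have "2 * (cmod x * cmod y) \<le> (cmod x)\<^sup>2 + (cmod y)\<^sup>2"
      using zero_le_power2[of "cmod x - cmod y"] unfolding power2_diff by linarith
    moreover have "0 \<le> cmod x * cmod y" by simp
    ultimately show ?thesis unfolding norm_mult complex_mod_cnj real_norm_def by linarith
  qed
  then show "AE z in D. norm (deriv f z * cnj (deriv g z)) \<le> norm ((cmod (deriv f z))\<^sup>2 + (cmod (deriv g z))\<^sup>2)"
    by simp
qed measurable

lemma deriv_plus_fun:
  "f \<in> H \<Longrightarrow> g \<in> H \<Longrightarrow> z \<in> ball 0 1 \<Longrightarrow> deriv (f + g) z = deriv f z + deriv g z"
  unfolding plus_fun_def by (intro deriv_add differentiable_in_disc dirichlet_spaceD)

lemma deriv_fun_scale: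
  "f \<in> H \<Longrightarrow> z \<in> ball 0 1 \<Longrightarrow> deriv (fun_scale c f) z = c * deriv f z"
  unfolding fun_scale_def by (intro deriv_cmult differentiable_in_disc dirichlet_spaceD)

lemma zero_in_H: "0 \<in> H"
proof (rule dirichlet_spaceI)
  have "deriv (0 :: complex \<Rightarrow> complex) z = 0" for z unfolding zero_fun_def by simp
  then show "integrable D (\<lambda>z. (cmod (deriv 0 z))\<^sup>2)" by simp
qed (auto simp: zero_fun_def)

lemma plus_in_H:
  assumes [measurable]: "f \<in> H" "g \<in> H"
  shows "f + g \<in> H"
proof (rule dirichlet_spaceI)
  show hol: "f + g holomorphic_on ball 0 1"
    unfolding plus_fun_def using assms by (intro holomorphic_intros dirichlet_spaceD)
  have meas [measurable]: "deriv (f + g) \<in> borel_measurable D" by (rule deriv_measurable_D[OF hol])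
  show "integrable D (\<lambda>z. (cmod (deriv (f + g) z))\<^sup>2)"
  proof (rule Bochner_Integration.integrable_bound)
    show "integrable D (\<lambda>z. 2 * (cmod (deriv f z))\<^sup>2 + 2 * (cmod (deriv g z))\<^sup>2)"
      using assms dirichlet_spaceD(3) by simp
    have "(cmod (x + y))\<^sup>2 \<le> 2 * (cmod x)\<^sup>2 + 2 * (cmod y)\<^sup>2" for x y
    proof -
      have "(cmod (x + y))\<^sup>2 \<le> (cmod x + cmod y)\<^sup>2"
        by (intro power_mono norm_triangle_ineq) auto
      also have "\<dots> \<le> 2 * (cmod x)\<^sup>2 + 2 * (cmod y)\<^sup>2"
        using zero_le_power2[of "cmod x - cmod y"] unfolding power2_diff power2_sum by linarith
      finally show ?thesis .
    qed
    then show "AE z in D. norm ((cmod (deriv (f + g) z))\<^sup>2) \<le> norm (2 * (cmod (deriv f z))\<^sup>2 + 2 * (cmod (deriv g z))\<^sup>2)"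
      using assms by (intro AE_I2) (simp add: deriv_plus_fun)
  qed measurable
qed (use dirichlet_spaceD(2)[OF assms(1)] dirichlet_spaceD(2)[OF assms(2)] in auto)

lemma scale_in_H:
  assumes "f \<in> H"
  shows "fun_scale c f \<in> H"
proof (rule dirichlet_spaceI)
  show "fun_scale c f holomorphic_on ball 0 1"
    unfolding fun_scale_def using assms by (intro holomorphic_intros dirichlet_spaceD)
  have "integrable D (\<lambda>z. (cmod c)\<^sup>2 * (cmod (deriv f z))\<^sup>2)" using assms dirichlet_spaceD(3) by simp
  then show "integrable D (\<lambda>z. (cmod (deriv (fun_scale c f) z))\<^sup>2)"
    by (rule Bochner_Integration.integrable_cong[THEN iffD1, rotated 2])
      (use assms in \<open>auto simp: deriv_fun_scale norm_mult power_mult_distrib\<close>)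
qed (use assms dirichlet_spaceD(2) in \<open>auto simp: fun_scale_def\<close>)

definition monomial :: "nat \<Rightarrow> complex \<Rightarrow> complex" where
  "monomial n z = (if z \<in> ball 0 1 then z ^ n else 0)"

text \<open>
The squared norm of \<open>z\<^bsup>n\<^esup>\<close>. It is of order \<open>n\<^bsup>1 - \<alpha>\<^esup>\<close>.
\<close>

definition weight :: "nat \<Rightarrow> real" where
  "weight n = (if n = 0 then 1 else (real n)\<^sup>2 * moment (n - 1))"

lemma deriv_monomial: "z \<in> ball 0 1 \<Longrightarrow> deriv (monomial n) z = of_nat n * z ^ (n - 1)"
proof -
  assume z: "z \<in> ball 0 1"
  have "((\<lambda>z. z ^ n) has_field_derivative of_nat n * z ^ (n - 1)) (at z)"
    by (auto intro!: derivative_eq_intros)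
  then have "(monomial n has_field_derivative of_nat n * z ^ (n - 1)) (at z)"
    by (rule has_field_derivative_transform_within_open[OF _ open_ball z]) (simp add: monomial_def)
  then show ?thesis by (rule DERIV_imp_deriv)
qed

lemma monomial_in_H: "monomial n \<in> H"
proof (rule dirichlet_spaceI)
  interpret finite_measure D by (rule finite_D)
  have "(\<lambda>z. z ^ n) holomorphic_on ball 0 1" by (intro holomorphic_intros)
  then show hol: "monomial n holomorphic_on ball 0 1"
    by (rule holomorphic_transform) (simp add: monomial_def)
  have [measurable]: "deriv (monomial n) \<in> borel_measurable D" by (rule deriv_measurable_D[OF hol])
  have "cmod (of_nat n * z ^ (n - 1)) \<le> real n" if "z \<in> ball 0 1" for z :: complex
    using that by (simp add: norm_mult norm_power power_le_one mult_left_le)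
  then have "(cmod (deriv (monomial n) z))\<^sup>2 \<le> (real n)\<^sup>2" if "z \<in> ball 0 1" for z
    unfolding deriv_monomial[OF that] using that by (intro power_mono) auto
  then show "integrable D (\<lambda>z. (cmod (deriv (monomial n) z))\<^sup>2)"
    by (intro integrable_const_bound[where B = "(real n)\<^sup>2"]) auto
qed (simp add: monomial_def)

lemma ip_monomial:
  fixes a :: "nat \<Rightarrow> complex"
  assumes f: "f \<in> H" and sums: "\<And>z. z \<in> ball 0 1 \<Longrightarrow> (\<lambda>n. a n * z ^ n) sums f z"
  shows "ip f (monomial n) = weight n * a n"
proof -
  have "(\<lambda>n. a n * 0 ^ n) sums f 0" by (rule sums) simp
  then have f0: "f 0 = a 0" using sums_unique2 powser_sums_zero by blast
  have df: "(\<lambda>j. diffs a j * z ^ j) sums deriv f z" if "z \<in> ball 0 1" for z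
  proof (rule termdiffs_sums_strong)
    show "norm z < 1" using that by simp
    show "(f has_field_derivative deriv f z) (at z)"
      using differentiable_in_disc[OF dirichlet_spaceD(1)[OF f] that] field_differentiable_derivI by blast
  qed (use sums in auto)
  have "(LINT z|D. deriv f z * cnj (deriv (monomial n) z)) =
      (LINT z|D. of_nat n * (deriv f z * cnj (z ^ (n - 1))))"
    by (intro Bochner_Integration.integral_cong) (auto simp: deriv_monomial)
  also have "\<dots> = of_nat n * (LINT z|D. deriv f z * cnj (z ^ (n - 1)))"
    by (rule integral_mult_right_zero)
  also have "(LINT z|D. deriv f z * cnj (z ^ (n - 1))) = diffs a (n - 1) * moment (n - 1)"
    using f by (intro integral_power_series_coeff df dirichlet_spaceD) auto
  finally have "(LINT z|D. deriv f z * cnj (deriv (monomial n) z)) =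
      of_nat n * (diffs a (n - 1) * moment (n - 1))" .
  moreover have "monomial n 0 = 0 ^ n" by (simp add: monomial_def)
  ultimately show ?thesis
    unfolding dirichlet_inner_def
    by (cases n) (simp_all add: weight_def f0 diffs_def power2_eq_square)
qed

definition taylor_coeff :: "(complex \<Rightarrow> complex) \<Rightarrow> nat \<Rightarrow> complex" where
  "taylor_coeff f n = (deriv ^^ n) f 0 / fact n"

lemma taylor_coeff_sums: "f \<in> H \<Longrightarrow> z \<in> ball 0 1 \<Longrightarrow> (\<lambda>n. taylor_coeff f n * z ^ n) sums f z"
  using holomorphic_power_series[OF dirichlet_spaceD(1), of f z] by (simp add: taylor_coeff_def)

lemma ip_monomial_taylor_coeff: "f \<in> H \<Longrightarrow> ip f (monomial n) = weight n * taylor_coeff f n"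
  by (rule ip_monomial) (auto intro: taylor_coeff_sums)

lemma ip_monomials: "ip (monomial m) (monomial n) = (if m = n then weight n else 0)"
proof -
  have "ip (monomial m) (monomial n) = of_real (weight n) * (if n = m then 1 else 0)"
  proof (rule ip_monomial[OF monomial_in_H])
    fix z :: complex assume z: "z \<in> ball 0 1"
    have "(\<lambda>k. if k = m then z ^ k else 0) sums z ^ m" by (rule sums_single)
    then show "(\<lambda>k. (if k = m then 1 else 0) * z ^ k) sums monomial m z"
      using z by (simp add: monomial_def if_distrib[of "\<lambda>x. x * _"] cong: if_cong)
  qed
  then show ?thesis by simp
qed

lemma weight_pos: "0 < weight n"
  using moment_pos by (simp add: weight_def)

lemma ip_eq_0_imp_zero:
  assumes f: "f \<in> H" and 0: "ip f f = 0"
  shows "f = 0"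
proof -
  have "ip f f = complex_of_real ((cmod (f 0))\<^sup>2 + (LINT z|D. (cmod (deriv f z))\<^sup>2))"
    unfolding dirichlet_inner_def
    by (simp add: complex_norm_square[symmetric] del: of_real_power)
  then have "(cmod (f 0))\<^sup>2 + (LINT z|D. (cmod (deriv f z))\<^sup>2) = 0"
    using 0 of_real_eq_0_iff by metis
  moreover have "0 \<le> (LINT z|D. (cmod (deriv f z))\<^sup>2)" by simp
  ultimately have f0: "f 0 = 0" and int0: "(LINT z|D. (cmod (deriv f z))\<^sup>2) = 0"
    by (simp_all add: add_nonneg_eq_0_iff)
  have "AE z in D. (cmod (deriv f z))\<^sup>2 = 0"
    using int0 integral_nonneg_eq_0_iff_AE[OF dirichlet_spaceD(3)[OF f]] by simp
  then have ae: "AE z in D. deriv f z * w z = 0" for w by (auto elim!: eventually_mono)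
  have "ip f (monomial n) = 0" for n
    unfolding dirichlet_inner_def using integral_eq_zero_AE[OF ae] by (simp add: f0)
  then have "taylor_coeff f n = 0" for n
    using ip_monomial_taylor_coeff[OF f, of n] weight_pos[of n] by simp
  then have "f z = 0" if "z \<in> ball 0 1" for z
    using sums_unique[OF taylor_coeff_sums[OF f that]] by simp
  then show ?thesis using dirichlet_spaceD(2)[OF f] by (auto simp: fun_eq_iff)
qed

sublocale inner_function_space H ip
proof
  fix f g h c
  show "0 \<in> H" by (rule zero_in_H)
  show "f \<in> H \<Longrightarrow> g \<in> H \<Longrightarrow> f + g \<in> H" by (rule plus_in_H)
  show "f \<in> H \<Longrightarrow> fun_scale c f \<in> H" by (rule scale_in_H)
  show "f \<in> H \<Longrightarrow> ip f f = 0 \<Longrightarrow> f = 0" by (rule ip_eq_0_imp_zero)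
  show "ip (f + g) h = ip f h + ip g h" if fgh: "f \<in> H" "g \<in> H" "h \<in> H"
  proof -
    have "(LINT z|D. deriv (f + g) z * cnj (deriv h z)) =
        (LINT z|D. deriv f z * cnj (deriv h z) + deriv g z * cnj (deriv h z))"
      using fgh by (intro Bochner_Integration.integral_cong) (auto simp: deriv_plus_fun algebra_simps)
    also have "\<dots> = (LINT z|D. deriv f z * cnj (deriv h z)) + (LINT z|D. deriv g z * cnj (deriv h z))"
      using fgh by (intro Bochner_Integration.integral_add integrable_deriv_product)
    finally show ?thesis by (simp add: dirichlet_inner_def algebra_simps)
  qed
  show "ip (fun_scale c f) h = c * ip f h" if fh: "f \<in> H" "h \<in> H"
  proof -
    have "(LINT z|D. deriv (fun_scale c f) z * cnj (deriv h z)) =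
        (LINT z|D. c * (deriv f z * cnj (deriv h z)))"
      using fh by (intro Bochner_Integration.integral_cong) (auto simp: deriv_fun_scale)
    also have "\<dots> = c * (LINT z|D. deriv f z * cnj (deriv h z))"
      by (rule integral_mult_right_zero)
    finally show ?thesis by (simp add: dirichlet_inner_def fun_scale_def algebra_simps)
  qed
  show "ip g f = cnj (ip f g)"
  proof -
    have "cnj (LINT z|D. deriv f z * cnj (deriv g z)) = (LINT z|D. cnj (deriv f z * cnj (deriv g z)))"
      by (simp only: Bochner_Integration.integral_cnj)
    then show ?thesis by (simp add: dirichlet_inner_def mult.commute)
  qed
  show "0 \<le> Re (ip f f)"
  proof -
    have "ip f f = complex_of_real ((cmod (f 0))\<^sup>2 + (LINT z|D. (cmod (deriv f z))\<^sup>2))"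
      unfolding dirichlet_inner_def
      by (simp add: complex_norm_square[symmetric] del: of_real_power)
    then show ?thesis by simp
  qed
qed

lemma nrm_eq: "(nrm f)\<^sup>2 = (cmod (f 0))\<^sup>2 + (LINT z|D. (cmod (deriv f z))\<^sup>2)"
  using dirichlet_norm[of \<alpha> f] by (simp add: dirichlet_integral_def)

text \<open>
The \<open>n\<close>-th Taylor coefficient of \<open>(1 - z)\<^bsup>-\<alpha>\<^esup>\<close>, which is of order \<open>n\<^bsup>\<alpha> - 1\<^esup>\<close>.
\<close>

definition kernel_coeff :: "nat \<Rightarrow> real" where
  "kernel_coeff n = pochhammer \<alpha> n / fact n"

lemma kernel_coeff_pos: "0 < kernel_coeff n"
  using \<alpha>0 by (simp add: kernel_coeff_def pochhammer_pos)

lemma kernel_coeff_Suc: "kernel_coeff (Suc n) = kernel_coeff n * ((\<alpha> + real n) / (real n + 1))"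
  by (simp add: kernel_coeff_def pochhammer_Suc field_simps)

lemma kernel_coeff_le_1: "kernel_coeff n \<le> 1"
proof (induction n)
  case (Suc n)
  have "kernel_coeff n * ((\<alpha> + real n) / (real n + 1)) \<le> 1 * 1"
    using Suc \<alpha>0 \<alpha>1 by (intro mult_mono) (auto simp: field_simps)
  then show ?case by (simp add: kernel_coeff_Suc)
qed (simp add: kernel_coeff_def)

lemma kernel_coeff_le_\<alpha>: "0 < n \<Longrightarrow> kernel_coeff n \<le> \<alpha>"
proof (induction n)
  case (Suc n)
  show ?case
  proof (cases "n = 0")
    case False
    then have "kernel_coeff n * ((\<alpha> + real n) / (real n + 1)) \<le> \<alpha> * 1"
      using Suc \<alpha>0 \<alpha>1 kernel_coeff_pos[of n] by (intro mult_mono) (auto simp: field_simps)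
    then show ?thesis by (simp add: kernel_coeff_Suc)
  qed (simp add: kernel_coeff_def)
qed simp

text \<open>
The weights of the Dirichlet space and the coefficients of \<open>(1 - z)\<^bsup>-\<alpha>\<^esup>\<close> are reciprocal up to
bounded factors. This makes the energy, whose weights \<open>n\<^bsup>\<alpha> - 1\<^esup>\<close> are comparable
to the coefficients, dual to the norm.
\<close>

lemma weight_kernel_coeff:
  assumes "0 < n"
  shows "weight n * kernel_coeff n = \<alpha> * (1 + \<alpha>) * (real n / (real n + \<alpha>))"
proof -
  obtain m where n: "n = Suc m" using assms by (cases n) auto
  have nonint: "x \<notin> \<int>\<^sub>\<le>\<^sub>0" if "0 < x" for x :: real using that by (auto elim!: nonpos_Ints_cases)
  have pos: "Gamma x > 0" if "0 < x" for x :: real using that by (rule Gamma_real_pos)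
  have 1: "Gamma (\<alpha> + 1) = \<alpha> * Gamma \<alpha>" using Gamma_plus1[OF nonint[OF \<alpha>0]] by simp
  have 2: "Gamma (\<alpha> + real n + 1) = (\<alpha> + real n) * Gamma (\<alpha> + real n)"
    using \<alpha>0 by (intro Gamma_plus1 nonint) simp
  have 3: "Gamma (real m + 1) = fact m" using Gamma_fact[of m, where 'a = real] by (simp add: add.commute)
  have "weight n = (real n)\<^sup>2 * (1 + \<alpha>) * (fact m * (\<alpha> * Gamma \<alpha>)) / ((\<alpha> + real n) * Gamma (\<alpha> + real n))"
    using 1 2 3 by (simp add: n weight_def moment_def Beta_def add_ac)
  moreover have "kernel_coeff n = Gamma (\<alpha> + real n) / Gamma \<alpha> / fact n"
    using pochhammer_Gamma[OF nonint[OF \<alpha>0], of n] by (simp add: kernel_coeff_def)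
  moreover have "fact n = real n * (fact m :: real)" by (simp add: n)
  moreover have "N\<^sup>2 * (1 + \<alpha>) * (f * (\<alpha> * G)) / (B * K) * (K / G / (N * f)) = \<alpha> * (1 + \<alpha>) * (N / B)"
    if "0 < G" "0 < K" "0 < B" "0 < f" "0 < N" for N f G K B :: real
    using that by (simp add: power2_eq_square)
  note this[OF pos[OF \<alpha>0] pos[of "\<alpha> + real n"], of "\<alpha> + real n" "fact m" "real n"]
  ultimately show ?thesis using \<alpha>0 assms by (simp add: add.commute)
qed

lemma inverse_weight_le: "1 / weight n \<le> kernel_coeff n / \<alpha>"
proof (cases "n = 0")
  case True
  then show ?thesis using \<alpha>0 \<alpha>1 by (simp add: weight_def kernel_coeff_def)
next
  case False
  then have "\<alpha> * 1 \<le> \<alpha> * ((1 + \<alpha>) * (real n / (real n + \<alpha>)))"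
    using \<alpha>0 \<alpha>1 by (intro mult_left_mono) (auto simp: field_simps)
  then have "\<alpha> \<le> weight n * kernel_coeff n" using False by (simp add: weight_kernel_coeff mult.assoc)
  then show ?thesis using weight_pos[of n] \<alpha>0 by (simp add: field_simps)
qed

lemma weight_ge_1: "1 \<le> weight n"
proof (cases "n = 0")
  case False
  then have "kernel_coeff n / \<alpha> \<le> 1" using kernel_coeff_le_\<alpha>[of n] \<alpha>0 by simp
  then have "1 / weight n \<le> 1" using inverse_weight_le[of n] by linarith
  then show ?thesis using weight_pos[of n] by (simp add: field_simps)
qed (simp add: weight_def)

lemma weight_le: "weight n \<le> 2 / kernel_coeff n"
proof (cases "n = 0")
  case False
  have "\<alpha> * (1 + \<alpha>) * (real n / (real n + \<alpha>)) \<le> 1 * 2 * 1"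
    using \<alpha>0 \<alpha>1 by (intro mult_mono) (auto simp: field_simps)
  then show ?thesis using weight_kernel_coeff[of n] False kernel_coeff_pos[of n] by (simp add: field_simps)
qed (simp add: weight_def kernel_coeff_def)

lemma nrm_monomial: "(nrm (monomial n))\<^sup>2 = weight n"
  by (simp add: nrm_sq[OF monomial_in_H] ip_monomials)

lemma taylor_coeff_le_nrm: "f \<in> H \<Longrightarrow> cmod (taylor_coeff f n) \<le> nrm f"
proof -
  assume f: "f \<in> H"
  have m: "nrm (monomial n) = sqrt (weight n)"
    using nrm_monomial[of n] nrm_nonneg[OF monomial_in_H, of n] by (metis real_sqrt_unique)
  have "weight n * cmod (taylor_coeff f n) = cmod (ip f (monomial n))"
    using weight_pos[of n] by (simp add: ip_monomial_taylor_coeff[OF f] norm_mult)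
  also have "\<dots> \<le> nrm f * sqrt (weight n)"
    using Cauchy_Schwarz[OF f monomial_in_H, of n] by (simp add: m)
  also have "\<dots> \<le> nrm f * weight n"
  proof (rule mult_left_mono)
    have "sqrt (weight n) * 1 \<le> sqrt (weight n) * sqrt (weight n)"
      using weight_ge_1[of n] by (intro mult_left_mono) auto
    then show "sqrt (weight n) \<le> weight n" using weight_pos[of n] by simp
  qed (use f in simp)
  finally show ?thesis using weight_pos[of n] by (simp add: mult.commute)
qed

lemma point_evaluation_bound:
  assumes f: "f \<in> H" and z: "z \<in> ball 0 1"
  shows "cmod (f z) \<le> nrm f / (1 - cmod z)"
proof -
  have geo: "(\<lambda>n. nrm f * cmod z ^ n) sums (nrm f * (1 / (1 - cmod z)))"
    using z by (intro sums_mult geometric_sums) auto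
  have le: "norm (taylor_coeff f n * z ^ n) \<le> nrm f * cmod z ^ n" for n
    using taylor_coeff_le_nrm[OF f, of n] by (simp add: norm_mult norm_power mult_right_mono)
  have "cmod (\<Sum>n. taylor_coeff f n * z ^ n) \<le> (\<Sum>n. nrm f * cmod z ^ n)"
    by (rule norm_suminf_le[OF le sums_summable[OF geo]])
  then show ?thesis
    using sums_unique[OF taylor_coeff_sums[OF f z]] sums_unique[OF geo] by simp
qed

lemma nn_integral_deriv_le: "f \<in> H \<Longrightarrow> (\<integral>\<^sup>+z. ennreal ((cmod (deriv f z))\<^sup>2) \<partial>D) \<le> ennreal ((nrm f)\<^sup>2)"
  using nn_integral_eq_integral[OF dirichlet_spaceD(3), of f] nrm_eq[of f] by (simp add: ennreal_leI)

text \<open>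
Point evaluations are bounded, so a Cauchy sequence converges locally uniformly, together with its
derivatives, and Fatou's lemma shows that the limit belongs to the space and is also the limit in norm.
\<close>

lemma H_complete:
  fixes F :: "nat \<Rightarrow> complex \<Rightarrow> complex"
  assumes F: "\<And>n. F n \<in> H"
    and Cauchy: "\<And>e. e > 0 \<Longrightarrow> \<exists>N. \<forall>m\<ge>N. \<forall>n\<ge>N. nrm (F m - F n) < e"
  shows "\<exists>g\<in>H. (\<lambda>n. nrm (F n - g)) \<longlonglongrightarrow> 0"
proof -
  have pt: "cmod (F m z - F n z) \<le> nrm (F m - F n) / (1 - cmod z)" if "z \<in> ball 0 1" for m n z
    using point_evaluation_bound[OF diff_mem[OF F F] that, of m n] by simp
  have cau: "Cauchy (\<lambda>n. F n z)" if z: "z \<in> ball 0 1" for z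
  proof (rule metric_CauchyI)
    fix e :: real assume "0 < e"
    then have "0 < e * (1 - cmod z)" using z by simp
    from Cauchy[OF this] obtain N where N: "\<forall>m\<ge>N. \<forall>n\<ge>N. nrm (F m - F n) < e * (1 - cmod z)" by blast
    have "dist (F m z) (F n z) < e" if mn: "m \<ge> N" "n \<ge> N" for m n
    proof -
      have "nrm (F m - F n) / (1 - cmod z) < e" using N mn z by (simp add: pos_divide_less_eq)
      then show ?thesis using pt[OF z, of m n] by (simp add: dist_norm)
    qed
    then show "\<exists>M. \<forall>m\<ge>M. \<forall>n\<ge>M. dist (F m z) (F n z) < e" by blast
  qed
  define g where "g z = (if z \<in> ball 0 1 then lim (\<lambda>n. F n z) else 0)" for z
  have g: "(\<lambda>n. F n z) \<longlonglongrightarrow> g z" if "z \<in> ball 0 1" for z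
    using cau[OF that] that by (simp add: g_def Cauchy_convergent_iff convergent_LIMSEQ_iff)
  have g_dist: "cmod (F n z - g z) \<le> e / (1 - cmod z)"
    if z: "z \<in> ball 0 1" and N: "\<forall>m\<ge>N. \<forall>n\<ge>N. nrm (F m - F n) < e" and n: "n \<ge> N" for n N e z
  proof (rule LIMSEQ_le_const2)
    show "(\<lambda>m. cmod (F n z - F m z)) \<longlonglongrightarrow> cmod (F n z - g z)" by (intro tendsto_intros g z)
    have "cmod (F n z - F m z) \<le> e / (1 - cmod z)" if "m \<ge> N" for m
    proof -
      have "nrm (F n - F m) / (1 - cmod z) \<le> e / (1 - cmod z)"
        using N n that z by (intro divide_right_mono) (auto simp: less_imp_le)
      then show ?thesis using pt[OF z, of n m] by linarith
    qed
    then show "\<exists>N. \<forall>m\<ge>N. cmod (F n z - F m z) \<le> e / (1 - cmod z)" by blast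
  qed
  have "\<exists>g'. \<forall>x \<in> ball 0 1. (g has_field_derivative g' x) (at x) \<and> ((\<lambda>n. deriv (F n) x) \<longlonglongrightarrow> g' x)"
  proof (rule has_complex_derivative_uniform_sequence[OF open_ball])
    show "(F n has_field_derivative deriv (F n) x) (at x)" if "x \<in> ball 0 1" for n x
      using differentiable_in_disc[OF dirichlet_spaceD(1)[OF F] that] field_differentiable_derivI by blast
    fix x :: complex assume x: "x \<in> ball 0 1"
    define d where "d = (1 - cmod x) / 2"
    have d: "0 < d" using x by (simp add: d_def)
    have far: "d \<le> 1 - cmod z" if "z \<in> cball x d" for z
      using that norm_triangle_sub[of z x] by (simp add: d_def dist_norm norm_minus_commute)
    then have sub: "cball x d \<subseteq> ball 0 1" using d by force
    have "uniform_limit (cball x d) F g sequentially"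
      unfolding uniform_limit_sequentially_iff
    proof (intro allI impI)
      fix e :: real assume e: "0 < e"
      then have "0 < e / 2 * d" using d by simp
      from Cauchy[OF this] obtain N where N: "\<forall>m\<ge>N. \<forall>n\<ge>N. nrm (F m - F n) < e / 2 * d" by blast
      have "dist (F n z) (g z) < e" if n: "n \<ge> N" and z: "z \<in> cball x d" for n z
      proof -
        have "z \<in> ball 0 1" using sub z by blast
        then have "cmod (F n z - g z) \<le> (e / 2 * d) / (1 - cmod z)" by (rule g_dist[OF _ N n])
        also have "\<dots> \<le> (e / 2 * d) / d" using far[OF z] d e by (intro divide_left_mono) auto
        also have "\<dots> < e" using d e by simp
        finally show ?thesis by (simp add: dist_norm)
      qed
      then show "\<exists>N. \<forall>n\<ge>N. \<forall>z\<in>cball x d. dist (F n z) (g z) < e" by blast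
    qed
    with d sub show "\<exists>d>0. cball x d \<subseteq> ball 0 1 \<and> uniform_limit (cball x d) F g sequentially" by blast
  qed
  then obtain g' where g': "\<And>x. x \<in> ball 0 1 \<Longrightarrow> (g has_field_derivative g' x) (at x)"
    "\<And>x. x \<in> ball 0 1 \<Longrightarrow> (\<lambda>n. deriv (F n) x) \<longlonglongrightarrow> g' x" by blast
  have dg: "deriv g x = g' x" if "x \<in> ball 0 1" for x using g'(1)[OF that] by (rule DERIV_imp_deriv)
  have hol: "g holomorphic_on ball 0 1"
    unfolding holomorphic_on_open[OF open_ball] using g'(1) by blast
  have meas: "deriv h \<in> borel_measurable D" if "h holomorphic_on ball 0 1" for h
    using that by (rule deriv_measurable_D)
  have Fatou: "(\<integral>\<^sup>+z. ennreal ((cmod (deriv (F n) z - deriv g z))\<^sup>2) \<partial>D) \<le> ennreal (e\<^sup>2)"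
    if N: "\<forall>m\<ge>N. \<forall>n\<ge>N. nrm (F m - F n) < e" and n: "n \<ge> N" for n N e
  proof -
    let ?u = "\<lambda>m z. ennreal ((cmod (deriv (F n) z - deriv (F m) z))\<^sup>2)"
    have [measurable]: "deriv (F k) \<in> borel_measurable D" for k using meas dirichlet_spaceD(1)[OF F] by blast
    have "(\<integral>\<^sup>+z. ennreal ((cmod (deriv (F n) z - deriv g z))\<^sup>2) \<partial>D) = (\<integral>\<^sup>+z. liminf (\<lambda>m. ?u m z) \<partial>D)"
    proof (rule nn_integral_cong)
      fix z assume "z \<in> space D"
      then have z: "z \<in> ball 0 1" by simp
      have "(\<lambda>m. ?u m z) \<longlonglongrightarrow> ennreal ((cmod (deriv (F n) z - deriv g z))\<^sup>2)"
        unfolding dg[OF z] by (intro tendsto_intros tendsto_ennrealI g'(2) z)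
      from lim_imp_Liminf[OF _ this] show "ennreal ((cmod (deriv (F n) z - deriv g z))\<^sup>2) = liminf (\<lambda>m. ?u m z)"
        by simp
    qed
    also have "\<dots> \<le> liminf (\<lambda>m. \<integral>\<^sup>+z. ?u m z \<partial>D)" by (rule nn_integral_liminf) measurable
    also have "\<dots> \<le> ennreal (e\<^sup>2)"
    proof (rule Liminf_le)
      have "(\<integral>\<^sup>+z. ?u m z \<partial>D) \<le> ennreal (e\<^sup>2)" if m: "m \<ge> N" for m
      proof -
        have "(\<integral>\<^sup>+z. ?u m z \<partial>D) = (\<integral>\<^sup>+z. ennreal ((cmod (deriv (F n - F m) z))\<^sup>2) \<partial>D)"
        proof (rule nn_integral_cong)
          fix z assume "z \<in> space D"
          then have z: "z \<in> ball 0 1" by simp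
          have "deriv (F n - F m) z = deriv (F n) z - deriv (F m) z"
            unfolding fun_diff_def using z by (intro deriv_diff differentiable_in_disc dirichlet_spaceD F)
          then show "?u m z = ennreal ((cmod (deriv (F n - F m) z))\<^sup>2)" by simp
        qed
        also have "\<dots> \<le> ennreal ((nrm (F n - F m))\<^sup>2)" by (rule nn_integral_deriv_le[OF diff_mem[OF F F]])
        also have "\<dots> \<le> ennreal (e\<^sup>2)"
          using N n m nrm_nonneg[OF diff_mem[OF F F], of n m] by (intro ennreal_leI power_mono) (auto simp: less_imp_le)
        finally show ?thesis .
      qed
      then show "\<forall>\<^sub>F m in sequentially. (\<integral>\<^sup>+z. ?u m z \<partial>D) \<le> ennreal (e\<^sup>2)"
        by (auto simp: eventually_sequentially)
    qed simp
    finally show ?thesis .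
  qed
  have deriv_diff_g: "deriv (F n - g) z = deriv (F n) z - deriv g z" if z: "z \<in> ball 0 1" for n z
    unfolding fun_diff_def
    using differentiable_in_disc[OF dirichlet_spaceD(1)[OF F] z] differentiable_in_disc[OF hol z] by (rule deriv_diff)
  have diff_in: "F n - g \<in> H" and diff_int: "(LINT z|D. (cmod (deriv (F n - g) z))\<^sup>2) \<le> e\<^sup>2"
    if N: "\<forall>m\<ge>N. \<forall>n\<ge>N. nrm (F m - F n) < e" and n: "n \<ge> N" for n N e
  proof -
    have hol': "F n - g holomorphic_on ball 0 1"
      unfolding fun_diff_def by (rule holomorphic_on_diff[OF dirichlet_spaceD(1)[OF F] hol])
    have [measurable]: "deriv (F n - g) \<in> borel_measurable D" by (rule meas[OF hol'])
    have le: "(\<integral>\<^sup>+z. ennreal ((cmod (deriv (F n - g) z))\<^sup>2) \<partial>D) \<le> ennreal (e\<^sup>2)"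
      using Fatou[OF N n] by (subst nn_integral_cong[where v = "\<lambda>z. ennreal ((cmod (deriv (F n) z - deriv g z))\<^sup>2)"]) (auto simp: deriv_diff_g)
    have int: "integrable D (\<lambda>z. (cmod (deriv (F n - g) z))\<^sup>2)"
      by (rule integrableI_bounded) (use le in \<open>auto simp: le_less_trans\<close>)
    show "F n - g \<in> H"
      by (rule dirichlet_spaceI[OF hol' _ int]) (use dirichlet_spaceD(2)[OF F] in \<open>auto simp: g_def\<close>)
    show "(LINT z|D. (cmod (deriv (F n - g) z))\<^sup>2) \<le> e\<^sup>2"
      using le nn_integral_eq_integral[OF int] by (simp add: ennreal_le_iff)
  qed
  obtain N where N: "\<forall>m\<ge>N. \<forall>n\<ge>N. nrm (F m - F n) < 1" using Cauchy[of 1] by auto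
  have "F N - (F N - g) \<in> H" by (rule diff_mem[OF F diff_in[OF N]]) simp
  then have gH: "g \<in> H" by simp
  have "(\<lambda>n. nrm (F n - g)) \<longlonglongrightarrow> 0"
  proof (rule metric_LIMSEQ_I)
    fix e :: real assume e: "0 < e"
    then have "0 < e / 2" by simp
    from Cauchy[OF this] obtain N where N: "\<forall>m\<ge>N. \<forall>n\<ge>N. nrm (F m - F n) < e / 2" by blast
    have "nrm (F n - g) < e" if n: "n \<ge> N" for n
    proof (rule power2_less_imp_less)
      have "cmod ((F n - g) 0) \<le> e / 2" using g_dist[OF _ N n, of 0] by simp
      then have "(cmod ((F n - g) 0))\<^sup>2 \<le> (e / 2)\<^sup>2" by (intro power_mono) auto
      then have "(nrm (F n - g))\<^sup>2 \<le> (e / 2)\<^sup>2 + (e / 2)\<^sup>2"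
        using diff_int[OF N n] unfolding nrm_eq by linarith
      also have "\<dots> < e\<^sup>2" using e by (simp add: field_simps power2_eq_square)
      finally show "(nrm (F n - g))\<^sup>2 < e\<^sup>2" .
    qed (use e in simp)
    then show "\<exists>N. \<forall>n\<ge>N. dist (nrm (F n - g)) 0 < e"
      using nrm_nonneg[OF diff_mem[OF F gH]] by (intro exI[of _ N]) auto
  qed
  with gH show ?thesis by blast
qed

sublocale hilbert_function_space H ip
  by unfold_locales (use H_complete in blast)

definition basis :: "nat \<Rightarrow> complex \<Rightarrow> complex" where
  "basis n = fun_scale (of_real (1 / sqrt (weight n))) (monomial n)"

lemma basis_in_H: "basis n \<in> H"
  by (simp add: basis_def monomial_in_H)

lemma ip_basis: "f \<in> H \<Longrightarrow> ip f (basis n) = of_real (sqrt (weight n)) * taylor_coeff f n"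
  using weight_pos[of n]
  by (simp add: basis_def ip_scale_right monomial_in_H ip_monomial_taylor_coeff field_simps flip: of_real_mult)

lemma basis_orthonormal: "ip (basis m) (basis n) = (if m = n then 1 else 0)"
  using weight_pos[of n]
  by (simp add: basis_def ip_scale_right ip_scale_left monomial_in_H ip_monomials flip: of_real_mult)

lemma sum_weight_taylor_coeff_le:
  assumes f: "f \<in> H"
  shows "(\<Sum>n<N. weight n * (cmod (taylor_coeff f n))\<^sup>2) \<le> (nrm f)\<^sup>2"
proof -
  have inj: "inj basis" using basis_orthonormal by (intro injI) (metis zero_neq_one)
  have "(\<Sum>n<N. weight n * (cmod (taylor_coeff f n))\<^sup>2) = (\<Sum>n<N. (cmod (ip f (basis n)))\<^sup>2)"
    using weight_pos by (simp add: ip_basis[OF f] norm_mult power_mult_distrib less_imp_le)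
  also have "\<dots> = (\<Sum>v\<in>basis ` {..<N}. (cmod (ip f v))\<^sup>2)"
    using inj_on_subset[OF inj subset_UNIV] by (simp only: sum.reindex o_def)
  also have "\<dots> \<le> (nrm f)\<^sup>2"
    by (rule Bessel[OF _ _ f]) (auto simp: orthonormal_def basis_in_H basis_orthonormal inj_eq[OF inj])
  finally show ?thesis .
qed

section \<open>A kernel that is dominated by its real part\<close>

lemma kernel_coeff_bounds:
  obtains c C where "0 < c" "0 < C"
    "\<And>n. 0 < n \<Longrightarrow> c * real n powr (\<alpha> - 1) \<le> kernel_coeff n"
    "\<And>n. 0 < n \<Longrightarrow> kernel_coeff n \<le> C * real n powr (\<alpha> - 1)"
proof -
  have eq: "kernel_coeff n * Gamma_series' \<alpha> n = real n powr (\<alpha> - 1)" if n: "0 < n" for n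
  proof -
    have "fact n = real n * fact (n - 1)" using n by (simp add: fact_reduce)
    moreover have "exp (\<alpha> * ln (real n)) = real n powr (\<alpha> - 1) * real n"
      using n by (simp add: powr_def left_diff_distrib exp_diff)
    moreover have "pochhammer \<alpha> n > 0" using \<alpha>0 by (rule pochhammer_pos)
    ultimately show ?thesis using n by (simp add: kernel_coeff_def Gamma_series'_def)
  qed
  have pos: "0 < Gamma_series' \<alpha> n" for n
    using \<alpha>0 by (simp add: Gamma_series'_def pochhammer_pos)
  have lim: "Gamma_series' \<alpha> \<longlonglongrightarrow> Gamma \<alpha>" by (rule Gamma_series'_LIMSEQ)
  have G: "0 < Gamma \<alpha>" using \<alpha>0 by (rule Gamma_real_pos)
  have "Bseq (Gamma_series' \<alpha>)" using lim by (intro convergent_imp_Bseq convergentI)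
  then obtain B where B: "0 < B" "\<And>n. norm (Gamma_series' \<alpha> n) \<le> B" by (auto elim: BseqE)
  have "Bseq (\<lambda>n. inverse (Gamma_series' \<alpha> n))"
    using tendsto_inverse[OF lim] G by (intro convergent_imp_Bseq convergentI) auto
  then obtain B' where B': "0 < B'" "\<And>n. norm (inverse (Gamma_series' \<alpha> n)) \<le> B'" by (auto elim: BseqE)
  show thesis
  proof (rule that[of "1 / B" B'])
    fix n :: nat assume n: "0 < n"
    have k: "kernel_coeff n = real n powr (\<alpha> - 1) * inverse (Gamma_series' \<alpha> n)"
      using eq[OF n] pos[of n] by (simp add: field_simps)
    have "1 / B \<le> inverse (Gamma_series' \<alpha> n)"
      using B(1) B(2)[of n] pos[of n] by (simp add: field_simps)
    then show "1 / B * real n powr (\<alpha> - 1) \<le> kernel_coeff n"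
      unfolding k by (subst mult.commute) (intro mult_left_mono, auto)
    have "inverse (Gamma_series' \<alpha> n) \<le> B'" using B'(2)[of n] pos[of n] by simp
    then show "kernel_coeff n \<le> B' * real n powr (\<alpha> - 1)"
      unfolding k by (subst (2) mult.commute) (intro mult_left_mono, auto)
  qed (use B B' in auto)
qed

text \<open>
On the circle \<open>\<bar>1 - z\<bar>\<^bsup>-\<alpha>\<^esup>\<close> is the Riesz kernel, whose energy is comparable to that of the capacity up
to an additive constant. The holomorphic variant has explicit Taylor coefficients.
\<close>

definition riesz_kernel :: "complex \<Rightarrow> complex" where
  "riesz_kernel z = (1 - z) powr (- of_real \<alpha>)"

lemma riesz_kernel_sums:
  assumes "cmod z < 1"
  shows "(\<lambda>n. of_real (kernel_coeff n) * z ^ n) sums riesz_kernel z"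
proof -
  have "((- of_real \<alpha> :: complex) gchoose n) * (- z) ^ n = of_real (kernel_coeff n) * z ^ n" for n
  proof -
    have "((- of_real \<alpha> :: complex) gchoose n) * (- z) ^ n =
        ((- 1) ^ n * (- 1) ^ n) * (pochhammer (of_real \<alpha>) n / fact n * z ^ n)"
      unfolding gbinomial_pochhammer power_minus[of z] by simp
    also have "(- 1) ^ n * (- 1) ^ n = (1 :: complex)" by (simp flip: power_mult_distrib)
    also have "pochhammer (of_real \<alpha>) n / fact n = (of_real (kernel_coeff n) :: complex)"
      by (simp add: kernel_coeff_def pochhammer_of_real)
    finally show ?thesis by simp
  qed
  then show ?thesis
    using gen_binomial_complex[of "- z" "- of_real \<alpha>"] assms by (simp add: riesz_kernel_def)
qed

lemma cos_\<alpha>_pos: "0 < cos (\<alpha> * (pi / 2))"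
proof (rule cos_gt_zero_pi)
  have "\<alpha> * (pi / 2) < 1 * (pi / 2)" using \<alpha>1 by (intro mult_strict_right_mono) auto
  then show "\<alpha> * (pi / 2) < pi / 2" by simp
  have "0 < \<alpha> * (pi / 2)" using \<alpha>0 by simp
  then show "- (pi / 2) < \<alpha> * (pi / 2)" using pi_gt_zero by linarith
qed

text \<open>
The number \<open>1 - z\<close> lies in the right half plane, so the argument of \<open>(1 - z)\<^bsup>-\<alpha>\<^esup>\<close> is at most
\<open>\<alpha> \<pi> / 2 < \<pi> / 2\<close> in modulus.
\<close>

lemma cmod_riesz_kernel_le:
  assumes z: "cmod z < 1"
  shows "cmod (riesz_kernel z) \<le> Re (riesz_kernel z) / cos (\<alpha> * (pi / 2))"
proof -
  let ?u = "1 - z"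
  have Re: "0 < Re ?u" using z complex_Re_le_cmod[of z] by simp
  then have nz: "?u \<noteq> 0" by (metis zero_complex.simps(1) less_irrefl)
  have arg: "\<bar>Im (Ln ?u)\<bar> < pi / 2" using Re_Ln_pos_lt[OF nz] Re by simp
  let ?e = "- of_real \<alpha> * Ln ?u"
  have k: "riesz_kernel z = exp ?e" using nz by (simp add: riesz_kernel_def powr_def)
  have "\<alpha> * \<bar>Im (Ln ?u)\<bar> \<le> \<alpha> * (pi / 2)" using arg \<alpha>0 by (intro mult_left_mono) auto
  moreover have "\<alpha> * (pi / 2) \<le> 1 * pi" using \<alpha>1 by (intro mult_mono) auto
  ultimately have "cos (\<alpha> * (pi / 2)) \<le> cos (\<alpha> * \<bar>Im (Ln ?u)\<bar>)"
    using \<alpha>0 by (intro cos_monotone_0_pi_le) auto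
  also have "\<dots> = cos (Im ?e)"
    by (cases "0 \<le> Im (Ln ?u)") (auto simp: abs_if)
  finally have "cmod (riesz_kernel z) * cos (\<alpha> * (pi / 2)) \<le> cmod (riesz_kernel z) * cos (Im ?e)"
    by (intro mult_left_mono) auto
  also have "\<dots> = Re (riesz_kernel z)" unfolding k norm_exp_eq_Re Re_exp ..
  finally show ?thesis using cos_\<alpha>_pos by (simp add: pos_le_divide_eq)
qed

end

section \<open>Measures of finite energy and boundary values\<close>

locale circle_measure = dirichlet_weight +
  fixes M :: "complex measure"
  assumes prob_M: "prob_space M" and sets_M: "sets M = sets (restrict_space borel (sphere 0 1))"
begin

lemma space_M: "space M = sphere 0 1"
  using sets_eq_imp_space_eq[OF sets_M] by (simp add: space_restrict_space)

lemma finite_M: "finite_measure M"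
  using prob_M by (rule prob_space.finite_measure)

lemma M_total: "measure M (space M) = 1"
  using prob_M by (rule prob_space.prob_space)

lemma continuous_measurable_M:
  assumes "continuous_on (sphere 0 1) f"
  shows "(f :: complex \<Rightarrow> complex) \<in> borel_measurable M"
  using borel_measurable_continuous_on_restrict[OF assms] measurable_cong_sets[OF sets_M refl] by blast

lemma kernel_term_bound:
  assumes r: "0 \<le> r" and "cmod a \<le> 1" "cmod b \<le> 1" "cmod c \<le> 1" "cmod d \<le> 1"
  shows "cmod (of_real (kernel_coeff n * r ^ n) * (a * b) * (c * d)) \<le> r ^ n"
proof -
  have "cmod (a * b) \<le> 1" "cmod (c * d) \<le> 1" unfolding norm_mult using assms by (auto intro: mult_le_one)
  then have ab: "cmod (a * b) * cmod (c * d) \<le> 1" by (intro mult_le_one) auto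
  have x: "0 \<le> kernel_coeff n * r ^ n" "kernel_coeff n * r ^ n \<le> 1 * r ^ n"
    using mult_right_mono[OF kernel_coeff_le_1[of n], of "r ^ n"] kernel_coeff_pos[of n] r by simp_all
  have "cmod (of_real x * u * v) = x * (cmod u * cmod v)" if "0 \<le> x" for x u v
    using that by (simp add: norm_mult)
  from this[OF x(1), of "a * b" "c * d"]
  have "cmod (of_real (kernel_coeff n * r ^ n) * (a * b) * (c * d)) = kernel_coeff n * r ^ n * (cmod (a * b) * cmod (c * d))" .
  also have "\<dots> \<le> kernel_coeff n * r ^ n * 1" by (rule mult_left_mono[OF ab x(1)])
  also have "\<dots> \<le> r ^ n" using x(2) by simp
  finally show ?thesis .
qed

lemma circle_power [simp]: "\<zeta> \<in> space M \<Longrightarrow> cmod (\<zeta> ^ n) \<le> 1" "\<zeta> \<in> space M \<Longrightarrow> cmod \<zeta> = 1"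
  by (auto simp: space_M norm_power)

lemma power_measurable_M: "(\<lambda>\<zeta>. \<zeta> ^ n) \<in> borel_measurable M"
  by (intro continuous_measurable_M continuous_intros)

definition twisted_moment :: "(complex \<Rightarrow> complex) \<Rightarrow> nat \<Rightarrow> complex" where
  "twisted_moment h n = (LINT \<zeta>|M. h \<zeta> * \<zeta> ^ n)"

text \<open>
The factor \<open>r < 1\<close> makes the kernel bounded and its series uniformly convergent. Integrating
\<open>potential r h\<close> gives the energy of the complex measure with density \<open>h\<close>, regularized by \<open>r\<close>.
\<close>

definition potential :: "real \<Rightarrow> (complex \<Rightarrow> complex) \<Rightarrow> complex \<Rightarrow> complex" where
  "potential r h \<zeta> = (LINT \<eta>|M. h \<zeta> * cnj (h \<eta>) * riesz_kernel (of_real r * (\<zeta> * cnj \<eta>)))"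

context
  fixes h :: "complex \<Rightarrow> complex" and r :: real
  assumes h_meas: "h \<in> borel_measurable M" and h_le: "\<forall>\<zeta>\<in>space M. cmod (h \<zeta>) \<le> 1"
    and r: "0 \<le> r" "r < 1"
begin

lemma cmod_twisted_moment_le: "cmod (twisted_moment h n) \<le> 1"
proof -
  interpret prob_space M by (rule prob_M)
  have "cmod (twisted_moment h n) \<le> (LINT \<zeta>|M. 1)"
    unfolding twisted_moment_def
  proof (rule Bochner_Integration.integral_norm_bound_integral)
    have [measurable]: "(\<lambda>\<zeta>. \<zeta> ^ n) \<in> borel_measurable M"
      by (intro continuous_measurable_M continuous_intros)
    have b: "cmod (h \<zeta> * \<zeta> ^ n) \<le> 1" if "\<zeta> \<in> space M" for \<zeta>
      unfolding norm_mult using bspec[OF h_le that] circle_power[OF that] by (intro mult_le_one) auto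
    then show "cmod (h \<zeta> * \<zeta> ^ n) \<le> 1" if "\<zeta> \<in> space M" for \<zeta> using that .
    show "integrable M (\<lambda>\<zeta>. h \<zeta> * \<zeta> ^ n)"
      by (rule integrable_const_bound[where B = 1]) (use b h_meas in auto)
  qed simp
  then show ?thesis by (simp add: M_total)
qed

lemma summable_power_r: "summable (\<lambda>n. r ^ n)"
  using r by (intro summable_geometric) auto

lemma potential_inner:
  assumes \<zeta>: "\<zeta> \<in> space M"
  shows "(\<lambda>n. of_real (kernel_coeff n * r ^ n) * (h \<zeta> * \<zeta> ^ n) * cnj (twisted_moment h n)) sums potential r h \<zeta>"
    and "integrable M (\<lambda>\<eta>. h \<zeta> * cnj (h \<eta>) * riesz_kernel (of_real r * (\<zeta> * cnj \<eta>)))"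
proof -
  let ?u = "\<lambda>n \<eta>. of_real (kernel_coeff n * r ^ n) * (h \<zeta> * \<zeta> ^ n) * (cnj (h \<eta>) * cnj (\<eta> ^ n))"
  have meas: "?u n \<in> borel_measurable M" for n
    using h_meas power_measurable_M[of n] by measurable
  have bound: "cmod (?u n \<eta>) \<le> r ^ n" if "\<eta> \<in> space M" for n \<eta>
    using that \<zeta> h_le r by (intro kernel_term_bound) (auto simp: norm_power)
  have sums: "(\<lambda>n. ?u n \<eta>) sums (h \<zeta> * cnj (h \<eta>) * riesz_kernel (of_real r * (\<zeta> * cnj \<eta>)))"
    if \<eta>: "\<eta> \<in> space M" for \<eta>
  proof -
    have "cmod (of_real r * (\<zeta> * cnj \<eta>)) < 1" using r \<zeta> \<eta> by (simp add: norm_mult)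
    from sums_mult[OF riesz_kernel_sums[OF this], of "h \<zeta> * cnj (h \<eta>)"] show ?thesis
      by (rule back_subst[of "\<lambda>u. u sums _"]) (auto simp: power_mult_distrib)
  qed
  have sum: "(\<lambda>n. LINT \<eta>|M. ?u n \<eta>) sums (LINT \<eta>|M. h \<zeta> * cnj (h \<eta>) * riesz_kernel (of_real r * (\<zeta> * cnj \<eta>)))"
    by (rule sums_integral_bounded(1)[OF finite_M meas bound summable_power_r sums])
  show "integrable M (\<lambda>\<eta>. h \<zeta> * cnj (h \<eta>) * riesz_kernel (of_real r * (\<zeta> * cnj \<eta>)))" 
    by (rule sums_integral_bounded(2)[OF finite_M meas bound summable_power_r sums])
  have eq: "(LINT \<eta>|M. ?u n \<eta>) = of_real (kernel_coeff n * r ^ n) * (h \<zeta> * \<zeta> ^ n) * cnj (twisted_moment h n)" for n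
  proof -
    have "(LINT \<eta>|M. ?u n \<eta>) = of_real (kernel_coeff n * r ^ n) * (h \<zeta> * \<zeta> ^ n) * (LINT \<eta>|M. cnj (h \<eta> * \<eta> ^ n))"
      by (subst integral_mult_right_zero) simp
    then show ?thesis unfolding Bochner_Integration.integral_cnj twisted_moment_def .
  qed
  show "(\<lambda>n. of_real (kernel_coeff n * r ^ n) * (h \<zeta> * \<zeta> ^ n) * cnj (twisted_moment h n)) sums potential r h \<zeta>"
    using sum unfolding eq potential_def .
qed

lemma potential_outer:
  shows "(\<lambda>n. of_real (kernel_coeff n * r ^ n * (cmod (twisted_moment h n))\<^sup>2)) sums (LINT \<zeta>|M. potential r h \<zeta>)"
    and "integrable M (potential r h)"
proof -
  let ?u = "\<lambda>n \<zeta>. of_real (kernel_coeff n * r ^ n) * (h \<zeta> * \<zeta> ^ n) * (cnj (twisted_moment h n) * 1)"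
  have meas: "?u n \<in> borel_measurable M" for n
    using h_meas power_measurable_M[of n] by measurable
  have bound: "cmod (?u n \<zeta>) \<le> r ^ n" if "\<zeta> \<in> space M" for n \<zeta>
    using that h_le cmod_twisted_moment_le r by (intro kernel_term_bound) auto
  have sums: "(\<lambda>n. ?u n \<zeta>) sums potential r h \<zeta>" if "\<zeta> \<in> space M" for \<zeta>
    using potential_inner(1)[OF that] by simp
  have sum: "(\<lambda>n. LINT \<zeta>|M. ?u n \<zeta>) sums (LINT \<zeta>|M. potential r h \<zeta>)"
    by (rule sums_integral_bounded(1)[OF finite_M meas bound summable_power_r sums])
  show "integrable M (potential r h)" 
    by (rule sums_integral_bounded(2)[OF finite_M meas bound summable_power_r sums])
  have eq: "(LINT \<zeta>|M. ?u n \<zeta>) = of_real (kernel_coeff n * r ^ n * (cmod (twisted_moment h n))\<^sup>2)" for n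
  proof -
    have "(LINT \<zeta>|M. ?u n \<zeta>) = (LINT \<zeta>|M. of_real (kernel_coeff n * r ^ n) * cnj (twisted_moment h n) * (h \<zeta> * \<zeta> ^ n))"
      by (simp add: mult_ac)
    also have "\<dots> = of_real (kernel_coeff n * r ^ n) * cnj (twisted_moment h n) * twisted_moment h n"
      unfolding twisted_moment_def by (rule integral_mult_right_zero)
    also have "\<dots> = of_real (kernel_coeff n * r ^ n) * (twisted_moment h n * cnj (twisted_moment h n))" by simp
    finally show ?thesis unfolding complex_norm_square[symmetric] by simp
  qed
  show "(\<lambda>n. of_real (kernel_coeff n * r ^ n * (cmod (twisted_moment h n))\<^sup>2)) sums (LINT \<zeta>|M. potential r h \<zeta>)"
    using sum unfolding eq .
qed

end

text \<open>
A density of modulus at most \<open>1\<close> increases the energy of a positive measure by at most a constant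
factor. This is not visible from the Fourier coefficients, but it is from the double integral
of the kernel, where the modulus of the kernel can be replaced by its real part.
\<close>

lemma twisted_energy_le:
  assumes h: "h \<in> borel_measurable M" "\<forall>\<zeta>\<in>space M. cmod (h \<zeta>) \<le> 1" and r: "0 \<le> r" "r < 1"
    and S: "summable (\<lambda>n. kernel_coeff n * (cmod (twisted_moment (\<lambda>_. 1) n))\<^sup>2)"
  shows "(\<Sum>n<N. kernel_coeff n * r ^ n * (cmod (twisted_moment h n))\<^sup>2) \<le>
    (\<Sum>n. kernel_coeff n * (cmod (twisted_moment (\<lambda>_. 1) n))\<^sup>2) / cos (\<alpha> * (pi / 2))"
proof -
  let ?c = "cos (\<alpha> * (pi / 2))"
  let ?one = "\<lambda>_::complex. 1 :: complex"
  have one: "?one \<in> borel_measurable M" "\<forall>\<zeta>\<in>space M. cmod (?one \<zeta>) \<le> 1" by auto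
  note inner_h = potential_inner[OF h r] and outer_h = potential_outer[OF h r]
  note inner_1 = potential_inner[OF one r] and outer_1 = potential_outer[OF one r]
  have circ: "cmod \<zeta> = 1" if "\<zeta> \<in> space M" for \<zeta> using that by (simp add: space_M)
  have pot: "cmod (potential r h \<zeta>) \<le> Re (potential r ?one \<zeta>) / ?c" if \<zeta>: "\<zeta> \<in> space M" for \<zeta>
  proof -
    let ?K = "\<lambda>\<eta>. riesz_kernel (of_real r * (\<zeta> * cnj \<eta>))"
    have int1: "integrable M ?K" using inner_1(2)[OF \<zeta>] by simp
    have "cmod (potential r h \<zeta>) \<le> (LINT \<eta>|M. Re (?K \<eta>) / ?c)"
      unfolding potential_def
    proof (rule Bochner_Integration.integral_norm_bound_integral)
      show "integrable M (\<lambda>\<eta>. Re (?K \<eta>) / ?c)" using int1 by (intro integrable_divide_zero integrable_Re)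
      fix \<eta> assume \<eta>: "\<eta> \<in> space M"
      have "cmod (of_real r * (\<zeta> * cnj \<eta>)) < 1" using r circ[OF \<zeta>] circ[OF \<eta>] by (simp add: norm_mult)
      note k = cmod_riesz_kernel_le[OF this]
      have "cmod (h \<zeta> * cnj (h \<eta>)) \<le> 1"
        unfolding norm_mult using bspec[OF h(2) \<zeta>] bspec[OF h(2) \<eta>] by (intro mult_le_one) auto
      then have "cmod (h \<zeta> * cnj (h \<eta>)) * cmod (?K \<eta>) \<le> 1 * cmod (?K \<eta>)" by (intro mult_right_mono) auto
      with k show "cmod (h \<zeta> * cnj (h \<eta>) * ?K \<eta>) \<le> Re (?K \<eta>) / ?c" by (simp add: norm_mult)
    qed (use inner_h(2)[OF \<zeta>] in simp)
    also have "\<dots> = Re (LINT \<eta>|M. ?K \<eta>) / ?c" using int1 by (simp add: integral_Re)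
    finally show ?thesis by (simp add: potential_def)
  qed
  have sum_h: "(\<lambda>n. kernel_coeff n * r ^ n * (cmod (twisted_moment h n))\<^sup>2) sums Re (LINT \<zeta>|M. potential r h \<zeta>)"
    using sums_Re[OF outer_h(1)] by simp
  have sum_1: "(\<lambda>n. kernel_coeff n * r ^ n * (cmod (twisted_moment ?one n))\<^sup>2) sums Re (LINT \<zeta>|M. potential r ?one \<zeta>)"
    using sums_Re[OF outer_1(1)] by simp
  have "(\<Sum>n<N. kernel_coeff n * r ^ n * (cmod (twisted_moment h n))\<^sup>2) \<le> Re (LINT \<zeta>|M. potential r h \<zeta>)"
    using sum_le_suminf[OF sums_summable[OF sum_h], of "{..<N}"] sums_unique[OF sum_h] r kernel_coeff_pos
    by (simp add: less_imp_le)
  also have "\<dots> \<le> cmod (LINT \<zeta>|M. potential r h \<zeta>)" by (rule complex_Re_le_cmod)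
  also have "\<dots> \<le> (LINT \<zeta>|M. Re (potential r ?one \<zeta>) / ?c)"
    by (rule Bochner_Integration.integral_norm_bound_integral[OF outer_h(2) _ pot])
      (intro integrable_divide_zero integrable_Re outer_1(2))
  also have "\<dots> = Re (LINT \<zeta>|M. potential r ?one \<zeta>) / ?c"
    using outer_1(2) by (simp add: integral_Re)
  also have "\<dots> \<le> (\<Sum>n. kernel_coeff n * (cmod (twisted_moment ?one n))\<^sup>2) / ?c"
  proof (rule divide_right_mono)
    have "kernel_coeff n * r ^ n * (cmod (twisted_moment ?one n))\<^sup>2 \<le> kernel_coeff n * (cmod (twisted_moment ?one n))\<^sup>2" for n
    proof (rule mult_right_mono)
      show "kernel_coeff n * r ^ n \<le> kernel_coeff n"
        using kernel_coeff_pos[of n] r power_le_one[of r n] by (simp add: mult_left_le)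
    qed simp
    then show "Re (LINT \<zeta>|M. potential r ?one \<zeta>) \<le> (\<Sum>n. kernel_coeff n * (cmod (twisted_moment ?one n))\<^sup>2)"
      unfolding sums_unique[OF sum_1] by (rule suminf_le[OF _ sums_summable[OF sum_1] S])
  qed (use cos_\<alpha>_pos in simp)
  finally show ?thesis .
qed

definition embedding_constant :: real where
  "embedding_constant =
     sqrt ((\<Sum>n. kernel_coeff n * (cmod (twisted_moment (\<lambda>_. 1) n))\<^sup>2) / cos (\<alpha> * (pi / 2)) / \<alpha>)"

text \<open>
Functions of the Dirichlet space have integrals against a measure of finite energy, uniformly in the
radius and in the density \<open>h\<close>. In terms of Taylor coefficients and moments this is the
Cauchy-Schwarz inequality for the weights \<open>weight n\<close> and their reciprocals, and the latter are bounded
by multiples of \<open>kernel_coeff n\<close>.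
\<close>

lemma integral_against_bounded_le:
  assumes h: "h \<in> borel_measurable M" "\<forall>\<zeta>\<in>space M. cmod (h \<zeta>) \<le> 1" and r: "0 \<le> r" "r < 1"
    and S: "summable (\<lambda>n. kernel_coeff n * (cmod (twisted_moment (\<lambda>_. 1) n))\<^sup>2)"
    and f: "f \<in> H"
  shows "cmod (LINT \<zeta>|M. h \<zeta> * f (of_real r * \<zeta>)) \<le> embedding_constant * nrm f"
proof -
  let ?c = "\<lambda>n. twisted_moment h n" and ?a = "\<lambda>n. taylor_coeff f n"
  let ?u = "\<lambda>n \<zeta>. ?a n * of_real (r ^ n) * (h \<zeta> * \<zeta> ^ n)"
  have circ: "cmod \<zeta> = 1" if "\<zeta> \<in> space M" for \<zeta> using that by (simp add: space_M)
  have sum: "(\<lambda>n. LINT \<zeta>|M. ?u n \<zeta>) sums (LINT \<zeta>|M. h \<zeta> * f (of_real r * \<zeta>))"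
  proof (rule sums_integral_bounded(1)[OF finite_M])
    show "?u n \<in> borel_measurable M" for n
      using h(1) power_measurable_M[of n] by measurable
    show "summable (\<lambda>n. nrm f * r ^ n)" using r by (intro summable_mult summable_geometric) auto
    show "cmod (?u n \<zeta>) \<le> nrm f * r ^ n" if "\<zeta> \<in> space M" for n \<zeta>
    proof -
      have "cmod (?u n \<zeta>) = (cmod (?a n) * r ^ n) * cmod (h \<zeta>)"
        using r circ[OF that] by (simp add: norm_mult norm_power)
      also have "\<dots> \<le> (nrm f * r ^ n) * 1"
        using r bspec[OF h(2) that] taylor_coeff_le_nrm[OF f, of n] f by (intro mult_mono) auto
      finally show ?thesis by simp
    qed
    show "(\<lambda>n. ?u n \<zeta>) sums (h \<zeta> * f (of_real r * \<zeta>))" if "\<zeta> \<in> space M" for \<zeta>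
    proof -
      have "of_real r * \<zeta> \<in> ball 0 1" using r circ[OF that] by (simp add: norm_mult)
      from sums_mult[OF taylor_coeff_sums[OF f this], of "h \<zeta>"] show ?thesis
        by (rule back_subst[of "\<lambda>u. u sums _"]) (auto simp: power_mult_distrib)
    qed
  qed
  have eq: "(LINT \<zeta>|M. ?u n \<zeta>) = ?a n * of_real (r ^ n) * ?c n" for n
    unfolding twisted_moment_def by (rule integral_mult_right_zero)
  have sums: "(\<lambda>n. ?a n * of_real (r ^ n) * ?c n) sums (LINT \<zeta>|M. h \<zeta> * f (of_real r * \<zeta>))"
    using sum unfolding eq .
  have part: "cmod (\<Sum>n<N. ?a n * of_real (r ^ n) * ?c n) \<le> embedding_constant * nrm f" for N
  proof -
    let ?x = "\<lambda>n. sqrt (weight n) * cmod (?a n)" and ?y = "\<lambda>n. r ^ n * cmod (?c n) / sqrt (weight n)"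
    have "cmod (\<Sum>n<N. ?a n * of_real (r ^ n) * ?c n) \<le> (\<Sum>n<N. ?x n * ?y n)"
      using r weight_pos by (intro sum_norm_le) (simp add: norm_mult norm_power less_imp_neq[symmetric])
    also have "\<dots> \<le> sqrt ((\<Sum>n<N. (?x n)\<^sup>2) * (\<Sum>n<N. (?y n)\<^sup>2))"
      by (rule real_le_rsqrt) (rule Cauchy_Schwarz_ineq_sum)
    also have "\<dots> \<le> sqrt ((nrm f)\<^sup>2 * embedding_constant\<^sup>2)"
    proof (intro real_sqrt_le_mono mult_mono)
      show "(\<Sum>n<N. (?x n)\<^sup>2) \<le> (nrm f)\<^sup>2"
        using sum_weight_taylor_coeff_le[OF f, of N] weight_pos by (simp add: power_mult_distrib less_imp_le)
      have "(\<Sum>n<N. (?y n)\<^sup>2) \<le> (\<Sum>n<N. kernel_coeff n * r ^ n * (cmod (?c n))\<^sup>2) / \<alpha>"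
        unfolding sum_divide_distrib
      proof (rule sum_mono)
        fix n
        have "(?y n)\<^sup>2 = r ^ n * (r ^ n * (cmod (?c n))\<^sup>2 * (1 / weight n))"
          using weight_pos[of n] by (simp add: power_divide power_mult_distrib power2_eq_square[of "r ^ n"] less_imp_le)
        also have "\<dots> \<le> 1 * (r ^ n * (cmod (?c n))\<^sup>2 * (kernel_coeff n / \<alpha>))"
          using r inverse_weight_le[of n] weight_pos[of n] by (intro mult_mono power_le_one) (auto simp: less_imp_le)
        finally show "(?y n)\<^sup>2 \<le> kernel_coeff n * r ^ n * (cmod (?c n))\<^sup>2 / \<alpha>" by (simp add: mult_ac)
      qed
      also have "\<dots> \<le> (\<Sum>n. kernel_coeff n * (cmod (twisted_moment (\<lambda>_. 1) n))\<^sup>2) / cos (\<alpha> * (pi / 2)) / \<alpha>"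
        using twisted_energy_le[OF h r S] \<alpha>0 by (intro divide_right_mono) auto
      also have "\<dots> = embedding_constant\<^sup>2"
      proof -
        have "0 \<le> (\<Sum>n. kernel_coeff n * (cmod (twisted_moment (\<lambda>_. 1) n))\<^sup>2)"
          using kernel_coeff_pos by (intro suminf_nonneg S) (simp add: less_imp_le)
        then show ?thesis using cos_\<alpha>_pos \<alpha>0 by (simp add: embedding_constant_def)
      qed
      finally show "(\<Sum>n<N. (?y n)\<^sup>2) \<le> embedding_constant\<^sup>2" .
    qed (auto intro!: sum_nonneg)
    also have "\<dots> = \<bar>nrm f * embedding_constant\<bar>" by (simp add: real_sqrt_mult abs_mult)
    also have "\<dots> = embedding_constant * nrm f"
    proof -
      have "0 \<le> (\<Sum>n. kernel_coeff n * (cmod (twisted_moment (\<lambda>_. 1) n))\<^sup>2)"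
        using kernel_coeff_pos by (intro suminf_nonneg S) (simp add: less_imp_le)
      then have "0 \<le> embedding_constant" using cos_\<alpha>_pos \<alpha>0 by (simp add: embedding_constant_def)
      then show ?thesis using f by (simp add: abs_mult)
    qed
    finally show ?thesis .
  qed
  have "(\<lambda>N. cmod (\<Sum>n<N. ?a n * of_real (r ^ n) * ?c n)) \<longlonglongrightarrow> cmod (LINT \<zeta>|M. h \<zeta> * f (of_real r * \<zeta>))"
    using sums unfolding sums_def by (rule tendsto_norm)
  then show ?thesis by (rule LIMSEQ_le_const2) (use part in blast)
qed

lemma summable_of_finite_energy:
  assumes "energy \<alpha> M \<noteq> \<top>"
  shows "summable (\<lambda>n. kernel_coeff n * (cmod (twisted_moment (\<lambda>_. 1) n))\<^sup>2)"
proof -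
  have fc: "cmod (fourier_coeff M (int n)) = cmod (twisted_moment (\<lambda>_. 1) n)" for n
  proof -
    have "fourier_coeff M (int n) = (LINT \<zeta>|M. cnj (1 * \<zeta> ^ n))"
      unfolding fourier_coeff_def
    proof (intro Bochner_Integration.integral_cong refl)
      fix \<zeta> assume "\<zeta> \<in> space M"
      then have 1: "cmod \<zeta> = 1" by (simp add: space_M)
      have "\<zeta> powi (- int n) = inverse (\<zeta> ^ n)" by (simp add: power_int_minus)
      also have "\<dots> = cnj (1 * \<zeta> ^ n)"
      proof (rule inverse_unique)
        have "\<zeta> ^ n * cnj (\<zeta> ^ n) = 1"
          unfolding complex_norm_square[symmetric] using 1 by (simp add: norm_power)
        then show "\<zeta> ^ n * cnj (1 * \<zeta> ^ n) = 1" by simp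
      qed
      finally show "\<zeta> powi (- int n) = cnj (1 * \<zeta> ^ n)" .
    qed
    then show ?thesis
      unfolding twisted_moment_def Bochner_Integration.integral_cnj by (simp only: complex_mod_cnj)
  qed
  obtain C where C: "0 < C" "\<And>n. 0 < n \<Longrightarrow> kernel_coeff n \<le> C * real n powr (\<alpha> - 1)"
    using kernel_coeff_bounds by metis
  have "summable (\<lambda>k. (cmod (fourier_coeff M (int (Suc k))))\<^sup>2 / real (Suc k) powr (1 - \<alpha>))"
    using assms by (intro summable_suminf_not_top) (auto simp: energy_def)
  then have s: "summable (\<lambda>k. C * ((cmod (fourier_coeff M (int (Suc k))))\<^sup>2 / real (Suc k) powr (1 - \<alpha>)))"
    by (rule summable_mult)
  have "summable (\<lambda>k. kernel_coeff (Suc k) * (cmod (twisted_moment (\<lambda>_. 1) (Suc k)))\<^sup>2)"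
  proof (rule summable_comparison_test'[OF s])
    fix k
    have "real (Suc k) powr (\<alpha> - 1) = 1 / real (Suc k) powr (1 - \<alpha>)"
      by (metis minus_diff_eq powr_minus_divide)
    then have "kernel_coeff (Suc k) * (cmod (twisted_moment (\<lambda>_. 1) (Suc k)))\<^sup>2 \<le>
        C * (1 / real (Suc k) powr (1 - \<alpha>)) * (cmod (twisted_moment (\<lambda>_. 1) (Suc k)))\<^sup>2"
      using C(2)[of "Suc k"] by (intro mult_right_mono) auto
    then show "norm (kernel_coeff (Suc k) * (cmod (twisted_moment (\<lambda>_. 1) (Suc k)))\<^sup>2) \<le>
        C * ((cmod (fourier_coeff M (int (Suc k))))\<^sup>2 / real (Suc k) powr (1 - \<alpha>))"
      unfolding fc using kernel_coeff_pos[of "Suc k"] by (simp add: less_imp_le)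
  qed
  then show ?thesis by (subst (asm) summable_Suc_iff)
qed

text \<open>
With the density \<open>h \<zeta> = cnj (\<phi> (r \<zeta>))\<^bsup>N\<^esup>\<close> the preceding lemma bounds the integral of
\<open>\<bar>\<phi> (r \<zeta>)\<bar>\<^bsup>2N\<^esup>\<close>. As \<open>r \<rightarrow> 1\<close> along the radii, which lie in every Stolz region, the integrand
tends to \<open>1\<close> on the contact set. The measure is carried by the contact set, so the limit of the
integrals is \<open>1\<close>.
\<close>

lemma norm_composed_power_ge:
  assumes hol: "\<phi> holomorphic_on ball 0 1" and self: "\<phi> ` ball 0 1 \<subseteq> ball 0 1"
    and F: "closed F" "F \<subseteq> contact_set \<phi>" and mass: "emeasure M (F \<inter> sphere 0 1) = 1"
    and S: "summable (\<lambda>n. kernel_coeff n * (cmod (twisted_moment (\<lambda>_. 1) n))\<^sup>2)"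
    and in_H: "composition_operator \<phi> (monomial N) \<in> H"
  shows "1 \<le> embedding_constant * nrm (composition_operator \<phi> (monomial N))"
proof -
  interpret prob_space M by (rule prob_M)
  let ?f = "composition_operator \<phi> (monomial N)"
  have f: "?f z = \<phi> z ^ N" if "z \<in> ball 0 1" for z
    using that self by (auto simp: composition_operator_def monomial_def image_subset_iff)
  have phi: "cmod (\<phi> z) < 1" if "z \<in> ball 0 1" for z using that self by (auto simp: image_subset_iff)
  have circ: "cmod \<zeta> = 1" if "\<zeta> \<in> space M" for \<zeta> using that by (simp add: space_M)
  define r where "r n = 1 - 1 / real (Suc n)" for n
  have r: "0 \<le> r n" "r n < 1" for n by (auto simp: r_def)
  have r_lim: "r \<longlonglongrightarrow> 1"
    using tendsto_diff[OF tendsto_const LIMSEQ_Suc[OF lim_1_over_n[where 'a = real]], of 1]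
    by (simp add: r_def[abs_def])
  have in_disc: "of_real (r n) * \<zeta> \<in> ball 0 1" if "\<zeta> \<in> space M" for n \<zeta>
    using r[of n] circ[OF that] by (simp add: norm_mult)
  let ?g = "\<lambda>n \<zeta>. \<phi> (of_real (r n) * \<zeta>) ^ N"
  have g_cont: "continuous_on (sphere 0 1) (?g n)" for n
  proof (intro continuous_on_power continuous_on_compose2[OF holomorphic_on_imp_continuous_on[OF hol]])
    show "(*) (complex_of_real (r n)) ` sphere 0 1 \<subseteq> ball 0 1"
      using in_disc[of _ n] by (auto simp: space_M)
  qed (intro continuous_intros)
  have g_meas [measurable]: "?g n \<in> borel_measurable M" for n
    by (rule continuous_measurable_M[OF g_cont])
  have g_le: "cmod (?g n \<zeta>) \<le> 1" if "\<zeta> \<in> space M" for n \<zeta>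
    using phi[OF in_disc[OF that, of n]] by (simp add: norm_power power_le_one)
  have bound: "(LINT \<zeta>|M. (cmod (?g n \<zeta>))\<^sup>2) \<le> embedding_constant * nrm ?f" for n
  proof -
    have h: "(\<lambda>\<zeta>. cnj (?g n \<zeta>)) \<in> borel_measurable M" by (rule borel_measurable_cnj) (rule g_meas)
    have h1: "\<forall>\<zeta>\<in>space M. cmod (cnj (?g n \<zeta>)) \<le> 1" using g_le by (simp only: complex_mod_cnj) blast
    have "cmod (LINT \<zeta>|M. cnj (?g n \<zeta>) * ?f (of_real (r n) * \<zeta>)) \<le> embedding_constant * nrm ?f"
      by (rule integral_against_bounded_le[OF h h1 r(1)[of n] r(2)[of n] S in_H])
    also have "(LINT \<zeta>|M. cnj (?g n \<zeta>) * ?f (of_real (r n) * \<zeta>)) = (LINT \<zeta>|M. complex_of_real ((cmod (?g n \<zeta>))\<^sup>2))"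
    proof (intro Bochner_Integration.integral_cong refl)
      fix \<zeta> assume \<zeta>: "\<zeta> \<in> space M"
      show "cnj (?g n \<zeta>) * ?f (of_real (r n) * \<zeta>) = complex_of_real ((cmod (?g n \<zeta>))\<^sup>2)"
        unfolding complex_norm_square f[OF in_disc[OF \<zeta>]] by (rule mult.commute)
    qed
    also have "\<dots> = of_real (LINT \<zeta>|M. (cmod (?g n \<zeta>))\<^sup>2)" by (rule integral_complex_of_real)
    also have "cmod \<dots> = (LINT \<zeta>|M. (cmod (?g n \<zeta>))\<^sup>2)" by simp
    finally show ?thesis .
  qed
  have limit: "(\<lambda>n. (cmod (?g n \<zeta>))\<^sup>2) \<longlonglongrightarrow> 1" if \<zeta>: "\<zeta> \<in> F" for \<zeta>
  proof -
    from \<zeta> F obtain w where w: "has_nontangential_limit \<phi> w \<zeta>" "1 \<le> cmod w" and \<zeta>1: "cmod \<zeta> = 1"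
      by (auto simp: contact_set_def)
    have "filterlim (\<lambda>n. of_real (r n) * \<zeta>) (at \<zeta> within stolz_region \<zeta> 2) sequentially"
      unfolding filterlim_at
    proof -
      have "(\<lambda>n. of_real (r n) * \<zeta>) \<longlonglongrightarrow> of_real 1 * \<zeta>" by (intro tendsto_intros r_lim)
      moreover have "of_real (r n) * \<zeta> \<in> stolz_region \<zeta> 2 \<and> of_real (r n) * \<zeta> \<noteq> \<zeta>" for n
      proof -
        have "of_real (r n) * \<zeta> - \<zeta> = of_real (r n - 1) * \<zeta>" by (simp add: algebra_simps)
        then have "cmod (of_real (r n) * \<zeta> - \<zeta>) = 1 - r n" using r[of n] \<zeta>1 by (simp only: norm_mult norm_of_real) simp
        moreover have "cmod (of_real (r n) * \<zeta>) = r n" using r[of n] \<zeta>1 by (simp add: norm_mult)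
        ultimately show ?thesis using r[of n] by (auto simp: stolz_region_def)
      qed
      ultimately show "(\<forall>\<^sub>F n in sequentially. of_real (r n) * \<zeta> \<in> stolz_region \<zeta> 2 \<and> of_real (r n) * \<zeta> \<noteq> \<zeta>) \<and>
          (\<lambda>n. of_real (r n) * \<zeta>) \<longlonglongrightarrow> \<zeta>" by simp
    qed
    moreover have "(\<phi> \<longlongrightarrow> w) (at \<zeta> within stolz_region \<zeta> 2)"
      using w(1) by (simp add: has_nontangential_limit_def)
    ultimately have phi_lim: "(\<lambda>n. \<phi> (of_real (r n) * \<zeta>)) \<longlonglongrightarrow> w" by (rule filterlim_compose[rotated])
    have "\<zeta> \<in> space M" using \<zeta>1 by (simp add: space_M)
    then have "cmod w \<le> 1"
      using phi[OF in_disc] by (intro LIMSEQ_le_const2[OF tendsto_norm[OF phi_lim]]) (auto intro: less_imp_le)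
    then have "cmod w = 1" using w(2) by simp
    moreover have "(\<lambda>n. (cmod (?g n \<zeta>))\<^sup>2) \<longlonglongrightarrow> (cmod (w ^ N))\<^sup>2" by (intro tendsto_intros phi_lim)
    ultimately show ?thesis by (simp add: norm_power)
  qed
  have "(\<lambda>n. LINT \<zeta>|M. (cmod (?g n \<zeta>))\<^sup>2) \<longlonglongrightarrow> (LINT \<zeta>|M. 1)"
  proof (rule integral_dominated_convergence[where w = "\<lambda>_. 1"])
    have "F \<inter> sphere 0 1 \<in> sets M"
      unfolding sets_M sets_restrict_space Int_commute[of F] using F(1) by (intro imageI borel_closed)
    then have "prob (F \<inter> sphere 0 1) = 1" using mass by (simp add: measure_def)
    then have "AE \<zeta> in M. \<zeta> \<in> F \<inter> sphere 0 1" by (rule AE_prob_1)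
    then show "AE \<zeta> in M. (\<lambda>n. (cmod (?g n \<zeta>))\<^sup>2) \<longlonglongrightarrow> 1"
      by eventually_elim (use limit in auto)
    show "AE \<zeta> in M. norm ((cmod (?g n \<zeta>))\<^sup>2) \<le> 1" for n
      using g_le by (intro AE_I2) (simp add: power_le_one)
  qed (use g_meas in \<open>auto intro: borel_measurable_power borel_measurable_norm\<close>)
  then have "(LINT \<zeta>|M. 1) \<le> embedding_constant * nrm ?f"
    by (rule LIMSEQ_le_const2) (use bound in blast)
  then show ?thesis by (simp add: M_total)
qed

end

section \<open>Composition operators in Schatten classes\<close>

lemma powr_summable_mono:
  fixes s :: "nat \<Rightarrow> real"
  assumes "decseq s" "s \<longlonglongrightarrow> 0" "summable (\<lambda>n. s n powr p)" "p \<le> q"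
  shows "summable (\<lambda>n. s n powr q)"
proof -
  have nonneg: "0 \<le> s n" for n using assms(1,2) by (rule decseq_ge)
  have "\<forall>\<^sub>F n in sequentially. s n < 1" using assms(2) by (rule order_tendstoD) simp
  then have "\<forall>\<^sub>F n in sequentially. norm (s n powr q) \<le> s n powr p"
    by eventually_elim (use nonneg assms(4) in \<open>auto intro!: powr_mono'\<close>)
  then show ?thesis using assms(3) by (rule summable_comparison_test_ev)
qed

theorem theorem4p1:
  fixes \<phi> :: "complex \<Rightarrow> complex" and \<alpha> p :: real
  assumes "\<phi> holomorphic_on ball 0 1" and "\<phi> ` ball 0 1 \<subseteq> ball 0 1"
    and "0 < \<alpha>" and "\<alpha> < 1"
    and "0 < p" and "p \<le> 2 / (1 - \<alpha>)"
    and "composition_operator \<phi> \<in>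
           schatten_class_on (dirichlet_space \<alpha>) (dirichlet_inner \<alpha>) p"
  shows "capacity \<alpha> (contact_set \<phi>) = 0"
proof -
  interpret dirichlet_weight \<alpha> using assms by unfold_locales
  let ?T = "composition_operator \<phi>"
  obtain s where compact: "compact_operator_on H ip ?T" and s: "singular_numbers_on H ip ?T s"
    and sp: "summable (\<lambda>n. s n powr p)"
    using assms(7) by (auto simp: schatten_class_on_def)
  interpret T: compact_operator H ip ?T by unfold_locales (rule compact)
  define q where "q = 2 / (1 - \<alpha>)"
  have q: "2 \<le> q" using \<alpha>0 \<alpha>1 by (simp add: q_def field_simps)
  have sq: "summable (\<lambda>n. s n powr q)"
    using s sp assms(6) unfolding singular_numbers_on_def q_def by (blast intro: powr_summable_mono[of s p])
  have infinite_energy: "energy \<alpha> M = \<top>"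
    if F: "closed F" "F \<subseteq> contact_set \<phi>" and M: "M \<in> circle_prob_measures F" for F M
  proof (rule ccontr)
    assume fin: "energy \<alpha> M \<noteq> \<top>"
    have "prob_space M" "sets M = sets (restrict_space borel (sphere 0 1))"
      using M by (simp_all add: circle_prob_measures_def)
    then interpret circle_measure \<alpha> M
      by (intro circle_measure.intro circle_measure_axioms.intro dirichlet_weight_axioms)
    let ?K = embedding_constant
    have ge: "1 \<le> ?K * nrm (?T (monomial n))" for n
      by (rule norm_composed_power_ge[OF assms(1,2) F _ summable_of_finite_energy[OF fin]])
        (use M in \<open>auto simp: circle_prob_measures_def monomial_in_H\<close>)
    have K: "0 < ?K"
    proof (rule ccontr)
      assume "\<not> 0 < ?K"
      then have "?K * nrm (?T (monomial 0)) \<le> 0"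
        by (intro mult_nonpos_nonneg) (auto simp: monomial_in_H)
      then show False using ge[of 0] by simp
    qed
    obtain c where c: "0 < c" "\<And>n. 0 < n \<Longrightarrow> c * real n powr (\<alpha> - 1) \<le> kernel_coeff n"
      using kernel_coeff_bounds by metis
    \<comment> \<open>The exponent \<open>q\<close> turns the lower bound of order \<open>n\<^bsup>(\<alpha> - 1) / 2\<^esup>\<close> into the harmonic series.\<close>
    define b where "b = (sqrt (c / 2) / ?K) powr q"
    have b: "0 < b" using c K by (simp add: b_def)
    have lower: "b * (1 / real n) \<le> nrm (?T (basis n)) powr q" if n: "0 < n" for n
    proof -
      have "c * real n powr (\<alpha> - 1) * weight n \<le> kernel_coeff n * weight n"
        using c(2)[OF n] weight_pos[of n] by (intro mult_right_mono) auto
      also have "\<dots> \<le> 2" using weight_le[of n] kernel_coeff_pos[of n] by (simp add: field_simps)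
      finally have "c / 2 * real n powr (\<alpha> - 1) \<le> 1 / weight n"
        using weight_pos[of n] by (simp add: field_simps)
      then have "sqrt (c / 2 * real n powr (\<alpha> - 1)) \<le> sqrt (1 / weight n)" by (rule real_sqrt_le_mono)
      then have sq_le: "sqrt (c / 2) * real n powr ((\<alpha> - 1) / 2) \<le> 1 / sqrt (weight n)"
        by (simp add: real_sqrt_mult real_sqrt_divide powr_half_sqrt[symmetric] powr_powr)
      have "sqrt (c / 2) / ?K * real n powr ((\<alpha> - 1) / 2) \<le> 1 / sqrt (weight n) * (1 / ?K)"
        using sq_le K by (simp add: field_simps)
      also have "\<dots> \<le> 1 / sqrt (weight n) * nrm (?T (monomial n))"
        using ge[of n] K weight_pos[of n] by (intro mult_left_mono) (auto simp: field_simps)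
      also have "\<dots> = nrm (?T (basis n))"
        using weight_pos[of n]
        by (simp add: basis_def T.T_scale monomial_in_H nrm_scale norm_divide less_imp_le)
      finally have "(sqrt (c / 2) / ?K * real n powr ((\<alpha> - 1) / 2)) powr q \<le> nrm (?T (basis n)) powr q"
        using q c K by (intro powr_mono2) auto
      moreover have "(sqrt (c / 2) / ?K * real n powr ((\<alpha> - 1) / 2)) powr q = b * (1 / real n)"
      proof -
        have "(\<alpha> - 1) / 2 * q = -1" using \<alpha>1 by (simp add: q_def field_simps)
        then have "(real n powr ((\<alpha> - 1) / 2)) powr q = 1 / real n"
          using n by (simp add: powr_powr powr_minus_divide)
        then show ?thesis using c K unfolding b_def by (subst powr_mult) auto
      qed
      ultimately show ?thesis by simp
    qed
    have "summable (\<lambda>n. nrm (?T (basis n)) powr q)"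
      by (rule summableI_nonneg_bounded[where x = "\<Sum>n. s n powr q"])
        (auto intro!: T.sum_nrm_T_powr_le[OF s sq q] basis_in_H basis_orthonormal)
    then have "summable (\<lambda>n. b * (1 / real n))"
    proof (rule summable_comparison_test'[where N = 1])
      show "norm (b * (1 / real n)) \<le> nrm (?T (basis n)) powr q" if "n \<ge> 1" for n
        using lower[of n] that b by simp
    qed
    then have "summable (\<lambda>n. 1 / real n)" using b by (subst (asm) summable_cmult_iff) simp
    then show False using not_summable_harmonic[where 'a = real] by (simp add: inverse_eq_divide)
  qed
  have "closed_capacity \<alpha> F = 0" if "closed F" "F \<subseteq> contact_set \<phi>" for F
  proof -
    have "(INF \<mu>\<in>circle_prob_measures F. energy \<alpha> \<mu>) = \<top>"
    proof (rule antisym[OF top_greatest INF_greatest])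
      show "\<top> \<le> energy \<alpha> \<mu>" if "\<mu> \<in> circle_prob_measures F" for \<mu>
        using infinite_energy[OF \<open>closed F\<close> \<open>F \<subseteq> contact_set \<phi>\<close> that] by simp
    qed
    then show ?thesis by (simp add: closed_capacity_def)
  qed
  then show ?thesis unfolding capacity_def by (auto intro!: SUP_eq_const simp: bot_ennreal[symmetric])
qed

end
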